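(* Let $E$ be an infinite dimensional Fréchet nuclear space, $\mu$ a Gaussian measure on $(E',\mathcal{S}_E)$ with covariance operator $\mathfrak{C}$, and $1\le p<\infty$. Then for every complete system $(\xi_n)_{n\in\mathbb{N}}\subset E$ the operator $$\mathfrak{F}_p:\mathscr{L}^p(\mathfrak{H})\to L^p(E',\mu),\qquad (f_n)_{n\in\mathbb{N}}\mapsto\lim_{n\to\infty}\varphi_n^*(f_n),$$ is an isometric isomorphism with inverse $$\mathfrak{F}_p^{-1}:L^p(E',\mu)\to\mathscr{L}^p(\mathfrak{H}),\qquad f\mapsto\big([\varphi_n^*]^{-1}(\mathbb{E}_n(f))\big)_{n\in\mathbb{N}}.$$ Consequently, when the $\xi_n$ are linearly independent, for each $f\in L^1(E',\mu)$ there exists a sequence $(f_n)_{n\in\mathbb{N}}\in\prod_{n\in\mathbb{N}}L^1(H_n^a,\mu_n)$ such that $$\int_{E'}f\,\mathrm{d}\mu=\lim_{n\to\infty}\int_{H_n^a}f_n(\mathbf{x})\,\frac{\exp\{-\frac12\sum_{i,j=1}^n\mathfrak{C}^{-1}_{ij}x_ix_j\}}{\sqrt{(2\pi)^n\det[\mathfrak{C}_{H_n}]}}\,\mathrm{d}^n\mathbf{x}.$$ Moreover, the sequence can be chosen to be $f_n=[\varphi_n^*]^{-1}(\mathbb{E}_n(f))$ for each $n\in\mathbb{N}$.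
   Context: $E$ is a real space, $E'$ its topological dual. For $\xi\in E$ let $\xi_*:E'\to\mathbb{R}$, $\xi_*(\ell)=\ell(\xi)$, and $\mathcal{S}_E=\sigma(\{\xi_*^{-1}(B):\xi\in E,\ B\subset\mathbb{R}\text{ Borel}\})$. A measure $\mu$ on $(E',\mathcal{S}_E)$ is Gaussian with covariance operator $\mathfrak{C}$ if $\mathfrak{C}(\cdot,\cdot)$ is an inner product on $E$ and $\int_{E'}e^{i\ell(\xi)}\,\mathrm{d}\mu(\ell)=e^{-\frac12\mathfrak{C}(\xi,\xi)}$ for all $\xi\in E$. A complete system is a sequence $(\xi_n)_{n\in\mathbb{N}}\subset E$ with $\operatorname{span}\{\xi_n:n\in\mathbb{N}\}$ dense in $E$. Put $H_n=\operatorname{span}\{\xi_1,\dots,\xi_n\}$, $H_n^a$ its algebraic dual, $\mu_n$ the Borel measure on $H_n^a$ with $\int_{H_n^a}e^{i\ell(\xi)}\mathrm{d}\mu_n(\ell)=e^{-\frac12\mathfrak{C}(\xi,\xi)}$ for $\xi\in H_n$, $\pi_{nm}:H_m^a\to H_n^a$, $\pi_{nm}(\ell)=\ell|_{H_n}$ for $n\le m$, and $\varphi_n:E'\to H_n^a$, $\varphi_n(\ell)=\ell|_{H_n}$. These maps are measure preserving. $L^p$ spaces are of real-valued functions, $f^*(u)=u\circ f$. $\mathbb{E}_n(f)=\mathbb{E}[f\,|\,\mathcal{B}^n]$ is the conditional expectation with respect to $\mathcal{B}^n=\{\varphi_n^{-1}(B):B\subset H_n^a\text{ Borel}\}$; it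 lies in the range of the isometry $\varphi_n^*$. $\mathfrak{H}$ denotes the diagram $(H_n^a,\mu_n,\pi_{nm})$. A sequence $(f_n)_n\in\prod_nL^p(H_n^a,\mu_n)$ is co-Cauchy if for every $\varepsilon>0$ there is $\ell\in\mathbb{N}$ with $\|\pi_{nm}^*(f_n)-f_m\|_{L^p(\mu_m)}<\varepsilon$ whenever $\ell\le n\le m$. $\mathscr{L}^p(\mathfrak{H})$ is the vector space of co-Cauchy sequences modulo $(f_n)\sim(g_n)$ iff $\lim_n\|f_n-g_n\|_{L^p(\mu_n)}=0$, with norm $\lim_n\|f_n\|_{L^p(\mu_n)}$. In the integral formula $\{\xi_1,\dots,\xi_n\}$ is a basis of $H_n$, $H_n^a\simeq\mathbb{R}^n$ via $\ell\mapsto\mathbf{x}=(\ell(\xi_1),\dots,\ell(\xi_n))$, $\mathfrak{C}_{H_n}=(\mathfrak{C}(\xi_i,\xi_j))_{1\le i,j\le n}$, $(\mathfrak{C}^{-1}_{ij})$ is the inverse matrix of $\mathfrak{C}_{H_n}$, and $\mathrm{d}^n\mathbf{x}$ is Lebesgue measure on $\mathbb{R}^n$. *)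

theory Defs
  imports
    "HOL-Probability.Probability"
    "Jordan_Normal_Form.Gauss_Jordan_Elimination"
    "Jordan_Normal_Form.Determinant"
begin

definition seminorm :: "('e::real_vector \<Rightarrow> real) \<Rightarrow> bool" where
  "seminorm p \<longleftrightarrow> (\<forall>x y. p (x + y) \<le> p x + p y) \<and> (\<forall>a x. p (a *\<^sub>R x) = \<bar>a\<bar> * p x)"

definition seminorm_Cauchy :: "('e::real_vector \<Rightarrow> real) \<Rightarrow> (nat \<Rightarrow> 'e) \<Rightarrow> bool" where
  "seminorm_Cauchy p X \<longleftrightarrow> (\<forall>\<epsilon>>0. \<exists>N. \<forall>m\<ge>N. \<forall>n\<ge>N. p (X m - X n) < \<epsilon>)"

text \<open>
  The topology is generated by a countable separating family of seminorms, for which the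
  space is complete.
\<close>
definition frechet_space :: "'e::{real_vector,topological_space} itself \<Rightarrow> bool" where
  "frechet_space _ \<longleftrightarrow>
    (\<exists>P :: nat \<Rightarrow> 'e \<Rightarrow> real.
       (\<forall>i. seminorm (P i)) \<and>
       (\<forall>U. open U \<longleftrightarrow>
          (\<forall>x\<in>U. \<exists>F \<epsilon>. finite F \<and> \<epsilon> > 0 \<and> {y. \<forall>i\<in>F. P i (y - x) < \<epsilon>} \<subseteq> U)) \<and>
       (\<forall>x. x \<noteq> 0 \<longrightarrow> (\<exists>i. P i x \<noteq> 0)) \<and>
       (\<forall>X. (\<forall>i. seminorm_Cauchy (P i) X) \<longrightarrow> (\<exists>x. X \<longlonglongrightarrow> x)))"

text \<open>
  For seminorms \<open>p \<le> q\<close> let \<open>E\<^sub>p\<close>, \<open>E\<^sub>q\<close> be the completions of \<open>E\<close> modulo the null space of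
  \<open>p\<close>, \<open>q\<close>. The following says that the canonical map from \<open>E\<^sub>q\<close> to \<open>E\<^sub>p\<close> is a nuclear operator
  \<open>x \<mapsto> (\<Sum>k. l k x * y k)\<close>, where \<open>(\<Sum>k. \<parallel>l k\<parallel> * \<parallel>y k\<parallel>) < \<infinity>\<close>. A functional in the dual of
  \<open>E\<^sub>q\<close> is given by its values on \<open>E\<close>, with norm at most \<open>c k\<close>; an element of \<open>E\<^sub>p\<close> is
  represented by a \<open>p\<close>-Cauchy sequence \<open>y k\<close> in \<open>E\<close>, with norm \<open>lim (\<lambda>j. p (y k j))\<close>.
\<close>
definition nuclear_canonical_map ::
    "('e::real_vector \<Rightarrow> real) \<Rightarrow> ('e \<Rightarrow> real) \<Rightarrow> bool" where
  "nuclear_canonical_map q p \<longleftrightarrow>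
    (\<exists>(l :: nat \<Rightarrow> 'e \<Rightarrow> real) (c :: nat \<Rightarrow> real) (y :: nat \<Rightarrow> nat \<Rightarrow> 'e).
       (\<forall>k. linear (l k) \<and> 0 \<le> c k \<and> (\<forall>x. \<bar>l k x\<bar> \<le> c k * q x)) \<and>
       (\<forall>k. seminorm_Cauchy p (y k)) \<and>
       summable (\<lambda>k. c k * lim (\<lambda>j. p (y k j))) \<and>
       (\<forall>x. (\<lambda>n. lim (\<lambda>j. p (x - (\<Sum>k<n. l k x *\<^sub>R y k j)))) \<longlonglongrightarrow> 0))"

definition nuclear_space :: "'e::{real_vector,topological_space} itself \<Rightarrow> bool" where
  "nuclear_space _ \<longleftrightarrow>
    (\<forall>p :: 'e \<Rightarrow> real. seminorm p \<and> continuous_on UNIV p \<longrightarrow>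
       (\<exists>q. seminorm q \<and> continuous_on UNIV q \<and> (\<forall>x. p x \<le> q x) \<and> nuclear_canonical_map q p))"

definition infinite_dimensional :: "'e::real_vector itself \<Rightarrow> bool" where
  "infinite_dimensional _ \<longleftrightarrow> \<not> (\<exists>B :: 'e set. finite B \<and> span B = UNIV)"

definition top_dual :: "('e::{real_vector,topological_space} \<Rightarrow> real) set" where
  "top_dual = {l. linear l \<and> continuous_on UNIV l}"

definition cylinder_algebra :: "('e::{real_vector,topological_space} \<Rightarrow> real) measure" where
  "cylinder_algebra =
    sigma top_dual {{l \<in> top_dual. l x \<in> B} | x B. B \<in> sets (borel :: real measure)}"

definition inner_product :: "('e::real_vector \<Rightarrow> 'e \<Rightarrow> real) \<Rightarrow> bool" where
  "inner_product C \<longleftrightarrow>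
    bilinear C \<and> (\<forall>x y. C x y = C y x) \<and> (\<forall>x. x \<noteq> 0 \<longrightarrow> C x x > 0)"

definition gaussian_char ::
    "('e::real_vector \<Rightarrow> 'e \<Rightarrow> real) \<Rightarrow> 'e set \<Rightarrow> ('e \<Rightarrow> real) measure \<Rightarrow> bool" where
  "gaussian_char C V M \<longleftrightarrow>
    (\<forall>x\<in>V. (CLINT l|M. iexp (l x)) = complex_of_real (exp (- C x x / 2)))"

definition gaussian_measure ::
    "('e::{real_vector,topological_space} \<Rightarrow> 'e \<Rightarrow> real) \<Rightarrow> ('e \<Rightarrow> real) measure \<Rightarrow> bool" where
  "gaussian_measure C \<mu> \<longleftrightarrow>
    sets \<mu> = sets cylinder_algebra \<and> inner_product C \<and> gaussian_char C UNIV \<mu>"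

text \<open>Elements of the algebraic dual of a subspace \<open>V\<close> are \<open>undefined\<close> outside \<open>V\<close>.\<close>
definition alg_dual :: "'e::real_vector set \<Rightarrow> ('e \<Rightarrow> real) set" where
  "alg_dual V = {l \<in> extensional V.
     (\<forall>x\<in>V. \<forall>y\<in>V. l (x + y) = l x + l y) \<and> (\<forall>a. \<forall>x\<in>V. l (a *\<^sub>R x) = a * l x)}"

text \<open>
  For finite-dimensional \<open>V\<close>, the vector space topology of the algebraic dual is that of
  pointwise convergence on \<open>V\<close>.
\<close>
definition alg_dual_topology :: "'e::real_vector set \<Rightarrow> ('e \<Rightarrow> real) topology" where
  "alg_dual_topology V = subtopology (product_topology (\<lambda>_. euclideanreal) V) (alg_dual V)"

definition alg_dual_borel :: "'e::real_vector set \<Rightarrow> ('e \<Rightarrow> real) measure" where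
  "alg_dual_borel V = sigma (alg_dual V) {U. openin (alg_dual_topology V) U}"

definition complete_system :: "(nat \<Rightarrow> 'e::{real_vector,topological_space}) \<Rightarrow> bool" where
  "complete_system \<xi> \<longleftrightarrow> closure (span (range \<xi>)) = UNIV"

text \<open>
  Sequences are indexed from \<open>0\<close>: \<open>\<xi> n\<close> is the vector with number \<open>n + 1\<close>, and \<open>fin_span \<xi> n\<close>
  is spanned by the first \<open>n + 1\<close> vectors.
\<close>
definition fin_span :: "(nat \<Rightarrow> 'e::real_vector) \<Rightarrow> nat \<Rightarrow> 'e set" where
  "fin_span \<xi> n = span (\<xi> ` {..n})"

definition fin_dim_gaussian ::
    "('e::real_vector \<Rightarrow> 'e \<Rightarrow> real) \<Rightarrow> 'e set \<Rightarrow> ('e \<Rightarrow> real) measure \<Rightarrow> bool" where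
  "fin_dim_gaussian C V M \<longleftrightarrow> sets M = sets (alg_dual_borel V) \<and> gaussian_char C V M"

definition proj ::
    "(nat \<Rightarrow> 'e::real_vector) \<Rightarrow> nat \<Rightarrow> nat \<Rightarrow> ('e \<Rightarrow> real) \<Rightarrow> ('e \<Rightarrow> real)" where
  "proj \<xi> n m l = restrict l (fin_span \<xi> n)"

definition phi :: "(nat \<Rightarrow> 'e::real_vector) \<Rightarrow> nat \<Rightarrow> ('e \<Rightarrow> real) \<Rightarrow> ('e \<Rightarrow> real)" where
  "phi \<xi> n l = restrict l (fin_span \<xi> n)"

record 'v normed_structure =
  vcarrier :: "'v set"
  vadd :: "'v \<Rightarrow> 'v \<Rightarrow> 'v"
  vscale :: "real \<Rightarrow> 'v \<Rightarrow> 'v"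
  vnorm :: "'v \<Rightarrow> real"

definition vdist :: "'v normed_structure \<Rightarrow> 'v \<Rightarrow> 'v \<Rightarrow> real" where
  "vdist X u v = vnorm X (vadd X u (vscale X (- 1) v))"

definition isometric_isomorphism ::
    "'v normed_structure \<Rightarrow> 'w normed_structure \<Rightarrow> ('v \<Rightarrow> 'w) \<Rightarrow> bool" where
  "isometric_isomorphism X Y T \<longleftrightarrow>
    bij_betw T (vcarrier X) (vcarrier Y) \<and>
    (\<forall>u\<in>vcarrier X. \<forall>v\<in>vcarrier X. T (vadd X u v) = vadd Y (T u) (T v)) \<and>
    (\<forall>a. \<forall>u\<in>vcarrier X. T (vscale X a u) = vscale Y a (T u)) \<and>
    (\<forall>u\<in>vcarrier X. vnorm Y (T u) = vnorm X u)"

definition Lp_fun :: "real \<Rightarrow> 'a measure \<Rightarrow> ('a \<Rightarrow> real) set" where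
  "Lp_fun p M = {f \<in> borel_measurable M. integrable M (\<lambda>x. \<bar>f x\<bar> powr p)}"

definition Lp_class :: "real \<Rightarrow> 'a measure \<Rightarrow> ('a \<Rightarrow> real) \<Rightarrow> ('a \<Rightarrow> real) set" where
  "Lp_class p M f = {g \<in> Lp_fun p M. AE x in M. g x = f x}"

definition Lp :: "real \<Rightarrow> 'a measure \<Rightarrow> ('a \<Rightarrow> real) set normed_structure" where
  "Lp p M =
    \<lparr>vcarrier = Lp_class p M ` Lp_fun p M,
     vadd = (\<lambda>A B. \<Union>f\<in>A. \<Union>g\<in>B. Lp_class p M (\<lambda>x. f x + g x)),
     vscale = (\<lambda>a A. \<Union>f\<in>A. Lp_class p M (\<lambda>x. a * f x)),
     vnorm = (\<lambda>A. the_elem ((\<lambda>f. (LINT x|M. \<bar>f x\<bar> powr p) powr (1 / p)) ` A))\<rparr>"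

text \<open>The pullback of a class along \<open>h\<close>; \<open>M\<close> is the measure on the domain of \<open>h\<close>.\<close>
definition Lp_pullback ::
    "real \<Rightarrow> 'a measure \<Rightarrow> ('a \<Rightarrow> 'b) \<Rightarrow> ('b \<Rightarrow> real) set \<Rightarrow> ('a \<Rightarrow> real) set" where
  "Lp_pullback p M h A = (\<Union>u\<in>A. Lp_class p M (u \<circ> h))"

definition Lp_cond_exp ::
    "real \<Rightarrow> 'a measure \<Rightarrow> 'a measure \<Rightarrow> ('a \<Rightarrow> real) set \<Rightarrow> ('a \<Rightarrow> real) set" where
  "Lp_cond_exp p M F A = (\<Union>f\<in>A. Lp_class p M (real_cond_exp M F f))"

definition co_Cauchy ::
    "real \<Rightarrow> (nat \<Rightarrow> 'a measure) \<Rightarrow> (nat \<Rightarrow> nat \<Rightarrow> 'a \<Rightarrow> 'a) \<Rightarrow> (nat \<Rightarrow> ('a \<Rightarrow> real) set) set" where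
  "co_Cauchy p M \<pi> =
    {f. (\<forall>n. f n \<in> vcarrier (Lp p (M n))) \<and>
        (\<forall>\<epsilon>>0. \<exists>k. \<forall>n m. k \<le> n \<and> n \<le> m \<longrightarrow>
           vdist (Lp p (M m)) (Lp_pullback p (M m) (\<pi> n m) (f n)) (f m) < \<epsilon>)}"

definition co_class ::
    "real \<Rightarrow> (nat \<Rightarrow> 'a measure) \<Rightarrow> (nat \<Rightarrow> nat \<Rightarrow> 'a \<Rightarrow> 'a) \<Rightarrow>
     (nat \<Rightarrow> ('a \<Rightarrow> real) set) \<Rightarrow> (nat \<Rightarrow> ('a \<Rightarrow> real) set) set" where
  "co_class p M \<pi> f = {g \<in> co_Cauchy p M \<pi>. (\<lambda>n. vdist (Lp p (M n)) (f n) (g n)) \<longlonglongrightarrow> 0}"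

definition co_Lp ::
    "real \<Rightarrow> (nat \<Rightarrow> 'a measure) \<Rightarrow> (nat \<Rightarrow> nat \<Rightarrow> 'a \<Rightarrow> 'a) \<Rightarrow>
     (nat \<Rightarrow> ('a \<Rightarrow> real) set) set normed_structure" where
  "co_Lp p M \<pi> =
    \<lparr>vcarrier = co_class p M \<pi> ` co_Cauchy p M \<pi>,
     vadd = (\<lambda>A B. \<Union>f\<in>A. \<Union>g\<in>B. co_class p M \<pi> (\<lambda>n. vadd (Lp p (M n)) (f n) (g n))),
     vscale = (\<lambda>a A. \<Union>f\<in>A. co_class p M \<pi> (\<lambda>n. vscale (Lp p (M n)) a (f n))),
     vnorm = (\<lambda>A. the_elem ((\<lambda>f. lim (\<lambda>n. vnorm (Lp p (M n)) (f n))) ` A))\<rparr>"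

definition Lp_limit ::
    "real \<Rightarrow> 'a measure \<Rightarrow> (nat \<Rightarrow> ('a \<Rightarrow> real) set) \<Rightarrow> ('a \<Rightarrow> real) set \<Rightarrow> bool" where
  "Lp_limit p M u v \<longleftrightarrow> v \<in> vcarrier (Lp p M) \<and> (\<lambda>n. vdist (Lp p M) (u n) v) \<longlonglongrightarrow> 0"

definition F_op ::
    "real \<Rightarrow> (nat \<Rightarrow> 'e::{real_vector,topological_space}) \<Rightarrow> ('e \<Rightarrow> real) measure \<Rightarrow>
     (nat \<Rightarrow> (('e \<Rightarrow> real) \<Rightarrow> real) set) set \<Rightarrow> (('e \<Rightarrow> real) \<Rightarrow> real) set" where
  "F_op p \<xi> \<mu> A =
    (THE v. \<forall>f\<in>A. Lp_limit p \<mu> (\<lambda>n. Lp_pullback p \<mu> (phi \<xi> n) (f n)) v)"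

text \<open>The sigma-algebra of preimages under \<open>phi \<xi> n\<close> of the Borel subsets of its codomain.\<close>
definition fin_algebra ::
    "(nat \<Rightarrow> 'e::{real_vector,topological_space}) \<Rightarrow> nat \<Rightarrow> ('e \<Rightarrow> real) measure" where
  "fin_algebra \<xi> n = vimage_algebra top_dual (phi \<xi> n) (alg_dual_borel (fin_span \<xi> n))"

definition fin_cond_exp ::
    "real \<Rightarrow> (nat \<Rightarrow> 'e::{real_vector,topological_space}) \<Rightarrow> ('e \<Rightarrow> real) measure \<Rightarrow>
     (nat \<Rightarrow> ('e \<Rightarrow> real) measure) \<Rightarrow> (('e \<Rightarrow> real) \<Rightarrow> real) set \<Rightarrow> nat \<Rightarrow> (('e \<Rightarrow> real) \<Rightarrow> real) set" where
  "fin_cond_exp p \<xi> \<mu> \<mu>n f n =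
    inv_into (vcarrier (Lp p (\<mu>n n))) (Lp_pullback p \<mu> (phi \<xi> n))
      (Lp_cond_exp p \<mu> (fin_algebra \<xi> n) f)"

definition coords :: "(nat \<Rightarrow> 'e::real_vector) \<Rightarrow> nat \<Rightarrow> ('e \<Rightarrow> real) \<Rightarrow> nat \<Rightarrow> real" where
  "coords \<xi> n l = (\<lambda>i\<in>{..n}. l (\<xi> i))"

definition cov_mat ::
    "('e::real_vector \<Rightarrow> 'e \<Rightarrow> real) \<Rightarrow> (nat \<Rightarrow> 'e) \<Rightarrow> nat \<Rightarrow> real Matrix.mat" where
  "cov_mat C \<xi> n = Matrix.mat (Suc n) (Suc n) (\<lambda>(i, j). C (\<xi> i) (\<xi> j))"

definition gaussian_integral ::
    "('e::real_vector \<Rightarrow> 'e \<Rightarrow> real) \<Rightarrow> (nat \<Rightarrow> 'e) \<Rightarrow> nat \<Rightarrow> (('e \<Rightarrow> real) \<Rightarrow> real) \<Rightarrow> real" where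
  "gaussian_integral C \<xi> n u =
    (LINT x|(\<Pi>\<^sub>M i\<in>{..n}. lborel).
       u (inv_into (alg_dual (fin_span \<xi> n)) (coords \<xi> n) x) *
       (exp (- (1 / 2) * (\<Sum>i\<le>n. \<Sum>j\<le>n. the (mat_inverse (cov_mat C \<xi> n)) $$ (i, j) * x i * x j)) /
        sqrt ((2 * pi) ^ Suc n * Determinant.det (cov_mat C \<xi> n))))"

text \<open>The formula is required for all representatives of the classes \<open>f\<close> and \<open>fn n\<close>.\<close>
definition integral_formula ::
    "('e::{real_vector,topological_space} \<Rightarrow> 'e \<Rightarrow> real) \<Rightarrow> (nat \<Rightarrow> 'e) \<Rightarrow> ('e \<Rightarrow> real) measure \<Rightarrow>
     (('e \<Rightarrow> real) \<Rightarrow> real) set \<Rightarrow> (nat \<Rightarrow> (('e \<Rightarrow> real) \<Rightarrow> real) set) \<Rightarrow> bool" where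
  "integral_formula C \<xi> \<mu> f fn \<longleftrightarrow>
    (\<forall>v\<in>f. \<forall>u. (\<forall>n. u n \<in> fn n) \<longrightarrow>
       (\<lambda>n. gaussian_integral C \<xi> n (u n)) \<longlonglongrightarrow> (LINT l|\<mu>. v l))"

end

theory Submission
  imports Defs
begin

text \<open>
  Everything rests on two properties of the restriction maps from \<open>E'\<close> to the duals of the
  finite-dimensional subspaces \<open>H\<^sub>n\<close>, collected in \<open>gaussian_measure_tower\<close>. They preserve measure: a
  finite measure on a space of functionals is determined by its characteristic function
  (\<open>measure_eq_of_same_char\<close>), and the image of \<open>\<mu>\<close> has the characteristic function of \<open>\<mu>n n\<close>. And the
  sigma-algebras that they pull back generate the one of \<open>E'\<close>: a vector \<open>x\<close> is the limit of a sequence in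
  the dense span of the \<open>\<xi> n\<close>, because a Frechet space is first countable, so evaluation at \<open>x\<close> is the
  pointwise limit of evaluations at vectors of the \<open>H\<^sub>n\<close>.

  The isometry then is measure theory (locale \<open>measure_tower\<close>). Pulled back to \<open>E'\<close>, co-Cauchy
  sequences are Cauchy sequences in \<open>L\<^sup>p(\<mu>)\<close> and equivalent ones are those with the same limit. As
  \<open>L\<^sup>p(\<mu>)\<close> is complete (\<open>Lp_complete\<close>), the equivalence classes are the sets of all sequences with a given
  limit \<open>V\<close>, and the limit map is linear, isometric and injective. It is onto, with the stated inverse,
  because the conditional expectations of \<open>f\<close> converge to \<open>f\<close> (\<open>cond_exp_level_tendsto\<close>): functions of
  finitely many evaluations are dense in \<open>L\<^sup>p(\<mu>)\<close>, each of them is fixed by all late conditional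
  expectations, and conditional expectations are contractions. That a conditional expectation at level \<open>n\<close>
  is a function on the dual of \<open>H\<^sub>n\<close> is the Doob-Dynkin lemma (\<open>measurable_vimage_algebra_factor\<close>).

  For the integral formula, conditional expectation keeps the integral, so already each single term
  of the sequence equals the limit (\<open>integral_level_exp\<close>), provided that \<open>\<mu>n n\<close> has the stated density in
  coordinates (\<open>gaussian_integral_eq\<close>). Gram-Schmidt with respect to \<open>C\<close> writes this density as a
  product of one-dimensional normal densities, the mean of each being linear in the earlier variables.
  Its Fourier transform is computed by integrating out one variable after the other, and uniqueness
  for characteristic functions identifies the measure.
\<close>

section \<open>The seminorm of order p and its completeness\<close>

text \<open>
  At positive arguments this is convexity of \<open>x powr p\<close>; at the boundary point \<open>0\<close> it comes from
  \<open>t powr p \<le> t\<close> for \<open>0 < t < 1\<close>. Convexity on the whole line is what both Minkowski's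
  inequality and the conditional Jensen inequality ask for.
\<close>
lemma abs_powr_convex:
  assumes "1 \<le> (p::real)"
  shows "convex_on UNIV (\<lambda>x::real. \<bar>x\<bar> powr p)"
proof (rule convex_onI)
  have pos: "((1 - t) * a + t * b) powr p \<le> (1 - t) * a powr p + t * b powr p"
    if t: "0 < t" "t < 1" and a: "0 \<le> a" and b: "0 \<le> b" for t a b :: real
  proof -
    have le: "s powr p \<le> s" if "0 < s" "s < 1" for s :: real
      using powr_mono'[of 1 p s] assms that by simp
    consider "a = 0" | "b = 0" | "0 < a" "0 < b" using a b by linarith
    then show ?thesis
    proof cases
      case 1
      then show ?thesis using le[of t] t b by (simp add: powr_mult mult_right_mono)
    next
      case 2
      then show ?thesis using le[of "1 - t"] t a by (simp add: powr_mult mult_right_mono)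
    next
      case 3
      then show ?thesis
        using convex_onD[OF powr_convex[OF assms], of t a b] t by simp
    qed
  qed
  fix t x y :: real
  assume t: "0 < t" "t < 1"
  have "\<bar>(1 - t) *\<^sub>R x + t *\<^sub>R y\<bar> \<le> (1 - t) * \<bar>x\<bar> + t * \<bar>y\<bar>"
    using t abs_triangle_ineq[of "(1 - t) * x" "t * y"] by (simp add: abs_mult)
  then have "\<bar>(1 - t) *\<^sub>R x + t *\<^sub>R y\<bar> powr p \<le> ((1 - t) * \<bar>x\<bar> + t * \<bar>y\<bar>) powr p"
    using assms by (intro powr_mono2) auto
  also have "\<dots> \<le> (1 - t) * \<bar>x\<bar> powr p + t * \<bar>y\<bar> powr p"
    by (rule pos) (use t in auto)
  finally show "\<bar>(1 - t) *\<^sub>R x + t *\<^sub>R y\<bar> powr p \<le> (1 - t) * \<bar>x\<bar> powr p + t * \<bar>y\<bar> powr p" .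
qed simp

definition Lp_seminorm :: "real \<Rightarrow> 'a measure \<Rightarrow> ('a \<Rightarrow> real) \<Rightarrow> real" where
  "Lp_seminorm p M f = (LINT x|M. \<bar>f x\<bar> powr p) powr (1 / p)"

lemma Lp_seminorm_nonneg [simp]: "0 \<le> Lp_seminorm p M f"
  by (simp add: Lp_seminorm_def)

lemma Lp_seminorm_minus_commute:
  "Lp_seminorm p M (\<lambda>x. f x - g x) = Lp_seminorm p M (\<lambda>x. g x - f x)"
  by (simp add: Lp_seminorm_def abs_minus_commute)

lemma Lp_fun_measurable: "f \<in> Lp_fun p M \<Longrightarrow> f \<in> borel_measurable M"
  and Lp_fun_integrable: "f \<in> Lp_fun p M \<Longrightarrow> integrable M (\<lambda>x. \<bar>f x\<bar> powr p)"
  by (auto simp: Lp_fun_def)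

lemma Lp_funI:
  "f \<in> borel_measurable M \<Longrightarrow> integrable M (\<lambda>x. \<bar>f x\<bar> powr p) \<Longrightarrow> f \<in> Lp_fun p M"
  by (simp add: Lp_fun_def)

lemma Lp_seminorm_cong_AE:
  assumes "f \<in> borel_measurable M" "g \<in> borel_measurable M" "AE x in M. f x = g x"
  shows "Lp_seminorm p M f = Lp_seminorm p M g"
proof -
  note [measurable] = assms(1,2)
  have "(LINT x|M. \<bar>f x\<bar> powr p) = (LINT x|M. \<bar>g x\<bar> powr p)"
    by (rule integral_cong_AE) (use assms(3) in auto)
  then show ?thesis by (simp add: Lp_seminorm_def)
qed

lemma Lp_fun_scale:
  assumes "f \<in> Lp_fun p M"
  shows "(\<lambda>x. a * f x) \<in> Lp_fun p M"
  using assms by (auto simp: Lp_fun_def abs_mult powr_mult)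

lemma Lp_fun_abs: "f \<in> Lp_fun p M \<Longrightarrow> (\<lambda>x. \<bar>f x\<bar>) \<in> Lp_fun p M"
  by (auto simp: Lp_fun_def)

context
  fixes p :: real
  assumes p: "1 \<le> p"
begin

lemma Lp_seminorm_powr: "Lp_seminorm p M f powr p = (LINT x|M. \<bar>f x\<bar> powr p)"
  using p by (simp add: Lp_seminorm_def powr_powr integral_nonneg_AE)

lemma Lp_seminorm_le_iff:
  assumes "0 \<le> c"
  shows "Lp_seminorm p M f \<le> c \<longleftrightarrow> (LINT x|M. \<bar>f x\<bar> powr p) \<le> c powr p"
proof
  assume "Lp_seminorm p M f \<le> c"
  then show "(LINT x|M. \<bar>f x\<bar> powr p) \<le> c powr p"
    using p powr_mono2[of p "Lp_seminorm p M f" c] by (simp add: Lp_seminorm_powr)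
next
  assume "(LINT x|M. \<bar>f x\<bar> powr p) \<le> c powr p"
  then have "(LINT x|M. \<bar>f x\<bar> powr p) powr (1 / p) \<le> (c powr p) powr (1 / p)"
    using p by (intro powr_mono2) (auto intro: integral_nonneg_AE)
  then show "Lp_seminorm p M f \<le> c"
    using p assms by (simp add: Lp_seminorm_def powr_powr)
qed

lemma Lp_seminorm_eq_0_iff:
  assumes "f \<in> Lp_fun p M"
  shows "Lp_seminorm p M f = 0 \<longleftrightarrow> (AE x in M. f x = 0)"
proof -
  have "Lp_seminorm p M f = 0 \<longleftrightarrow> (LINT x|M. \<bar>f x\<bar> powr p) = 0"
    by (simp add: Lp_seminorm_def)
  also have "\<dots> \<longleftrightarrow> (AE x in M. \<bar>f x\<bar> powr p = 0)"
    by (rule integral_nonneg_eq_0_iff_AE) (use assms in \<open>auto simp: Lp_fun_def\<close>)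
  finally show ?thesis by simp
qed

lemma Lp_seminorm_scale: "Lp_seminorm p M (\<lambda>x. a * f x) = \<bar>a\<bar> * Lp_seminorm p M f"
  using p by (simp add: Lp_seminorm_def abs_mult powr_mult powr_powr integral_nonneg_AE)

lemma Lp_fun_bound:
  assumes "f \<in> borel_measurable M" "w \<in> Lp_fun p M" "AE x in M. \<bar>f x\<bar> \<le> \<bar>w x\<bar>"
  shows "f \<in> Lp_fun p M"
proof (rule Lp_funI)
  note [measurable] = assms(1)
  show "integrable M (\<lambda>x. \<bar>f x\<bar> powr p)"
  proof (rule Bochner_Integration.integrable_bound[OF Lp_fun_integrable[OF assms(2)]])
    show "AE x in M. norm (\<bar>f x\<bar> powr p) \<le> norm (\<bar>w x\<bar> powr p)"
      using assms(3) by eventually_elim (use p in \<open>auto intro!: powr_mono2\<close>)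
  qed measurable
qed (rule assms(1))

lemma Lp_fun_add:
  assumes f: "f \<in> Lp_fun p M" and g: "g \<in> Lp_fun p M"
  shows "(\<lambda>x. f x + g x) \<in> Lp_fun p M"
proof (rule Lp_funI)
  note [measurable] = f[THEN Lp_fun_measurable] g[THEN Lp_fun_measurable]
  show "(\<lambda>x. f x + g x) \<in> borel_measurable M" by measurable
  have le: "\<bar>a + b\<bar> powr p \<le> 1/2 * \<bar>2 * a\<bar> powr p + 1/2 * \<bar>2 * b\<bar> powr p" for a b :: real
    using convex_onD[OF abs_powr_convex[OF p], of "1/2" "2 * a" "2 * b"] by simp
  have "integrable M (\<lambda>x. 1/2 * \<bar>2 * f x\<bar> powr p + 1/2 * \<bar>2 * g x\<bar> powr p)"
    using f[THEN Lp_fun_scale, THEN Lp_fun_integrable] g[THEN Lp_fun_scale, THEN Lp_fun_integrable]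
    by simp
  then show "integrable M (\<lambda>x. \<bar>f x + g x\<bar> powr p)"
    by (rule Bochner_Integration.integrable_bound) (use le in \<open>auto intro!: order_trans[OF le]\<close>)
qed

lemma Lp_fun_diff:
  assumes "f \<in> Lp_fun p M" "g \<in> Lp_fun p M"
  shows "(\<lambda>x. f x - g x) \<in> Lp_fun p M"
  using Lp_fun_add[OF assms(1) Lp_fun_scale[OF assms(2), of "-1"]] by simp

text \<open>
  Minkowski's inequality from convexity: with \<open>a\<close>, \<open>b\<close> the two seminorms, \<open>(f + g) / (a + b)\<close> is the
  convex combination of the normalised functions \<open>f / a\<close> and \<open>g / b\<close> with weights \<open>a / (a + b)\<close> and
  \<open>b / (a + b)\<close>.
\<close>
lemma Lp_seminorm_triangle:
  assumes f: "f \<in> Lp_fun p M" and g: "g \<in> Lp_fun p M"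
  shows "Lp_seminorm p M (\<lambda>x. f x + g x) \<le> Lp_seminorm p M f + Lp_seminorm p M g"
proof -
  note [measurable] = f[THEN Lp_fun_measurable] g[THEN Lp_fun_measurable]
  define a where "a = Lp_seminorm p M f"
  define b where "b = Lp_seminorm p M g"
  consider "a = 0" | "b = 0" | "0 < a" "0 < b"
    by (auto simp: a_def b_def less_le)
  then show ?thesis
  proof cases
    case 1
    then have "AE x in M. f x = 0" using Lp_seminorm_eq_0_iff[OF f] by (simp add: a_def)
    then have "Lp_seminorm p M (\<lambda>x. f x + g x) = Lp_seminorm p M g"
      by (intro Lp_seminorm_cong_AE) auto
    then show ?thesis by simp
  next
    case 2
    then have "AE x in M. g x = 0" using Lp_seminorm_eq_0_iff[OF g] by (simp add: b_def)
    then have "Lp_seminorm p M (\<lambda>x. f x + g x) = Lp_seminorm p M f"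
      by (intro Lp_seminorm_cong_AE) auto
    then show ?thesis by simp
  next
    case 3
    define t where "t = b / (a + b)"
    have t: "0 \<le> t" "t \<le> 1" "1 - t = a / (a + b)" using 3 by (auto simp: t_def field_simps)
    let ?c = "(a + b) powr p"
    have pt: "\<bar>u + v\<bar> powr p \<le> ?c * ((1 - t) * (\<bar>u\<bar> powr p / a powr p) + t * (\<bar>v\<bar> powr p / b powr p))"
      for u v :: real
    proof -
      have "u + v = (a + b) * ((1 - t) * (u / a) + t * (v / b))"
      proof -
        have "(1 - t) * (u / a) = u / (a + b)" "t * (v / b) = v / (a + b)"
          using 3 by (simp_all only: t(3)) (simp_all add: t_def)
        then show ?thesis using 3 by (simp add: add_divide_distrib[symmetric])
      qed
      then have "\<bar>u + v\<bar> powr p = ?c * \<bar>(1 - t) * (u / a) + t * (v / b)\<bar> powr p"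
        using 3 by (metis abs_mult abs_of_pos add_pos_pos powr_mult abs_ge_zero)
      also have "\<dots> \<le> ?c * ((1 - t) * \<bar>u / a\<bar> powr p + t * \<bar>v / b\<bar> powr p)"
        using convex_onD[OF abs_powr_convex[OF p], of t "u / a" "v / b"] t
        by (intro mult_left_mono) auto
      finally show ?thesis using 3 by (simp add: powr_divide)
    qed
    have ap: "(LINT x|M. \<bar>f x\<bar> powr p) = a powr p" "(LINT x|M. \<bar>g x\<bar> powr p) = b powr p"
      by (simp_all add: a_def b_def Lp_seminorm_powr)
    have "(LINT x|M. \<bar>f x + g x\<bar> powr p)
      \<le> (LINT x|M. ?c * ((1 - t) * (\<bar>f x\<bar> powr p / a powr p) + t * (\<bar>g x\<bar> powr p / b powr p)))"
      using Lp_fun_integrable[OF Lp_fun_add[OF f g]] Lp_fun_integrable[OF f] Lp_fun_integrable[OF g] pt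
      by (intro integral_mono) auto
    also have "\<dots> = ?c * ((1 - t) * (a powr p / a powr p) + t * (b powr p / b powr p))"
      using Lp_fun_integrable[OF f] Lp_fun_integrable[OF g] by (simp add: ap)
    also have "\<dots> = ?c" using 3 by simp
    finally show ?thesis
      using 3 by (subst Lp_seminorm_le_iff) (auto simp: a_def b_def)
  qed
qed

lemma Lp_seminorm_triangle_diff:
  assumes "f \<in> Lp_fun p M" "g \<in> Lp_fun p M" "h \<in> Lp_fun p M"
  shows "Lp_seminorm p M (\<lambda>x. f x - h x)
    \<le> Lp_seminorm p M (\<lambda>x. f x - g x) + Lp_seminorm p M (\<lambda>x. g x - h x)"
  using Lp_seminorm_triangle[OF Lp_fun_diff[OF assms(1,2)] Lp_fun_diff[OF assms(2,3)]] by simp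

lemma Lp_seminorm_reverse_triangle:
  assumes f: "f \<in> Lp_fun p M" and g: "g \<in> Lp_fun p M"
  shows "\<bar>Lp_seminorm p M f - Lp_seminorm p M g\<bar> \<le> Lp_seminorm p M (\<lambda>x. f x - g x)"
  using Lp_seminorm_triangle[OF Lp_fun_diff[OF f g] g] Lp_seminorm_triangle[OF Lp_fun_diff[OF g f] f]
  by (simp add: Lp_seminorm_minus_commute[of p M g f])

lemma Lp_dominated_convergence:
  assumes s: "\<And>i. s i \<in> borel_measurable M" and f: "f \<in> borel_measurable M"
    and w: "w \<in> Lp_fun p M"
    and lim: "AE x in M. (\<lambda>i. s i x) \<longlonglongrightarrow> f x"
    and bound: "\<And>i. AE x in M. \<bar>s i x - f x\<bar> \<le> w x"
  shows "(\<lambda>i. Lp_seminorm p M (\<lambda>x. s i x - f x)) \<longlonglongrightarrow> 0"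
proof -
  note [measurable] = s f w[THEN Lp_fun_measurable]
  have "(\<lambda>i. LINT x|M. \<bar>s i x - f x\<bar> powr p) \<longlonglongrightarrow> (LINT x|M. 0)"
  proof (rule integral_dominated_convergence[OF _ _ Lp_fun_integrable[OF w]])
    show "AE x in M. (\<lambda>i. \<bar>s i x - f x\<bar> powr p) \<longlonglongrightarrow> 0"
      using lim
    proof eventually_elim
      case (elim x)
      then have "(\<lambda>i. \<bar>s i x - f x\<bar>) \<longlonglongrightarrow> 0"
        using LIM_zero tendsto_rabs_zero by blast
      then show ?case using p by (intro tendsto_zero_powrI[where b = p]) auto
    qed
    show "AE x in M. norm (\<bar>s i x - f x\<bar> powr p) \<le> \<bar>w x\<bar> powr p" for i
      using bound[of i] by eventually_elim (use p in \<open>auto intro!: powr_mono2\<close>)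
  qed measurable
  then have "(\<lambda>i. LINT x|M. \<bar>s i x - f x\<bar> powr p) \<longlonglongrightarrow> 0" by simp
  then show ?thesis
    unfolding Lp_seminorm_def using p
    by (intro tendsto_zero_powrI[where b = "1 / p"]) (auto intro: integral_nonneg_AE)
qed

lemma nn_integral_Lp_seminorm:
  assumes "f \<in> Lp_fun p M"
  shows "(\<integral>\<^sup>+x. ennreal (\<bar>f x\<bar> powr p) \<partial>M) = ennreal (Lp_seminorm p M f powr p)"
  unfolding Lp_seminorm_powr
  by (rule nn_integral_eq_integral[OF Lp_fun_integrable[OF assms]]) auto

lemma Lp_Fatou:
  assumes h: "\<And>k. h k \<in> Lp_fun p M" and f: "f \<in> borel_measurable M"
    and lim: "AE x in M. (\<lambda>k. h k x) \<longlonglongrightarrow> f x"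
    and bound: "\<forall>\<^sub>F k in sequentially. Lp_seminorm p M (h k) \<le> c"
  shows "f \<in> Lp_fun p M \<and> Lp_seminorm p M f \<le> c"
proof -
  note [measurable] = h[THEN Lp_fun_measurable] f
  obtain k where "Lp_seminorm p M (h k) \<le> c"
    using bound by (meson eventually_sequentially order_refl)
  then have c: "0 \<le> c" using Lp_seminorm_nonneg order_trans by blast
  have "(\<integral>\<^sup>+x. ennreal (\<bar>f x\<bar> powr p) \<partial>M) = (\<integral>\<^sup>+x. liminf (\<lambda>k. ennreal (\<bar>h k x\<bar> powr p)) \<partial>M)"
  proof (rule nn_integral_cong_AE)
    show "AE x in M. ennreal (\<bar>f x\<bar> powr p) = liminf (\<lambda>k. ennreal (\<bar>h k x\<bar> powr p))"
      using lim
    proof eventually_elim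
      case (elim x)
      have "(\<lambda>k. \<bar>h k x\<bar> powr p) \<longlonglongrightarrow> \<bar>f x\<bar> powr p"
        by (rule tendsto_powr'[OF tendsto_rabs[OF elim] tendsto_const]) (use p in auto)
      then have "(\<lambda>k. ennreal (\<bar>h k x\<bar> powr p)) \<longlonglongrightarrow> ennreal (\<bar>f x\<bar> powr p)"
        by (intro tendsto_ennrealI)
      then show ?case by (rule lim_imp_Liminf[OF trivial_limit_sequentially, symmetric])
    qed
  qed
  also have "\<dots> \<le> liminf (\<lambda>k. \<integral>\<^sup>+x. ennreal (\<bar>h k x\<bar> powr p) \<partial>M)"
    by (rule nn_integral_liminf) measurable
  also have "\<dots> \<le> ennreal (c powr p)"
  proof (rule Liminf_le)
    show "\<forall>\<^sub>F k in sequentially. (\<integral>\<^sup>+x. ennreal (\<bar>h k x\<bar> powr p) \<partial>M) \<le> ennreal (c powr p)"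
      using bound by eventually_elim (use h p in \<open>auto simp: nn_integral_Lp_seminorm intro!: ennreal_leI powr_mono2\<close>)
  qed simp
  finally have le: "(\<integral>\<^sup>+x. ennreal (\<bar>f x\<bar> powr p) \<partial>M) \<le> ennreal (c powr p)" .
  have "f \<in> Lp_fun p M"
    by (rule Lp_funI[OF f], rule integrableI_bounded)
       (use le in \<open>auto intro: le_less_trans[OF _ ennreal_less_top]\<close>)
  moreover from this have "Lp_seminorm p M f powr p \<le> c powr p"
    using le by (simp add: nn_integral_Lp_seminorm)
  then have "Lp_seminorm p M f \<le> c"
    using c by (subst Lp_seminorm_le_iff) (auto simp: Lp_seminorm_powr)
  ultimately show ?thesis by blast
qed

lemma Lp_sum_seminorm_le:
  assumes "finite I" "\<And>i. i \<in> I \<Longrightarrow> f i \<in> Lp_fun p M"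
  shows "(\<lambda>x. \<Sum>i\<in>I. f i x) \<in> Lp_fun p M
    \<and> Lp_seminorm p M (\<lambda>x. \<Sum>i\<in>I. f i x) \<le> (\<Sum>i\<in>I. Lp_seminorm p M (f i))"
  using assms
proof (induction I rule: finite_induct)
  case empty
  then show ?case using p by (simp add: Lp_fun_def Lp_seminorm_def)
next
  case (insert i I)
  then show ?case
    using Lp_fun_add[of "f i" M "\<lambda>x. \<Sum>i\<in>I. f i x"]
      Lp_seminorm_triangle[of "f i" M "\<lambda>x. \<Sum>i\<in>I. f i x"] by force
qed

text \<open>
  By Minkowski's inequality the partial sums of \<open>\<bar>d k\<bar>\<close> have seminorm at most the sum of the
  series, so by monotone convergence their supremum has a finite integral in \<open>p\<close>-th power and is
  therefore finite almost everywhere.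
\<close>
lemma Lp_AE_summable:
  assumes d: "\<And>k. d k \<in> Lp_fun p M" and sum: "summable (\<lambda>k. Lp_seminorm p M (d k))"
  shows "AE x in M. summable (\<lambda>k. \<bar>d k x\<bar>)"
proof -
  note [measurable] = d[THEN Lp_fun_measurable]
  let ?S = "\<lambda>n x. \<Sum>k<n. \<bar>d k x\<bar>"
  let ?c = "\<Sum>k. Lp_seminorm p M (d k)"
  have S: "?S n \<in> Lp_fun p M \<and> Lp_seminorm p M (?S n) \<le> ?c" for n
  proof -
    have "Lp_seminorm p M (\<lambda>x. \<bar>d k x\<bar>) = Lp_seminorm p M (d k)" for k
      by (simp add: Lp_seminorm_def)
    moreover have "(\<Sum>k<n. Lp_seminorm p M (d k)) \<le> ?c"
      by (rule sum_le_suminf[OF sum]) auto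
    ultimately show ?thesis
      using Lp_sum_seminorm_le[of "{..<n}" "\<lambda>k x. \<bar>d k x\<bar>" M] Lp_fun_abs[OF d] by fastforce
  qed
  have nn: "0 \<le> ?S n x" for n x by (intro sum_nonneg) auto
  have mono: "incseq (\<lambda>n. ennreal (?S n x powr p))" for x
    using p by (intro incseq_SucI ennreal_leI powr_mono2) (auto intro: sum_nonneg)
  have "(\<integral>\<^sup>+x. (SUP n. ennreal (?S n x powr p)) \<partial>M) = (SUP n. \<integral>\<^sup>+x. ennreal (?S n x powr p) \<partial>M)"
    by (rule nn_integral_monotone_convergence_SUP) (use mono in \<open>auto simp: incseq_def le_fun_def\<close>)
  also have "\<dots> \<le> ennreal (?c powr p)"
  proof (rule SUP_least)
    fix n
    have "(\<integral>\<^sup>+x. ennreal (?S n x powr p) \<partial>M) = ennreal (Lp_seminorm p M (?S n) powr p)"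
      using nn_integral_Lp_seminorm[of "?S n" M] S[of n] nn[where n = n] by simp
    also have "\<dots> \<le> ennreal (?c powr p)"
      using S[of n] p by (intro ennreal_leI powr_mono2) auto
    finally show "(\<integral>\<^sup>+x. ennreal (?S n x powr p) \<partial>M) \<le> ennreal (?c powr p)" .
  qed
  finally have "(\<integral>\<^sup>+x. (SUP n. ennreal (?S n x powr p)) \<partial>M) \<noteq> \<infinity>"
    by (auto simp: top_unique)
  then have "AE x in M. (SUP n. ennreal (?S n x powr p)) \<noteq> \<infinity>"
    by (intro nn_integral_noteq_infinite) auto
  then show ?thesis
  proof eventually_elim
    case (elim x)
    then obtain r where r: "0 \<le> r" "(SUP n. ennreal (?S n x powr p)) = ennreal r"
      by (cases "SUP n. ennreal (?S n x powr p)") auto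
    have "?S n x \<le> r powr (1 / p)" for n
    proof -
      have "ennreal (?S n x powr p) \<le> ennreal r"
        unfolding r(2)[symmetric] by (rule SUP_upper) simp
      then have "(?S n x powr p) powr (1 / p) \<le> r powr (1 / p)"
        using p r(1) by (intro powr_mono2) auto
      then show ?thesis using p nn[where n = n and x = x] by (simp add: powr_powr)
    qed
    then show ?case by (intro summableI_nonneg_bounded[where x = "r powr (1 / p)"]) auto
  qed
qed

text \<open>
  Riesz-Fischer: a subsequence with geometrically small steps converges almost everywhere, and Fatou's
  lemma turns this into convergence of the whole sequence in the seminorm.
\<close>
theorem Lp_complete:
  assumes f: "\<And>n. f n \<in> Lp_fun p M"
    and cauchy: "\<And>\<epsilon>. 0 < \<epsilon> \<Longrightarrow> \<exists>k. \<forall>n m. k \<le> n \<and> n \<le> m \<longrightarrow> Lp_seminorm p M (\<lambda>x. f n x - f m x) < \<epsilon>"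
  obtains g where "g \<in> Lp_fun p M" "(\<lambda>n. Lp_seminorm p M (\<lambda>x. f n x - g x)) \<longlonglongrightarrow> 0"
proof -
  note [measurable] = f[THEN Lp_fun_measurable]
  have "\<forall>j. \<exists>k. \<forall>n m. k \<le> n \<and> n \<le> m \<longrightarrow> Lp_seminorm p M (\<lambda>x. f n x - f m x) < (1/2) ^ j"
    using cauchy by simp
  then obtain K where K: "\<And>j n m. K j \<le> n \<Longrightarrow> n \<le> m \<Longrightarrow> Lp_seminorm p M (\<lambda>x. f n x - f m x) < (1/2) ^ j"
    by metis
  \<comment> \<open>Summing the \<open>K i\<close> makes the subsequence of indices monotone and keeps \<open>K j \<le> r j\<close>.\<close>
  define r where "r j = (\<Sum>i\<le>j. K i)" for j
  have Kr: "K j \<le> r j" for j unfolding r_def by (rule member_le_sum) auto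
  have rmono: "r j \<le> r (Suc j)" for j by (simp add: r_def)
  define d where "d j x = f (r (Suc j)) x - f (r j) x" for j x
  have d: "d j \<in> Lp_fun p M" for j
    unfolding d_def by (rule Lp_fun_diff) (rule f)+
  have "summable (\<lambda>j. Lp_seminorm p M (d j))"
  proof (rule summable_comparison_test')
    show "summable (\<lambda>j. (1/2::real) ^ j)" by (simp add: summable_geometric)
    show "norm (Lp_seminorm p M (d j)) \<le> (1/2) ^ j" if "0 \<le> j" for j
      using K[OF Kr rmono, of j] by (simp add: d_def[abs_def] Lp_seminorm_minus_commute[of p M "f (r (Suc j))"])
  qed
  from Lp_AE_summable[OF d this] have "AE x in M. convergent (\<lambda>j. f (r j) x)"
  proof eventually_elim
    case (elim x)
    then have "convergent (\<lambda>n. \<Sum>j<n. d j x)"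
      using summable_rabs_cancel summable_iff_convergent by blast
    moreover have "(\<Sum>j<n. d j x) = f (r n) x - f (r 0) x" for n
      unfolding d_def by (rule sum_lessThan_telescope)
    ultimately have "convergent (\<lambda>n. f (r n) x - f (r 0) x)" by simp
    from convergent_add[OF this convergent_const[of "f (r 0) x"]] show ?case by simp
  qed
  then have lim: "AE x in M. (\<lambda>j. f (r j) x) \<longlonglongrightarrow> lim (\<lambda>j. f (r j) x)"
    by (simp add: convergent_LIMSEQ_iff)
  define g where "g x = lim (\<lambda>j. f (r j) x)" for x
  have g [measurable]: "g \<in> borel_measurable M" unfolding g_def[abs_def] by measurable
  have close: "(\<lambda>x. f n x - g x) \<in> Lp_fun p M \<and> Lp_seminorm p M (\<lambda>x. f n x - g x) \<le> (1/2) ^ j"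
    if n: "r j \<le> n" for n j
  proof (rule Lp_Fatou)
    show "(\<lambda>x. f n x - f (r k) x) \<in> Lp_fun p M" for k by (intro Lp_fun_diff f)
    show "AE x in M. (\<lambda>k. f n x - f (r k) x) \<longlonglongrightarrow> f n x - g x"
      using lim by eventually_elim (auto simp: g_def intro!: tendsto_intros)
    show "\<forall>\<^sub>F k in sequentially. Lp_seminorm p M (\<lambda>x. f n x - f (r k) x) \<le> (1/2) ^ j"
      unfolding eventually_sequentially
    proof (intro exI allI impI)
      fix k assume "j \<le> k"
      then have "K j \<le> r k" using Kr[of j] lift_Suc_mono_le[of r j k] rmono by (meson le_trans)
      moreover have "K j \<le> n" using Kr[of j] n by simp
      ultimately show "Lp_seminorm p M (\<lambda>x. f n x - f (r k) x) \<le> (1/2) ^ j"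
        using K[of j n "r k"] K[of j "r k" n] Lp_seminorm_minus_commute[of p M "f n" "f (r k)"]
        by (cases "n \<le> r k") auto
    qed
  qed measurable
  show ?thesis
  proof
    have "(\<lambda>x. f (r 0) x - (f (r 0) x - g x)) \<in> Lp_fun p M"
      by (rule Lp_fun_diff[OF f]) (use close in blast)
    then show "g \<in> Lp_fun p M" by simp
    show "(\<lambda>n. Lp_seminorm p M (\<lambda>x. f n x - g x)) \<longlonglongrightarrow> 0"
    proof (rule LIMSEQ_I)
      fix e :: real assume "0 < e"
      then obtain j where j: "(1/2) ^ j < e" using real_arch_pow_inv[of e "1/2"] by auto
      show "\<exists>n0. \<forall>n\<ge>n0. norm (Lp_seminorm p M (\<lambda>x. f n x - g x) - 0) < e"
        using close[of j] j by (intro exI[of _ "r j"]) (auto intro: le_less_trans)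
    qed
  qed
qed

end

section \<open>Classes modulo null functions\<close>

lemma UN_constant_value: "A \<noteq> {} \<Longrightarrow> (\<And>f. f \<in> A \<Longrightarrow> F f = X) \<Longrightarrow> (\<Union>f\<in>A. F f) = X"
  by auto

lemma the_elem_image: "A \<noteq> {} \<Longrightarrow> (\<And>f. f \<in> A \<Longrightarrow> F f = c) \<Longrightarrow> the_elem (F ` A) = c"
  using the_elem_image_unique[of A F] by (metis all_not_in_conv)

lemma Lp_class_self: "f \<in> Lp_fun p M \<Longrightarrow> f \<in> Lp_class p M f"
  by (simp add: Lp_class_def)

text \<open>
  Operations on classes are defined as unions over representatives. A union collapses to one class
  (\<open>UN_constant_value\<close>) once all representatives are known to contribute the same one, and this is
  how that is seen.
\<close>
lemma Lp_class_cong_AE: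
  assumes "AE x in M. f x = g x"
  shows "Lp_class p M f = Lp_class p M g"
proof -
  have "(AE x in M. h x = f x) \<longleftrightarrow> (AE x in M. h x = g x)" for h
    using assms by (auto elim: eventually_elim2)
  then show ?thesis by (auto simp: Lp_class_def)
qed

lemma Lp_class_eqD:
  assumes "f \<in> Lp_fun p M" "Lp_class p M f = Lp_class p M g"
  shows "AE x in M. f x = g x"
  using Lp_class_self[OF assms(1)] assms(2) by (auto simp: Lp_class_def)

lemma Lp_carrierE:
  assumes "u \<in> vcarrier (Lp p M)"
  obtains f where "f \<in> Lp_fun p M" "u = Lp_class p M f"
  using assms by (auto simp: Lp_def)

lemma Lp_class_carrier: "f \<in> Lp_fun p M \<Longrightarrow> Lp_class p M f \<in> vcarrier (Lp p M)"
  by (simp add: Lp_def)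

lemma Lp_carrier_memD:
  assumes "u \<in> vcarrier (Lp p M)" "f \<in> u"
  shows "f \<in> Lp_fun p M" "u = Lp_class p M f"
proof -
  obtain g where g: "u = Lp_class p M g" using assms(1) by (rule Lp_carrierE)
  then show "f \<in> Lp_fun p M" using assms(2) by (simp add: Lp_class_def)
  show "u = Lp_class p M f"
    unfolding g by (rule Lp_class_cong_AE) (use assms(2) g in \<open>auto simp: Lp_class_def\<close>)
qed

context
  fixes p :: real
  assumes p: "1 \<le> p"
begin

lemma vadd_Lp_class:
  assumes "f \<in> Lp_fun p M" "g \<in> Lp_fun p M"
  shows "vadd (Lp p M) (Lp_class p M f) (Lp_class p M g) = Lp_class p M (\<lambda>x. f x + g x)"
  unfolding Lp_def normed_structure.simps
proof (intro UN_constant_value)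
  fix f' g' assume "f' \<in> Lp_class p M f" "g' \<in> Lp_class p M g"
  then have "AE x in M. f' x = f x" "AE x in M. g' x = g x" by (auto simp: Lp_class_def)
  then show "Lp_class p M (\<lambda>x. f' x + g' x) = Lp_class p M (\<lambda>x. f x + g x)"
    by (intro Lp_class_cong_AE) (auto elim: eventually_elim2)
qed (use Lp_class_self assms in blast)+

lemma vscale_Lp_class:
  assumes "f \<in> Lp_fun p M"
  shows "vscale (Lp p M) a (Lp_class p M f) = Lp_class p M (\<lambda>x. a * f x)"
  unfolding Lp_def normed_structure.simps
proof (intro UN_constant_value)
  fix f' assume "f' \<in> Lp_class p M f"
  then have "AE x in M. f' x = f x" by (auto simp: Lp_class_def)
  then show "Lp_class p M (\<lambda>x. a * f' x) = Lp_class p M (\<lambda>x. a * f x)"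
    by (intro Lp_class_cong_AE) (auto elim: eventually_mono)
qed (use Lp_class_self assms in blast)

lemma vnorm_Lp_class:
  assumes "f \<in> Lp_fun p M"
  shows "vnorm (Lp p M) (Lp_class p M f) = Lp_seminorm p M f"
  unfolding Lp_def normed_structure.simps Lp_seminorm_def[symmetric]
proof (rule the_elem_image)
  fix f' assume "f' \<in> Lp_class p M f"
  then show "Lp_seminorm p M f' = Lp_seminorm p M f"
    using assms by (intro Lp_seminorm_cong_AE) (auto simp: Lp_class_def Lp_fun_def)
qed (use Lp_class_self assms in blast)

lemma vdist_Lp_class:
  assumes "f \<in> Lp_fun p M" "g \<in> Lp_fun p M"
  shows "vdist (Lp p M) (Lp_class p M f) (Lp_class p M g) = Lp_seminorm p M (\<lambda>x. f x - g x)"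
  using Lp_fun_scale[OF assms(2), of "-1"] Lp_fun_diff[OF p assms] assms
  by (simp add: vdist_def vscale_Lp_class vadd_Lp_class vnorm_Lp_class)

lemma vadd_Lp_carrier:
  "u \<in> vcarrier (Lp p M) \<Longrightarrow> v \<in> vcarrier (Lp p M) \<Longrightarrow> vadd (Lp p M) u v \<in> vcarrier (Lp p M)"
  by (elim Lp_carrierE) (simp add: vadd_Lp_class Lp_class_carrier Lp_fun_add p)

lemma vscale_Lp_carrier:
  "u \<in> vcarrier (Lp p M) \<Longrightarrow> vscale (Lp p M) a u \<in> vcarrier (Lp p M)"
  by (elim Lp_carrierE) (simp add: vscale_Lp_class Lp_class_carrier Lp_fun_scale)

lemma vdist_Lp_eq_0:
  assumes "u \<in> vcarrier (Lp p M)" "v \<in> vcarrier (Lp p M)" "vdist (Lp p M) u v = 0"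
  shows "u = v"
proof -
  obtain f g where fg: "f \<in> Lp_fun p M" "g \<in> Lp_fun p M" "u = Lp_class p M f" "v = Lp_class p M g"
    using assms(1,2) by (metis Lp_carrierE)
  then have "AE x in M. f x = g x"
    using assms(3) Lp_seminorm_eq_0_iff[OF p Lp_fun_diff[OF p fg(1,2)]] by (simp add: vdist_Lp_class)
  then show ?thesis unfolding fg by (rule Lp_class_cong_AE)
qed

lemma vdist_Lp_triangle:
  assumes "u \<in> vcarrier (Lp p M)" "v \<in> vcarrier (Lp p M)" "w \<in> vcarrier (Lp p M)"
  shows "vdist (Lp p M) u w \<le> vdist (Lp p M) u v + vdist (Lp p M) v w"
  using assms Lp_seminorm_triangle_diff[OF p] by (auto elim!: Lp_carrierE simp: vdist_Lp_class)

lemma vdist_Lp_commute: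
  assumes "u \<in> vcarrier (Lp p M)" "v \<in> vcarrier (Lp p M)"
  shows "vdist (Lp p M) u v = vdist (Lp p M) v u"
  using assms Lp_seminorm_minus_commute[of p M] by (auto elim!: Lp_carrierE simp: vdist_Lp_class)

lemma vdist_Lp_nonneg:
  assumes "u \<in> vcarrier (Lp p M)" "v \<in> vcarrier (Lp p M)"
  shows "0 \<le> vdist (Lp p M) u v"
  using assms by (auto elim!: Lp_carrierE simp: vdist_Lp_class)

lemma vdist_Lp_vadd:
  assumes "u \<in> vcarrier (Lp p M)" "v \<in> vcarrier (Lp p M)" "u' \<in> vcarrier (Lp p M)" "v' \<in> vcarrier (Lp p M)"
  shows "vdist (Lp p M) (vadd (Lp p M) u v) (vadd (Lp p M) u' v') \<le> vdist (Lp p M) u u' + vdist (Lp p M) v v'"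
proof -
  obtain f g f' g' where fg: "f \<in> Lp_fun p M" "g \<in> Lp_fun p M" "f' \<in> Lp_fun p M" "g' \<in> Lp_fun p M"
    "u = Lp_class p M f" "v = Lp_class p M g" "u' = Lp_class p M f'" "v' = Lp_class p M g'"
    using assms by (metis Lp_carrierE)
  have "Lp_seminorm p M (\<lambda>x. (f x - f' x) + (g x - g' x))
      \<le> Lp_seminorm p M (\<lambda>x. f x - f' x) + Lp_seminorm p M (\<lambda>x. g x - g' x)"
    by (rule Lp_seminorm_triangle[OF p]) (use fg Lp_fun_diff[OF p] in blast)+
  then show ?thesis
    using fg by (simp add: vadd_Lp_class vdist_Lp_class Lp_fun_add p algebra_simps)
qed

lemma vdist_Lp_vscale:
  assumes "u \<in> vcarrier (Lp p M)" "v \<in> vcarrier (Lp p M)"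
  shows "vdist (Lp p M) (vscale (Lp p M) a u) (vscale (Lp p M) a v) = \<bar>a\<bar> * vdist (Lp p M) u v"
proof -
  obtain f g where fg: "f \<in> Lp_fun p M" "g \<in> Lp_fun p M" "u = Lp_class p M f" "v = Lp_class p M g"
    using assms by (metis Lp_carrierE)
  then show ?thesis
    using Lp_seminorm_scale[OF p, of M a "\<lambda>x. f x - g x"]
    by (simp add: vscale_Lp_class vdist_Lp_class Lp_fun_scale right_diff_distrib)
qed

lemma vnorm_Lp_diff:
  assumes "u \<in> vcarrier (Lp p M)" "v \<in> vcarrier (Lp p M)"
  shows "\<bar>vnorm (Lp p M) u - vnorm (Lp p M) v\<bar> \<le> vdist (Lp p M) u v"
  using assms by (elim Lp_carrierE) (simp add: vnorm_Lp_class vdist_Lp_class Lp_seminorm_reverse_triangle[OF p])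

lemma Lp_limit_unique:
  assumes u: "\<And>n. u n \<in> vcarrier (Lp p M)" and "Lp_limit p M u v" "Lp_limit p M u w"
  shows "v = w"
proof (rule vdist_Lp_eq_0)
  show v: "v \<in> vcarrier (Lp p M)" and w: "w \<in> vcarrier (Lp p M)"
    using assms by (auto simp: Lp_limit_def)
  have "(\<lambda>n. vdist (Lp p M) (u n) v + vdist (Lp p M) (u n) w) \<longlonglongrightarrow> 0 + 0"
    using assms by (intro tendsto_add) (auto simp: Lp_limit_def)
  moreover have "vdist (Lp p M) v w \<le> vdist (Lp p M) (u n) v + vdist (Lp p M) (u n) w" for n
    using vdist_Lp_triangle[OF v u w, of n] vdist_Lp_commute[OF v u] by simp
  ultimately have "vdist (Lp p M) v w \<le> 0"
    by (intro LIMSEQ_le_const) auto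
  then show "vdist (Lp p M) v w = 0" using vdist_Lp_nonneg[OF v w] by simp
qed

text \<open>
  Identifies the equivalence relation on co-Cauchy sequences with equality of limits; both directions
  are the triangle inequality.
\<close>
lemma Lp_limit_iff_of_dist:
  assumes u: "\<And>n. u n \<in> vcarrier (Lp p M)" and w: "\<And>n. w n \<in> vcarrier (Lp p M)"
    and lim: "Lp_limit p M u v"
  shows "(\<lambda>n. vdist (Lp p M) (u n) (w n)) \<longlonglongrightarrow> 0 \<longleftrightarrow> Lp_limit p M w v"
proof -
  have v: "v \<in> vcarrier (Lp p M)" and uv: "(\<lambda>n. vdist (Lp p M) (u n) v) \<longlonglongrightarrow> 0"
    using lim by (auto simp: Lp_limit_def)
  show ?thesis
  proof
    assume uw: "(\<lambda>n. vdist (Lp p M) (u n) (w n)) \<longlonglongrightarrow> 0"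
    have "(\<lambda>n. vdist (Lp p M) (w n) v) \<longlonglongrightarrow> 0"
    proof (rule Lim_null_comparison)
      show "(\<lambda>n. vdist (Lp p M) (u n) (w n) + vdist (Lp p M) (u n) v) \<longlonglongrightarrow> 0"
        using tendsto_add[OF uw uv] by simp
      show "\<forall>\<^sub>F n in sequentially. norm (vdist (Lp p M) (w n) v)
          \<le> vdist (Lp p M) (u n) (w n) + vdist (Lp p M) (u n) v"
        using vdist_Lp_triangle[OF w u v] vdist_Lp_commute[OF w u] vdist_Lp_nonneg[OF w v]
        by (intro always_eventually) simp
    qed
    then show "Lp_limit p M w v" using v by (simp add: Lp_limit_def)
  next
    assume "Lp_limit p M w v"
    then have wv: "(\<lambda>n. vdist (Lp p M) (w n) v) \<longlonglongrightarrow> 0" by (simp add: Lp_limit_def)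
    show "(\<lambda>n. vdist (Lp p M) (u n) (w n)) \<longlonglongrightarrow> 0"
    proof (rule Lim_null_comparison)
      show "(\<lambda>n. vdist (Lp p M) (u n) v + vdist (Lp p M) (w n) v) \<longlonglongrightarrow> 0"
        using tendsto_add[OF uv wv] by simp
      show "\<forall>\<^sub>F n in sequentially. norm (vdist (Lp p M) (u n) (w n))
          \<le> vdist (Lp p M) (u n) v + vdist (Lp p M) (w n) v"
        using vdist_Lp_triangle[OF u v w] vdist_Lp_commute[OF v w] vdist_Lp_nonneg[OF u w]
        by (intro always_eventually) simp
    qed
  qed
qed

lemma Lp_Cauchy_limit:
  assumes u: "\<And>n. u n \<in> vcarrier (Lp p M)"
    and cauchy: "\<And>\<epsilon>. 0 < \<epsilon> \<Longrightarrow> \<exists>k. \<forall>n m. k \<le> n \<and> n \<le> m \<longrightarrow> vdist (Lp p M) (u n) (u m) < \<epsilon>"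
  obtains v where "Lp_limit p M u v"
proof -
  have "\<forall>n. \<exists>f. f \<in> Lp_fun p M \<and> u n = Lp_class p M f" using u by (metis Lp_carrierE)
  then obtain f where f: "\<And>n. f n \<in> Lp_fun p M" "\<And>n. u n = Lp_class p M (f n)" by metis
  obtain g where "g \<in> Lp_fun p M" "(\<lambda>n. Lp_seminorm p M (\<lambda>x. f n x - g x)) \<longlonglongrightarrow> 0"
    by (rule Lp_complete[OF p f(1)]) (use cauchy in \<open>simp_all add: f vdist_Lp_class\<close>)
  then have "Lp_limit p M u (Lp_class p M g)"
    by (simp add: Lp_limit_def Lp_class_carrier f vdist_Lp_class)
  then show ?thesis by (rule that)
qed

lemma Lp_limit_Cauchy:
  assumes u: "\<And>n. u n \<in> vcarrier (Lp p M)" and lim: "Lp_limit p M u v" and e: "0 < \<epsilon>"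
  shows "\<exists>k. \<forall>n m. k \<le> n \<and> n \<le> m \<longrightarrow> vdist (Lp p M) (u n) (u m) < \<epsilon>"
proof -
  have v: "v \<in> vcarrier (Lp p M)" and uv: "(\<lambda>n. vdist (Lp p M) (u n) v) \<longlonglongrightarrow> 0"
    using lim by (auto simp: Lp_limit_def)
  obtain k where k: "\<And>n. k \<le> n \<Longrightarrow> vdist (Lp p M) (u n) v < \<epsilon> / 2"
    using order_tendstoD(2)[OF uv, of "\<epsilon> / 2"] e by (auto simp: eventually_sequentially)
  have "vdist (Lp p M) (u n) (u m) < \<epsilon>" if "k \<le> n" "k \<le> m" for n m
    using vdist_Lp_triangle[OF u v u, of n m] k[OF that(1)] k[OF that(2)] vdist_Lp_commute[OF v u[of m]] by simp
  then show ?thesis by (meson le_trans)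
qed

end

section \<open>Measure preserving maps and conditional expectations\<close>

lemma Lp_fun_integrable_real:
  assumes "finite_measure M" "1 \<le> p" "f \<in> Lp_fun p M"
  shows "integrable M f"
proof (rule Bochner_Integration.integrable_bound)
  interpret finite_measure M by fact
  show "integrable M (\<lambda>x. 1 + \<bar>f x\<bar> powr p)" using Lp_fun_integrable[OF assms(3)] by simp
  have "\<bar>a\<bar> \<le> 1 + \<bar>a\<bar> powr p" for a :: real
  proof (cases "1 \<le> \<bar>a\<bar>")
    case True
    then have "\<bar>a\<bar> powr 1 \<le> \<bar>a\<bar> powr p" using assms(2) by (intro powr_mono) auto
    then show ?thesis by simp
  next
    case False
    then show ?thesis using powr_ge_zero[of "\<bar>a\<bar>" p] by linarith
  qed
  then show "AE x in M. norm (f x) \<le> norm (1 + \<bar>f x\<bar> powr p)" by simp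
qed (rule Lp_fun_measurable[OF assms(3)])

context
  fixes M :: "'a measure" and N :: "'b measure" and h :: "'a \<Rightarrow> 'b"
  assumes h [measurable]: "h \<in> measurable M N" and distr: "distr M N h = N"
begin

lemma measure_preserving_AE:
  "AE y in N. P y \<Longrightarrow> AE x in M. P (h x)"
  using AE_distrD[OF h, of P] by (simp only: distr)

lemma Lp_fun_comp: "u \<in> Lp_fun p N \<Longrightarrow> (\<lambda>x. u (h x)) \<in> Lp_fun p M"
  using integrable_distr[OF h, of "\<lambda>x. \<bar>u x\<bar> powr p"] by (auto simp: Lp_fun_def distr)

lemma Lp_seminorm_comp:
  assumes [measurable]: "u \<in> borel_measurable N"
  shows "Lp_seminorm p M (\<lambda>x. u (h x)) = Lp_seminorm p N u"
  using integral_distr[OF h, of "\<lambda>x. \<bar>u x\<bar> powr p"] by (simp add: Lp_seminorm_def distr)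

lemma Lp_fun_comp_iff:
  assumes [measurable]: "u \<in> borel_measurable N"
  shows "(\<lambda>x. u (h x)) \<in> Lp_fun p M \<longleftrightarrow> u \<in> Lp_fun p N"
  using integrable_distr_eq[OF h, of "\<lambda>x. \<bar>u x\<bar> powr p"] by (simp add: Lp_fun_def distr)

lemma Lp_pullback_class:
  assumes "u \<in> Lp_fun p N"
  shows "Lp_pullback p M h (Lp_class p N u) = Lp_class p M (\<lambda>x. u (h x))"
  unfolding Lp_pullback_def
proof (rule UN_constant_value)
  fix u' assume "u' \<in> Lp_class p N u"
  then have "AE x in N. u' x = u x" by (simp add: Lp_class_def)
  from measure_preserving_AE[OF this] show "Lp_class p M (u' \<circ> h) = Lp_class p M (\<lambda>x. u (h x))"
    by (intro Lp_class_cong_AE) simp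
qed (use Lp_class_self assms in blast)

lemma Lp_pullback_carrier:
  assumes "u \<in> vcarrier (Lp p N)"
  shows "Lp_pullback p M h u \<in> vcarrier (Lp p M)"
proof -
  obtain f where f: "f \<in> Lp_fun p N" "u = Lp_class p N f" using assms by (rule Lp_carrierE)
  then show ?thesis by (simp only: Lp_pullback_class[OF f(1)] Lp_class_carrier[OF Lp_fun_comp[OF f(1)]])
qed

lemma Lp_pullback_vdist:
  assumes p: "1 \<le> p" and "u \<in> vcarrier (Lp p N)" "v \<in> vcarrier (Lp p N)"
  shows "vdist (Lp p M) (Lp_pullback p M h u) (Lp_pullback p M h v) = vdist (Lp p N) u v"
proof -
  obtain f g where fg: "f \<in> Lp_fun p N" "g \<in> Lp_fun p N" "u = Lp_class p N f" "v = Lp_class p N g"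
    using assms(2,3) by (metis Lp_carrierE)
  have "Lp_seminorm p M (\<lambda>x. f (h x) - g (h x)) = Lp_seminorm p N (\<lambda>y. f y - g y)"
    by (rule Lp_seminorm_comp[OF Lp_fun_measurable[OF Lp_fun_diff[OF p fg(1,2)]]])
  then show ?thesis
    by (simp only: fg(3,4) Lp_pullback_class[OF fg(1)] Lp_pullback_class[OF fg(2)]
      vdist_Lp_class[OF p fg(1,2)] vdist_Lp_class[OF p fg(1,2)[THEN Lp_fun_comp]])
qed

lemma Lp_pullback_vnorm:
  assumes p: "1 \<le> p" and "u \<in> vcarrier (Lp p N)"
  shows "vnorm (Lp p M) (Lp_pullback p M h u) = vnorm (Lp p N) u"
proof -
  obtain f where f: "f \<in> Lp_fun p N" "u = Lp_class p N f" using assms(2) by (rule Lp_carrierE)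
  then show ?thesis
    by (simp only: Lp_pullback_class[OF f(1)] vnorm_Lp_class[OF p f(1)]
      vnorm_Lp_class[OF p Lp_fun_comp[OF f(1)]] Lp_seminorm_comp[OF Lp_fun_measurable[OF f(1)]])
qed

lemma Lp_pullback_vadd:
  assumes p: "1 \<le> p" and "u \<in> vcarrier (Lp p N)" "v \<in> vcarrier (Lp p N)"
  shows "Lp_pullback p M h (vadd (Lp p N) u v)
    = vadd (Lp p M) (Lp_pullback p M h u) (Lp_pullback p M h v)"
proof -
  obtain f g where fg: "f \<in> Lp_fun p N" "g \<in> Lp_fun p N" "u = Lp_class p N f" "v = Lp_class p N g"
    using assms(2,3) by (metis Lp_carrierE)
  then show ?thesis
    by (simp only: Lp_pullback_class[OF fg(1)] Lp_pullback_class[OF fg(2)]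
      Lp_pullback_class[OF Lp_fun_add[OF p fg(1,2)]]
      vadd_Lp_class[OF p fg(1,2)] vadd_Lp_class[OF p fg(1,2)[THEN Lp_fun_comp]])
qed

lemma Lp_pullback_vscale:
  assumes p: "1 \<le> p" and "u \<in> vcarrier (Lp p N)"
  shows "Lp_pullback p M h (vscale (Lp p N) a u) = vscale (Lp p M) a (Lp_pullback p M h u)"
proof -
  obtain f where f: "f \<in> Lp_fun p N" "u = Lp_class p N f" using assms(2) by (rule Lp_carrierE)
  then show ?thesis
    by (simp only: Lp_pullback_class[OF f(1)] Lp_pullback_class[OF Lp_fun_scale[OF f(1)]]
      vscale_Lp_class[OF p f(1)] vscale_Lp_class[OF p Lp_fun_comp[OF f(1)]])
qed

end

text \<open>
  Doob-Dynkin: a simple function for the pulled back algebra is a simple function of \<open>h\<close>, and the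
  factor of a limit of such functions is the pointwise \<open>lim\<close> of the factors. As a function of the point,
  \<open>lim\<close> is measurable also where the sequence diverges, which covers the points outside the range of \<open>h\<close>.
\<close>
lemma measurable_vimage_algebra_factor:
  fixes f :: "'a \<Rightarrow> real"
  assumes h: "h \<in> X \<rightarrow> space N" and f: "f \<in> borel_measurable (vimage_algebra X h N)"
  obtains g where "g \<in> borel_measurable N" "\<And>x. x \<in> X \<Longrightarrow> f x = g (h x)"
proof -
  let ?V = "vimage_algebra X h N"
  have "\<exists>s. (\<forall>i. simple_function ?V (s i)) \<and> (\<forall>x\<in>space ?V. (\<lambda>i. s i x) \<longlonglongrightarrow> f x) \<and>
      (\<forall>i. \<forall>x\<in>space ?V. dist (s i x) 0 \<le> 2 * dist (f x) 0)"
    by (rule borel_measurable_implies_sequence_metric[OF f])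
  then obtain s where s: "\<And>i. simple_function ?V (s i)" "\<And>x. x \<in> X \<Longrightarrow> (\<lambda>i. s i x) \<longlonglongrightarrow> f x"
    by auto
  have "\<exists>g. g \<in> borel_measurable N \<and> (\<forall>x\<in>X. s i x = g (h x))" for i
  proof -
    have "\<forall>y. \<exists>B. B \<in> sets N \<and> s i -` {y} \<inter> X = h -` B \<inter> X"
    proof
      fix y
      have "s i -` {y} \<inter> space ?V \<in> sets ?V" by (rule simple_functionD(2)[OF s(1)])
      then show "\<exists>B. B \<in> sets N \<and> s i -` {y} \<inter> X = h -` B \<inter> X"
        by (auto simp: sets_vimage_algebra2[OF h])
    qed
    then obtain B where B: "\<And>y. B y \<in> sets N" "\<And>y. s i -` {y} \<inter> X = h -` B y \<inter> X" by metis
    let ?g = "\<lambda>z. \<Sum>y\<in>s i ` X. indicator (B y) z * y"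
    have "?g \<in> borel_measurable N" using B(1) by measurable
    moreover have "s i x = ?g (h x)" if x: "x \<in> X" for x
    proof -
      have "s i x = (\<Sum>y\<in>s i ` X. indicator (s i -` {y} \<inter> X) x *\<^sub>R y)"
        using simple_function_indicator_representation_banach[OF s(1)[of i], of x] x by (simp only: space_vimage_algebra)
      also have "\<dots> = ?g (h x)"
        unfolding B(2) using x by (intro sum.cong) (auto simp: indicator_def)
      finally show ?thesis .
    qed
    ultimately show ?thesis by blast
  qed
  then obtain g where g: "\<And>i. g i \<in> borel_measurable N" "\<And>i x. x \<in> X \<Longrightarrow> s i x = g i (h x)" by metis
  show ?thesis
  proof
    show "(\<lambda>z. lim (\<lambda>i. g i z)) \<in> borel_measurable N" using g(1) by measurable
    show "f x = lim (\<lambda>i. g i (h x))" if "x \<in> X" for x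
    proof -
      have "(\<lambda>i. g i (h x)) \<longlonglongrightarrow> f x" using s(2)[OF that] by (simp only: g(2)[OF that])
      then show ?thesis by (rule limI[symmetric])
    qed
  qed
qed

context finite_measure_subalgebra
begin

text \<open>
  Jensen's inequality for \<open>\<bar>x\<bar> powr p\<close>, integrated.
\<close>
lemma Lp_cond_exp_contraction:
  assumes p: "1 \<le> p" and f: "f \<in> Lp_fun p M"
  shows "real_cond_exp M F f \<in> Lp_fun p M"
    and "Lp_seminorm p M (real_cond_exp M F f) \<le> Lp_seminorm p M f"
proof -
  have intf: "integrable M f" by (rule Lp_fun_integrable_real[OF finite_measure_axioms p f])
  note ip = Lp_fun_integrable[OF f]
  have jensen: "AE x in M. \<bar>real_cond_exp M F f x\<bar> powr p \<le> real_cond_exp M F (\<lambda>x. \<bar>f x\<bar> powr p) x"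
    by (rule real_cond_exp_jensens_inequality(2)[OF intf, of UNIV _ _ "\<lambda>x. \<bar>x\<bar> powr p"])
       (use ip abs_powr_convex[OF p] in auto)
  have ic: "integrable M (real_cond_exp M F (\<lambda>x. \<bar>f x\<bar> powr p))"
    by (rule real_cond_exp_int(1)[OF ip])
  have "integrable M (\<lambda>x. \<bar>real_cond_exp M F f x\<bar> powr p)"
    by (rule Bochner_Integration.integrable_bound[OF ic]) (use jensen in \<open>auto elim!: eventually_mono\<close>)
  then show cf: "real_cond_exp M F f \<in> Lp_fun p M" by (simp add: Lp_fun_def)
  have "(LINT x|M. \<bar>real_cond_exp M F f x\<bar> powr p) \<le> (LINT x|M. real_cond_exp M F (\<lambda>x. \<bar>f x\<bar> powr p) x)"
    by (rule integral_mono_AE[OF Lp_fun_integrable[OF cf] ic jensen])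
  also have "\<dots> = Lp_seminorm p M f powr p"
    by (simp add: real_cond_exp_int(2)[OF ip] Lp_seminorm_powr[OF p])
  finally show "Lp_seminorm p M (real_cond_exp M F f) \<le> Lp_seminorm p M f"
    by (subst Lp_seminorm_le_iff[OF p]) auto
qed

lemma Lp_cond_exp_class:
  assumes f: "f \<in> Lp_fun p M"
  shows "Lp_cond_exp p M F (Lp_class p M f) = Lp_class p M (real_cond_exp M F f)"
  unfolding Lp_cond_exp_def
proof (rule UN_constant_value)
  fix f' assume "f' \<in> Lp_class p M f"
  then have "AE x in M. real_cond_exp M F f' x = real_cond_exp M F f x"
    using f by (intro real_cond_exp_cong) (auto simp: Lp_class_def Lp_fun_def)
  then show "Lp_class p M (real_cond_exp M F f') = Lp_class p M (real_cond_exp M F f)"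
    by (rule Lp_class_cong_AE)
qed (use Lp_class_self f in blast)

text \<open>
  Conditional expectation fixes the \<open>F\<close>-measurable \<open>g\<close> and contracts \<open>f - g\<close>, so it moves \<open>f\<close> at most
  twice as far as \<open>g\<close> is from \<open>f\<close>.
\<close>
lemma cond_exp_approx:
  assumes p: "1 \<le> p" and f: "f \<in> Lp_fun p M" and g: "g \<in> Lp_fun p M" "g \<in> borel_measurable F"
  shows "Lp_seminorm p M (\<lambda>x. real_cond_exp M F f x - f x) \<le> 2 * Lp_seminorm p M (\<lambda>x. f x - g x)"
proof -
  have intf: "integrable M f" and intg: "integrable M g"
    using Lp_fun_integrable_real[OF finite_measure_axioms p] f g by auto
  have fg: "(\<lambda>x. f x - g x) \<in> Lp_fun p M" by (rule Lp_fun_diff[OF p f g(1)])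
  note c = Lp_cond_exp_contraction[OF p]
  have "AE x in M. real_cond_exp M F (\<lambda>x. f x - g x) x = real_cond_exp M F f x - g x"
    using real_cond_exp_diff[OF intf intg] real_cond_exp_F_meas[OF intg g(2)]
    by eventually_elim simp
  then have "Lp_seminorm p M (\<lambda>x. real_cond_exp M F f x - g x)
      = Lp_seminorm p M (real_cond_exp M F (\<lambda>x. f x - g x))"
    by (intro Lp_seminorm_cong_AE) (use g(1) in \<open>auto simp: Lp_fun_def\<close>)
  also have "\<dots> \<le> Lp_seminorm p M (\<lambda>x. f x - g x)" by (rule c(2)[OF fg])
  finally show ?thesis
    using Lp_seminorm_triangle_diff[OF p c(1)[OF f] g(1) f] Lp_seminorm_minus_commute[of p M g f] by simp
qed

end

section \<open>Convergence of conditional expectations along a tower\<close>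

text \<open>
  The features of the restriction maps that carry the measure-theoretic part of the theorem, with
  \<open>M\<close> in the role of \<open>E'\<close> and \<open>N n\<close> in that of the dual of \<open>H\<^sub>n\<close>.
\<close>
locale measure_tower = prob_space M for M :: "'a measure" +
  fixes N :: "nat \<Rightarrow> 'b measure" and \<phi> :: "nat \<Rightarrow> 'a \<Rightarrow> 'b" and \<pi> :: "nat \<Rightarrow> nat \<Rightarrow> 'b \<Rightarrow> 'b"
  assumes phi_measurable [measurable]: "\<And>n. \<phi> n \<in> measurable M (N n)"
    and distr_phi: "\<And>n. distr M (N n) (\<phi> n) = N n"
    and proj_measurable: "\<And>n m. n \<le> m \<Longrightarrow> \<pi> n m \<in> measurable (N m) (N n)"
    and proj_phi: "\<And>n m x. n \<le> m \<Longrightarrow> x \<in> space M \<Longrightarrow> \<pi> n m (\<phi> m x) = \<phi> n x"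
    and generated: "sets M = sigma_sets (space M) (\<Union>n. sets (vimage_algebra (space M) (\<phi> n) (N n)))"
begin

definition level :: "nat \<Rightarrow> 'a measure" where
  "level n = vimage_algebra (space M) (\<phi> n) (N n)"

lemma phi_space: "\<phi> n \<in> space M \<rightarrow> space (N n)"
  using measurable_space[OF phi_measurable] by auto

text \<open>
  Because \<open>\<phi> m\<close> preserves measure and \<open>\<pi> n m\<close> after \<open>\<phi> m\<close> is \<open>\<phi> n\<close>.
\<close>
lemma distr_proj:
  assumes "n \<le> m"
  shows "distr (N m) (N n) (\<pi> n m) = N n"
proof -
  have "distr (N m) (N n) (\<pi> n m) = distr (distr M (N m) (\<phi> m)) (N n) (\<pi> n m)"
    by (simp only: distr_phi)
  also have "\<dots> = distr M (N n) (\<pi> n m \<circ> \<phi> m)"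
    by (rule distr_distr[OF proj_measurable[OF assms] phi_measurable])
  also have "\<dots> = distr M (N n) (\<phi> n)"
    by (rule distr_cong) (simp_all add: proj_phi[OF assms])
  finally show ?thesis by (simp only: distr_phi)
qed

lemma level_mono:
  assumes "n \<le> m"
  shows "sets (level n) \<subseteq> sets (level m)"
  unfolding level_def
proof (rule sets_image_in_sets)
  have "\<phi> m \<in> measurable (vimage_algebra (space M) (\<phi> m) (N m)) (N m)"
    by (rule measurable_vimage_algebra1[OF phi_space])
  from measurable_compose[OF this proj_measurable[OF assms]]
  show "\<phi> n \<in> measurable (vimage_algebra (space M) (\<phi> m) (N m)) (N n)"
    by (rule measurable_cong[THEN iffD1, rotated]) (simp add: proj_phi[OF assms])
qed simp

lemma finite_measure_subalgebra_level: "finite_measure_subalgebra M (level n)"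
proof
  show "subalgebra M (level n)"
    unfolding subalgebra_def level_def
    using sets_image_in_sets[OF refl phi_measurable] by simp
qed

lemma level_measurable_mono:
  assumes "n \<le> m" "g \<in> borel_measurable (level n)"
  shows "g \<in> borel_measurable (level m)"
proof -
  have "space (level n) = space (level m)" by (simp add: level_def)
  from measurable_mono[OF order_refl refl level_mono[OF assms(1)] this]
  show ?thesis using assms(2) by auto
qed

text \<open>
  Membership in the \<open>L\<^sup>p\<close>-closure of the functions that are measurable at some level. That every
  function of \<open>Lp_fun p M\<close> lies there is shown for indicators by a Dynkin argument, then for simple
  functions by linearity, then in general by dominated convergence.
\<close>
definition approximable :: "real \<Rightarrow> ('a \<Rightarrow> real) \<Rightarrow> bool" where
  "approximable p f \<longleftrightarrow> f \<in> Lp_fun p M \<and>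
    (\<forall>\<epsilon>>0. \<exists>n. \<exists>g\<in>Lp_fun p M. g \<in> borel_measurable (level n) \<and> Lp_seminorm p M (\<lambda>x. f x - g x) < \<epsilon>)"

context
  fixes p :: real
  assumes p: "1 \<le> p"
begin

lemma approximableD:
  assumes "approximable p f" "0 < \<epsilon>"
  obtains n g where "g \<in> Lp_fun p M" "g \<in> borel_measurable (level n)"
    "Lp_seminorm p M (\<lambda>x. f x - g x) < \<epsilon>"
  using assms unfolding approximable_def by blast

lemma approximable_level:
  assumes "f \<in> Lp_fun p M" "f \<in> borel_measurable (level n)"
  shows "approximable p f"
proof -
  have "Lp_seminorm p M (\<lambda>x. f x - f x) = 0" by (simp add: Lp_seminorm_def)
  then show ?thesis
    using assms unfolding approximable_def
    by (intro conjI allI impI exI[of _ n] bexI[of _ f]) auto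
qed

lemma approximable_add:
  assumes f: "approximable p f" and g: "approximable p g"
  shows "approximable p (\<lambda>x. f x + g x)"
  unfolding approximable_def
proof (intro conjI allI impI)
  have fg: "f \<in> Lp_fun p M" "g \<in> Lp_fun p M" using f g by (auto simp: approximable_def)
  then show "(\<lambda>x. f x + g x) \<in> Lp_fun p M" by (rule Lp_fun_add[OF p])
  fix \<epsilon> :: real assume "0 < \<epsilon>"
  then have e: "0 < \<epsilon> / 2" by simp
  obtain n u where u: "u \<in> Lp_fun p M" "u \<in> borel_measurable (level n)"
    "Lp_seminorm p M (\<lambda>x. f x - u x) < \<epsilon> / 2" using approximableD[OF f e] .
  obtain m v where v: "v \<in> Lp_fun p M" "v \<in> borel_measurable (level m)"
    "Lp_seminorm p M (\<lambda>x. g x - v x) < \<epsilon> / 2" using approximableD[OF g e] .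
  let ?w = "\<lambda>x. u x + v x"
  have "?w \<in> borel_measurable (level (max n m))"
    by (intro borel_measurable_add level_measurable_mono[OF _ u(2)] level_measurable_mono[OF _ v(2)]) auto
  moreover have "Lp_seminorm p M (\<lambda>x. (f x + g x) - ?w x)
      \<le> Lp_seminorm p M (\<lambda>x. f x - u x) + Lp_seminorm p M (\<lambda>x. g x - v x)"
    using Lp_seminorm_triangle[OF p Lp_fun_diff[OF p fg(1) u(1)] Lp_fun_diff[OF p fg(2) v(1)]]
    by (simp add: algebra_simps)
  ultimately show "\<exists>n. \<exists>w\<in>Lp_fun p M. w \<in> borel_measurable (level n) \<and>
      Lp_seminorm p M (\<lambda>x. (f x + g x) - w x) < \<epsilon>"
    using u(3) v(3) Lp_fun_add[OF p u(1) v(1)] by (intro exI[of _ "max n m"] bexI[of _ ?w]) auto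
qed

lemma approximable_closed:
  assumes f: "f \<in> Lp_fun p M" and s: "\<And>i. approximable p (s i)"
    and lim: "(\<lambda>i. Lp_seminorm p M (\<lambda>x. s i x - f x)) \<longlonglongrightarrow> 0"
  shows "approximable p f"
  unfolding approximable_def
proof (intro conjI allI impI f)
  fix \<epsilon> :: real assume "0 < \<epsilon>"
  then have e: "0 < \<epsilon> / 2" by simp
  obtain i where i: "Lp_seminorm p M (\<lambda>x. s i x - f x) < \<epsilon> / 2"
    using order_tendstoD(2)[OF lim e] by (auto simp: eventually_sequentially)
  obtain n u where u: "u \<in> Lp_fun p M" "u \<in> borel_measurable (level n)"
    "Lp_seminorm p M (\<lambda>x. s i x - u x) < \<epsilon> / 2" using approximableD[OF s e] .
  have si: "s i \<in> Lp_fun p M" using s by (simp add: approximable_def)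
  have "Lp_seminorm p M (\<lambda>x. f x - u x) < \<epsilon>"
    using Lp_seminorm_triangle_diff[OF p f si u(1)] i u(3) Lp_seminorm_minus_commute[of p M f "s i"] by simp
  then show "\<exists>n. \<exists>w\<in>Lp_fun p M. w \<in> borel_measurable (level n) \<and> Lp_seminorm p M (\<lambda>x. f x - w x) < \<epsilon>"
    using u by blast
qed

lemma Lp_fun_const: "(\<lambda>_. c) \<in> Lp_fun p M"
  by (simp add: Lp_fun_def)

lemma approximable_scale:
  assumes f: "approximable p f"
  shows "approximable p (\<lambda>x. a * f x)"
  unfolding approximable_def
proof (intro conjI allI impI)
  have fp: "f \<in> Lp_fun p M" using f by (simp add: approximable_def)
  then show "(\<lambda>x. a * f x) \<in> Lp_fun p M" by (rule Lp_fun_scale)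
  fix \<epsilon> :: real assume "0 < \<epsilon>"
  then have e: "0 < \<epsilon> / (\<bar>a\<bar> + 1)" by simp
  obtain n u where u: "u \<in> Lp_fun p M" "u \<in> borel_measurable (level n)"
    "Lp_seminorm p M (\<lambda>x. f x - u x) < \<epsilon> / (\<bar>a\<bar> + 1)" using approximableD[OF f e] .
  have "Lp_seminorm p M (\<lambda>x. a * f x - a * u x) = \<bar>a\<bar> * Lp_seminorm p M (\<lambda>x. f x - u x)"
    using Lp_seminorm_scale[OF p, of M a "\<lambda>x. f x - u x"] by (simp add: right_diff_distrib)
  also have "\<dots> \<le> (\<bar>a\<bar> + 1) * Lp_seminorm p M (\<lambda>x. f x - u x)"
    by (intro mult_right_mono) auto
  also have "\<dots> < \<epsilon>" using u(3) by (simp add: pos_less_divide_eq mult.commute)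
  finally have "Lp_seminorm p M (\<lambda>x. a * f x - a * u x) < \<epsilon>" .
  then show "\<exists>n. \<exists>w\<in>Lp_fun p M. w \<in> borel_measurable (level n) \<and> Lp_seminorm p M (\<lambda>x. a * f x - w x) < \<epsilon>"
    using Lp_fun_scale[OF u(1), of a] u(2) by (intro exI[of _ n] bexI[of _ "\<lambda>x. a * u x"]) auto
qed

lemma approximable_sum:
  assumes "finite I" "\<And>i. i \<in> I \<Longrightarrow> approximable p (f i)"
  shows "approximable p (\<lambda>x. \<Sum>i\<in>I. f i x)"
  using assms
proof (induction I rule: finite_induct)
  case empty
  have "(\<lambda>_. 0::real) \<in> borel_measurable (level 0)" by simp
  from approximable_level[OF Lp_fun_const this] show ?case by simp
next
  case (insert i I)
  then show ?case using approximable_add[of "f i" "\<lambda>x. \<Sum>i\<in>I. f i x"] by simp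
qed

lemma Lp_fun_indicator:
  assumes "A \<in> sets M"
  shows "(indicator A :: 'a \<Rightarrow> real) \<in> Lp_fun p M"
  by (rule Lp_fun_bound[OF p _ Lp_fun_const[of 1]]) (use assms in \<open>auto simp: indicator_def\<close>)

text \<open>
  The sets of the levels form an increasing family, hence a generator that is stable under
  intersection, and the sets with an approximable indicator form a Dynkin system: a disjoint union
  is a dominated limit of finite sums.
\<close>
lemma approximable_indicator:
  assumes "A \<in> sets M"
  shows "approximable p (indicator A)"
proof -
  let ?G = "\<Union>n. sets (level n)"
  have G: "?G \<subseteq> Pow (space M)"
    using sets.sets_into_space by (fastforce simp: level_def)
  have setsM: "sets M = sigma_sets (space M) ?G" using generated by (simp add: level_def)
  have "Int_stable ?G"
  proof (rule Int_stableI)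
    fix A B assume "A \<in> ?G" "B \<in> ?G"
    then obtain n m where "A \<in> sets (level n)" "B \<in> sets (level m)" by auto
    then have "A \<in> sets (level (max n m))" "B \<in> sets (level (max n m))"
      using level_mono[of n "max n m"] level_mono[of m "max n m"] by auto
    then show "A \<inter> B \<in> ?G" by blast
  qed
  moreover note G
  moreover have "A \<in> sigma_sets (space M) ?G" using assms setsM by simp
  ultimately show ?thesis
  proof (induction rule: sigma_sets_induct_disjoint)
    case (basic A)
    then obtain n where n: "A \<in> sets (level n)" by auto
    have "A \<in> sets M" using basic setsM by (simp add: sigma_sets.Basic)
    then show ?case by (intro approximable_level[OF Lp_fun_indicator, of A n]) (use n in auto)
  next
    case empty
    have "(\<lambda>_. 0::real) \<in> borel_measurable (level 0)" by simp
    from approximable_level[OF Lp_fun_const this] show ?case by (simp add: indicator_def[abs_def])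
  next
    case (compl A)
    have "(\<lambda>_. 1::real) \<in> borel_measurable (level 0)" by simp
    from approximable_add[OF approximable_level[OF Lp_fun_const this] approximable_scale[OF compl(2), of "-1"]]
    have one: "approximable p (\<lambda>x. 1 + - 1 * indicator A x)" .
    have [measurable]: "A \<in> sets M" using compl(1) setsM by simp
    have "space M - A \<in> sets M" by measurable
    show ?case
    proof (rule approximable_closed[OF Lp_fun_indicator[OF \<open>space M - A \<in> sets M\<close>] one])
      have "Lp_seminorm p M (\<lambda>x. (1 + - 1 * indicator A x) - indicator (space M - A) x) = Lp_seminorm p M (\<lambda>x. 0)"
        by (rule Lp_seminorm_cong_AE, measurable) (auto simp: indicator_def)
      then show "(\<lambda>i. Lp_seminorm p M (\<lambda>x. (1 + - 1 * indicator A x) - indicator (space M - A) x)) \<longlonglongrightarrow> 0"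
        by (simp add: Lp_seminorm_def)
    qed
  next
    case (union A)
    have A: "\<And>i. A i \<in> sets M" using union(2) setsM by auto
    have sums: "(\<lambda>i. indicator (A i) x :: real) sums indicator (\<Union>i. A i) x" for x
      by (rule indicator_sums) (use union(1) in \<open>auto simp: disjoint_family_on_def\<close>)
    let ?s = "\<lambda>n x. \<Sum>i<n. indicator (A i) x :: real"
    \<comment> \<open>The partial sums lie between \<open>0\<close> and the indicator, so \<open>1\<close> is a dominating function.\<close>
    have le: "\<bar>?s n x - indicator (\<Union>i. A i) x\<bar> \<le> 1" for n x
    proof -
      have "0 \<le> ?s n x" by (intro sum_nonneg) simp
      moreover have "?s n x \<le> indicator (\<Union>i. A i) x"
        unfolding sums_unique[OF sums, of x] by (rule sum_le_suminf[OF sums_summable[OF sums]]) auto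
      ultimately show ?thesis by (auto simp: indicator_def split: if_splits)
    qed
    show ?case
    proof (rule approximable_closed)
      show "indicator (\<Union>i. A i) \<in> Lp_fun p M" by (rule Lp_fun_indicator) (use A in auto)
      show "approximable p (?s n)" for n by (rule approximable_sum) (use union(3) in auto)
      show "(\<lambda>n. Lp_seminorm p M (\<lambda>x. ?s n x - indicator (\<Union>i. A i) x)) \<longlonglongrightarrow> 0"
      proof (rule Lp_dominated_convergence[OF p, where w = "\<lambda>_. 1"])
        show "AE x in M. (\<lambda>n. ?s n x) \<longlonglongrightarrow> indicator (\<Union>i. A i) x"
          using sums by (simp add: sums_def)
        show "AE x in M. \<bar>?s n x - indicator (\<Union>i. A i) x\<bar> \<le> 1" for n by (intro AE_I2 le)
      qed (use A Lp_fun_const in auto)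
    qed
  qed
qed

lemma Lp_fun_approximable:
  assumes f: "f \<in> Lp_fun p M"
  shows "approximable p f"
proof -
  have "\<exists>s. (\<forall>i. simple_function M (s i)) \<and> (\<forall>x\<in>space M. (\<lambda>i. s i x) \<longlonglongrightarrow> f x) \<and>
      (\<forall>i. \<forall>x\<in>space M. dist (s i x) 0 \<le> 2 * dist (f x) 0)"
    by (rule borel_measurable_implies_sequence_metric[OF Lp_fun_measurable[OF f]])
  then obtain s where "\<forall>i. simple_function M (s i)" "\<forall>x\<in>space M. (\<lambda>i. s i x) \<longlonglongrightarrow> f x"
    "\<forall>i. \<forall>x\<in>space M. dist (s i x) 0 \<le> 2 * dist (f x) 0" by blast
  then have s: "\<And>i. simple_function M (s i)" "\<And>x. x \<in> space M \<Longrightarrow> (\<lambda>i. s i x) \<longlonglongrightarrow> f x"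
    "\<And>i x. x \<in> space M \<Longrightarrow> \<bar>s i x\<bar> \<le> 2 * \<bar>f x\<bar>" by auto
  have sm: "s i \<in> borel_measurable M" for i by (rule borel_measurable_simple_function[OF s(1)])
  have sp: "s i \<in> Lp_fun p M" for i
    by (rule Lp_fun_bound[OF p sm Lp_fun_scale[OF f, of 2]]) (use s(3) in \<open>auto simp: abs_mult\<close>)
  have sa: "approximable p (s i)" for i
  proof (rule approximable_closed[OF sp])
    let ?r = "\<lambda>x. \<Sum>y\<in>s i ` space M. y * indicator (s i -` {y} \<inter> space M) x"
    show r: "approximable p ?r"
      using simple_functionD[OF s(1)]
      by (intro approximable_sum approximable_scale approximable_indicator) auto
    have "Lp_seminorm p M (\<lambda>x. ?r x - s i x) = Lp_seminorm p M (\<lambda>x. 0)"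
    proof (rule Lp_seminorm_cong_AE)
      show "(\<lambda>x. ?r x - s i x) \<in> borel_measurable M"
        using r sm by (auto simp: approximable_def Lp_fun_def)
      show "AE x in M. ?r x - s i x = 0"
      proof (rule AE_I2)
        fix x assume that: "x \<in> space M"
        have "s i x = (\<Sum>y\<in>s i ` space M. indicator (s i -` {y} \<inter> space M) x *\<^sub>R y)"
          by (rule simple_function_indicator_representation_banach[OF s(1) that])
        also have "\<dots> = ?r x" by (rule sum.cong[OF refl]) (simp only: real_scaleR_def mult.commute)
        finally show "?r x - s i x = 0" by linarith
      qed
    qed simp
    then show "(\<lambda>_. Lp_seminorm p M (\<lambda>x. ?r x - s i x)) \<longlonglongrightarrow> 0" by (simp add: Lp_seminorm_def)
  qed
  show ?thesis
  proof (rule approximable_closed[OF f sa], rule Lp_dominated_convergence[OF p sm Lp_fun_measurable[OF f]])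
    show "(\<lambda>x. 3 * \<bar>f x\<bar>) \<in> Lp_fun p M" by (intro Lp_fun_scale Lp_fun_abs f)
    show "AE x in M. (\<lambda>i. s i x) \<longlonglongrightarrow> f x" using s(2) by (intro AE_I2)
    show "AE x in M. \<bar>s i x - f x\<bar> \<le> 3 * \<bar>f x\<bar>" for i using s(3)[of _ i] by (intro AE_I2) fastforce
  qed
qed

text \<open>
  Martingale convergence in \<open>L\<^sup>p\<close> for the martingale of conditional expectations of \<open>f\<close>: approximate \<open>f\<close> by
  a function \<open>u\<close> of level \<open>n0\<close>; from \<open>n0\<close> on, \<open>u\<close> is fixed by the conditional expectations.
\<close>
theorem cond_exp_level_tendsto:
  assumes f: "f \<in> Lp_fun p M"
  shows "(\<lambda>n. Lp_seminorm p M (\<lambda>x. real_cond_exp M (level n) f x - f x)) \<longlonglongrightarrow> 0"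
proof (rule LIMSEQ_I)
  fix r :: real assume "0 < r"
  then have e: "0 < r / 2" by simp
  obtain n0 u where u: "u \<in> Lp_fun p M" "u \<in> borel_measurable (level n0)"
    "Lp_seminorm p M (\<lambda>x. f x - u x) < r / 2"
    using approximableD[OF Lp_fun_approximable[OF f] e] .
  have "Lp_seminorm p M (\<lambda>x. real_cond_exp M (level n) f x - f x) < r" if n: "n0 \<le> n" for n
    using finite_measure_subalgebra.cond_exp_approx[OF finite_measure_subalgebra_level p f u(1)
        level_measurable_mono[OF n u(2)]] u(3) by simp
  then show "\<exists>n0. \<forall>n\<ge>n0. norm (Lp_seminorm p M (\<lambda>x. real_cond_exp M (level n) f x - f x) - 0) < r"
    by auto
qed

end

end

context measure_tower
begin

section \<open>The limit isometry of a tower\<close>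

definition tower_limit :: "real \<Rightarrow> (nat \<Rightarrow> ('b \<Rightarrow> real) set) \<Rightarrow> ('a \<Rightarrow> real) set \<Rightarrow> bool" where
  "tower_limit p f V \<longleftrightarrow> Lp_limit p M (\<lambda>n. Lp_pullback p M (\<phi> n) (f n)) V"

text \<open>
  The co-Cauchy sequences with limit \<open>V\<close>. The elements of \<open>co_Lp p N \<pi>\<close> turn out to be exactly these
  sets, which makes every operation on them an operation on \<open>V\<close>.
\<close>
definition fibre :: "real \<Rightarrow> ('a \<Rightarrow> real) set \<Rightarrow> (nat \<Rightarrow> ('b \<Rightarrow> real) set) set" where
  "fibre p V = {f \<in> co_Cauchy p N \<pi>. tower_limit p f V}"

definition limit_map :: "real \<Rightarrow> (nat \<Rightarrow> ('b \<Rightarrow> real) set) set \<Rightarrow> ('a \<Rightarrow> real) set" where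
  "limit_map p A = (THE V. \<forall>f\<in>A. tower_limit p f V)"

definition level_exp :: "real \<Rightarrow> ('a \<Rightarrow> real) set \<Rightarrow> nat \<Rightarrow> ('b \<Rightarrow> real) set" where
  "level_exp p V n =
    inv_into (vcarrier (Lp p (N n))) (Lp_pullback p M (\<phi> n)) (Lp_cond_exp p M (level n) V)"

context
  fixes p :: real
  assumes p: "1 \<le> p"
begin

lemmas pull_carrier = Lp_pullback_carrier[OF phi_measurable distr_phi]
lemmas pull_vdist = Lp_pullback_vdist[OF phi_measurable distr_phi p]

text \<open>
  Because of this, all distances between levels can be measured in \<open>Lp p M\<close>, where co-Cauchy just means
  Cauchy. It holds since \<open>\<pi> n m\<close> after \<open>\<phi> m\<close> is \<open>\<phi> n\<close>.
\<close>
lemma pull_proj: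
  assumes "n \<le> m" "u \<in> vcarrier (Lp p (N n))"
  shows "Lp_pullback p M (\<phi> m) (Lp_pullback p (N m) (\<pi> n m) u) = Lp_pullback p M (\<phi> n) u"
proof -
  obtain f where f: "f \<in> Lp_fun p (N n)" "u = Lp_class p (N n) f" using assms(2) by (rule Lp_carrierE)
  note pr = proj_measurable[OF assms(1)] distr_proj[OF assms(1)]
  have "Lp_class p M (\<lambda>x. f (\<pi> n m (\<phi> m x))) = Lp_class p M (\<lambda>x. f (\<phi> n x))"
    by (rule Lp_class_cong_AE) (simp add: proj_phi[OF assms(1)])
  then show ?thesis
    by (simp only: f(2) Lp_pullback_class[OF pr f(1)] Lp_pullback_class[OF phi_measurable distr_phi f(1)]
        Lp_pullback_class[OF phi_measurable distr_phi Lp_fun_comp[OF pr f(1)]])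
qed

lemma vdist_proj:
  assumes f: "\<And>n. f n \<in> vcarrier (Lp p (N n))" and "n \<le> m"
  shows "vdist (Lp p (N m)) (Lp_pullback p (N m) (\<pi> n m) (f n)) (f m)
    = vdist (Lp p M) (Lp_pullback p M (\<phi> n) (f n)) (Lp_pullback p M (\<phi> m) (f m))"
  using pull_vdist[OF Lp_pullback_carrier[OF proj_measurable[OF assms(2)] distr_proj[OF assms(2)] f] f]
  by (simp add: pull_proj[OF assms(2) f])

text \<open>
  One direction is completeness of \<open>Lp p M\<close>.
\<close>
lemma co_Cauchy_iff:
  "f \<in> co_Cauchy p N \<pi> \<longleftrightarrow> (\<forall>n. f n \<in> vcarrier (Lp p (N n))) \<and> (\<exists>V. tower_limit p f V)"
proof (cases "\<forall>n. f n \<in> vcarrier (Lp p (N n))")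
  case True
  let ?u = "\<lambda>n. Lp_pullback p M (\<phi> n) (f n)"
  have u: "?u n \<in> vcarrier (Lp p M)" for n using pull_carrier True by blast
  have "f \<in> co_Cauchy p N \<pi> \<longleftrightarrow>
      (\<forall>\<epsilon>>0. \<exists>k. \<forall>n m. k \<le> n \<and> n \<le> m \<longrightarrow> vdist (Lp p M) (?u n) (?u m) < \<epsilon>)"
    using True by (simp add: co_Cauchy_def vdist_proj)
  also have "\<dots> \<longleftrightarrow> (\<exists>V. tower_limit p f V)"
  proof
    assume "\<forall>\<epsilon>>0. \<exists>k. \<forall>n m. k \<le> n \<and> n \<le> m \<longrightarrow> vdist (Lp p M) (?u n) (?u m) < \<epsilon>"
    then obtain V where "Lp_limit p M ?u V" using Lp_Cauchy_limit[where u = ?u, OF p u] by metis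
    then show "\<exists>V. tower_limit p f V" unfolding tower_limit_def by blast
  next
    assume "\<exists>V. tower_limit p f V"
    then obtain V where "Lp_limit p M ?u V" unfolding tower_limit_def by blast
    then show "\<forall>\<epsilon>>0. \<exists>k. \<forall>n m. k \<le> n \<and> n \<le> m \<longrightarrow> vdist (Lp p M) (?u n) (?u m) < \<epsilon>"
      using Lp_limit_Cauchy[where u = ?u, OF p u] by blast
  qed
  finally show ?thesis using True by blast
qed (auto simp: co_Cauchy_def)

lemma tower_limit_carrier: "tower_limit p f V \<Longrightarrow> V \<in> vcarrier (Lp p M)"
  by (simp add: tower_limit_def Lp_limit_def)

lemma co_class_eq_fibre:
  assumes f: "\<And>n. f n \<in> vcarrier (Lp p (N n))" and lim: "tower_limit p f V"
  shows "co_class p N \<pi> f = fibre p V"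
proof -
  have "(\<lambda>n. vdist (Lp p (N n)) (f n) (g n)) \<longlonglongrightarrow> 0 \<longleftrightarrow> tower_limit p g V"
    if g: "g \<in> co_Cauchy p N \<pi>" for g
  proof -
    have g': "g n \<in> vcarrier (Lp p (N n))" for n using g by (simp add: co_Cauchy_def)
    show ?thesis
      using Lp_limit_iff_of_dist[where u = "\<lambda>n. Lp_pullback p M (\<phi> n) (f n)"
          and w = "\<lambda>n. Lp_pullback p M (\<phi> n) (g n)",
          OF p pull_carrier[OF f] pull_carrier[OF g'] lim[unfolded tower_limit_def]]
      by (simp add: tower_limit_def pull_vdist[OF f g'])
  qed
  then show ?thesis unfolding co_class_def fibre_def by auto
qed

text \<open>
  The inverse image taken in \<open>level_exp\<close> exists: the conditional expectation is measurable at level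
  \<open>n\<close>, so it factors through \<open>\<phi> n\<close>, and the factor is \<open>p\<close>-integrable because \<open>\<phi> n\<close> preserves measure.
\<close>
lemma level_exp_carrier:
  assumes V: "V \<in> vcarrier (Lp p M)"
  shows "level_exp p V n \<in> vcarrier (Lp p (N n))"
    and "Lp_pullback p M (\<phi> n) (level_exp p V n) = Lp_cond_exp p M (level n) V"
proof -
  obtain f where f: "f \<in> Lp_fun p M" "V = Lp_class p M f" using V by (rule Lp_carrierE)
  interpret F: finite_measure_subalgebra M "level n" by (rule finite_measure_subalgebra_level)
  have "real_cond_exp M (level n) f \<in> borel_measurable (vimage_algebra (space M) (\<phi> n) (N n))"
    using borel_measurable_cond_exp[of M "level n" f] by (simp add: level_def)
  then obtain g where g: "g \<in> borel_measurable (N n)"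
    "\<And>x. x \<in> space M \<Longrightarrow> real_cond_exp M (level n) f x = g (\<phi> n x)"
    using measurable_vimage_algebra_factor[OF phi_space] by blast
  have "(\<lambda>x. g (\<phi> n x)) \<in> Lp_fun p M"
  proof (rule Lp_fun_bound[OF p])
    show "real_cond_exp M (level n) f \<in> Lp_fun p M" by (rule F.Lp_cond_exp_contraction(1)[OF p f(1)])
    show "(\<lambda>x. g (\<phi> n x)) \<in> borel_measurable M" using g(1) by measurable
    show "AE x in M. \<bar>g (\<phi> n x)\<bar> \<le> \<bar>real_cond_exp M (level n) f x\<bar>" by (rule AE_I2) (simp add: g(2))
  qed
  then have gp: "g \<in> Lp_fun p (N n)"
    using Lp_fun_comp_iff[OF phi_measurable distr_phi g(1)] by blast
  have "Lp_class p M (\<lambda>x. g (\<phi> n x)) = Lp_class p M (real_cond_exp M (level n) f)"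
    by (rule Lp_class_cong_AE) (simp add: g(2))
  then have "Lp_pullback p M (\<phi> n) (Lp_class p (N n) g) = Lp_cond_exp p M (level n) V"
    unfolding f(2) F.Lp_cond_exp_class[OF f(1)]
    by (simp add: Lp_pullback_class[OF phi_measurable distr_phi gp])
  then have "Lp_cond_exp p M (level n) V \<in> Lp_pullback p M (\<phi> n) ` vcarrier (Lp p (N n))"
    using Lp_class_carrier[OF gp] by (metis imageI)
  then show "level_exp p V n \<in> vcarrier (Lp p (N n))"
    and "Lp_pullback p M (\<phi> n) (level_exp p V n) = Lp_cond_exp p M (level n) V"
    unfolding level_exp_def by (rule inv_into_into, rule f_inv_into_f)
qed

lemma level_exp_limit:
  assumes V: "V \<in> vcarrier (Lp p M)"
  shows "tower_limit p (level_exp p V) V"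
proof -
  obtain f where f: "f \<in> Lp_fun p M" "V = Lp_class p M f" using V by (rule Lp_carrierE)
  have "vdist (Lp p M) (Lp_cond_exp p M (level n) V) V
      = Lp_seminorm p M (\<lambda>x. real_cond_exp M (level n) f x - f x)" for n
  proof -
    interpret F: finite_measure_subalgebra M "level n" by (rule finite_measure_subalgebra_level)
    show ?thesis
      unfolding f(2) F.Lp_cond_exp_class[OF f(1)]
      by (rule vdist_Lp_class[OF p F.Lp_cond_exp_contraction(1)[OF p f(1)] f(1)])
  qed
  then show ?thesis
    using cond_exp_level_tendsto[OF p f(1)] V
    by (simp add: tower_limit_def Lp_limit_def level_exp_carrier(2)[OF V])
qed

lemma level_exp_co_Cauchy:
  "V \<in> vcarrier (Lp p M) \<Longrightarrow> level_exp p V \<in> co_Cauchy p N \<pi>"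
  using level_exp_carrier(1) level_exp_limit co_Cauchy_iff by blast

lemma co_class_level_exp:
  "V \<in> vcarrier (Lp p M) \<Longrightarrow> co_class p N \<pi> (level_exp p V) = fibre p V"
  by (rule co_class_eq_fibre[OF level_exp_carrier(1) level_exp_limit])

text \<open>
  Surjectivity of the limit map: no fibre is empty.
\<close>
lemma level_exp_in_fibre: "V \<in> vcarrier (Lp p M) \<Longrightarrow> level_exp p V \<in> fibre p V"
  by (simp add: fibre_def level_exp_co_Cauchy level_exp_limit)

lemma fibreD:
  assumes "f \<in> fibre p V"
  shows "f n \<in> vcarrier (Lp p (N n))" "tower_limit p f V"
  using assms by (auto simp: fibre_def co_Cauchy_def)

lemma limit_map_fibre:
  assumes V: "V \<in> vcarrier (Lp p M)"
  shows "limit_map p (fibre p V) = V"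
  unfolding limit_map_def
proof (rule the_equality)
  show "\<forall>f\<in>fibre p V. tower_limit p f V" by (simp add: fibre_def)
  fix W assume "\<forall>f\<in>fibre p V. tower_limit p f W"
  then have "tower_limit p (level_exp p V) W" using level_exp_in_fibre[OF V] by blast
  then show "W = V"
    using level_exp_limit[OF V] pull_carrier[OF level_exp_carrier(1)[OF V]]
    unfolding tower_limit_def by (intro Lp_limit_unique[OF p])
qed

lemma co_Lp_carrier: "vcarrier (co_Lp p N \<pi>) = fibre p ` vcarrier (Lp p M)"
proof -
  have "co_class p N \<pi> f \<in> fibre p ` vcarrier (Lp p M)" if "f \<in> co_Cauchy p N \<pi>" for f
  proof -
    obtain V where V: "\<And>n. f n \<in> vcarrier (Lp p (N n))" "tower_limit p f V"
      using \<open>f \<in> co_Cauchy p N \<pi>\<close> co_Cauchy_iff by blast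
    show ?thesis
      unfolding co_class_eq_fibre[OF V] by (rule imageI[OF tower_limit_carrier[OF V(2)]])
  qed
  moreover have "fibre p V \<in> co_class p N \<pi> ` co_Cauchy p N \<pi>" if "V \<in> vcarrier (Lp p M)" for V
    using co_class_level_exp[OF that, symmetric] level_exp_co_Cauchy[OF that] by blast
  ultimately show ?thesis by (auto simp: co_Lp_def)
qed

lemma tower_limit_vadd:
  assumes f: "\<And>n. f n \<in> vcarrier (Lp p (N n))" "tower_limit p f V"
    and g: "\<And>n. g n \<in> vcarrier (Lp p (N n))" "tower_limit p g W"
  shows "tower_limit p (\<lambda>n. vadd (Lp p (N n)) (f n) (g n)) (vadd (Lp p M) V W)"
proof -
  have V: "V \<in> vcarrier (Lp p M)" and W: "W \<in> vcarrier (Lp p M)"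
    using tower_limit_carrier f(2) g(2) by blast+
  have "(\<lambda>n. vdist (Lp p M) (vadd (Lp p M) (Lp_pullback p M (\<phi> n) (f n)) (Lp_pullback p M (\<phi> n) (g n)))
      (vadd (Lp p M) V W)) \<longlonglongrightarrow> 0"
  proof (rule Lim_null_comparison)
    show "(\<lambda>n. vdist (Lp p M) (Lp_pullback p M (\<phi> n) (f n)) V
        + vdist (Lp p M) (Lp_pullback p M (\<phi> n) (g n)) W) \<longlonglongrightarrow> 0"
      using f(2) g(2) tendsto_add[of _ 0 _ _ "0::real"] by (force simp: tower_limit_def Lp_limit_def)
    show "\<forall>\<^sub>F n in sequentially. norm (vdist (Lp p M) (vadd (Lp p M) (Lp_pullback p M (\<phi> n) (f n))
          (Lp_pullback p M (\<phi> n) (g n))) (vadd (Lp p M) V W))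
        \<le> vdist (Lp p M) (Lp_pullback p M (\<phi> n) (f n)) V + vdist (Lp p M) (Lp_pullback p M (\<phi> n) (g n)) W"
    proof (rule always_eventually, rule allI)
      fix n
      note c = pull_carrier[OF f(1)[of n]] pull_carrier[OF g(1)[of n]]
      show "norm (vdist (Lp p M) (vadd (Lp p M) (Lp_pullback p M (\<phi> n) (f n))
          (Lp_pullback p M (\<phi> n) (g n))) (vadd (Lp p M) V W))
        \<le> vdist (Lp p M) (Lp_pullback p M (\<phi> n) (f n)) V + vdist (Lp p M) (Lp_pullback p M (\<phi> n) (g n)) W"
        using vdist_Lp_vadd[OF p c V W] vdist_Lp_nonneg[OF p vadd_Lp_carrier[OF p c] vadd_Lp_carrier[OF p V W]]
        by simp
    qed
  qed
  then show ?thesis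
    using vadd_Lp_carrier[OF p V W]
    by (simp add: tower_limit_def Lp_limit_def Lp_pullback_vadd[OF phi_measurable distr_phi p f(1) g(1)])
qed

lemma tower_limit_vscale:
  assumes f: "\<And>n. f n \<in> vcarrier (Lp p (N n))" "tower_limit p f V"
  shows "tower_limit p (\<lambda>n. vscale (Lp p (N n)) a (f n)) (vscale (Lp p M) a V)"
proof -
  have V: "V \<in> vcarrier (Lp p M)" using f(2) by (rule tower_limit_carrier)
  have "(\<lambda>n. \<bar>a\<bar> * vdist (Lp p M) (Lp_pullback p M (\<phi> n) (f n)) V) \<longlonglongrightarrow> 0"
    using f(2) by (auto simp: tower_limit_def Lp_limit_def intro: tendsto_mult_right_zero)
  then show ?thesis
    using vscale_Lp_carrier[OF p V]
    by (simp add: tower_limit_def Lp_limit_def Lp_pullback_vscale[OF phi_measurable distr_phi p f(1)]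
        vdist_Lp_vscale[OF p pull_carrier[OF f(1)] V])
qed

lemma tower_limit_vnorm:
  assumes f: "\<And>n. f n \<in> vcarrier (Lp p (N n))" "tower_limit p f V"
  shows "(\<lambda>n. vnorm (Lp p (N n)) (f n)) \<longlonglongrightarrow> vnorm (Lp p M) V"
proof -
  have V: "V \<in> vcarrier (Lp p M)" using f(2) by (rule tower_limit_carrier)
  have "(\<lambda>n. vnorm (Lp p M) (Lp_pullback p M (\<phi> n) (f n)) - vnorm (Lp p M) V) \<longlonglongrightarrow> 0"
  proof (rule Lim_null_comparison)
    show "(\<lambda>n. vdist (Lp p M) (Lp_pullback p M (\<phi> n) (f n)) V) \<longlonglongrightarrow> 0"
      using f(2) by (simp add: tower_limit_def Lp_limit_def)
    show "\<forall>\<^sub>F n in sequentially. norm (vnorm (Lp p M) (Lp_pullback p M (\<phi> n) (f n)) - vnorm (Lp p M) V)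
        \<le> vdist (Lp p M) (Lp_pullback p M (\<phi> n) (f n)) V"
      using vnorm_Lp_diff[OF p pull_carrier[OF f(1)] V] by simp
  qed
  from LIM_zero_cancel[OF this] show ?thesis
    by (simp add: Lp_pullback_vnorm[OF phi_measurable distr_phi p f(1)])
qed

lemma vadd_fibre:
  assumes V: "V \<in> vcarrier (Lp p M)" and W: "W \<in> vcarrier (Lp p M)"
  shows "vadd (co_Lp p N \<pi>) (fibre p V) (fibre p W) = fibre p (vadd (Lp p M) V W)"
  unfolding co_Lp_def normed_structure.simps
proof (intro UN_constant_value)
  fix f g assume fg: "f \<in> fibre p V" "g \<in> fibre p W"
  show "co_class p N \<pi> (\<lambda>n. vadd (Lp p (N n)) (f n) (g n)) = fibre p (vadd (Lp p M) V W)"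
    by (rule co_class_eq_fibre[OF vadd_Lp_carrier[OF p fibreD(1)[OF fg(1)] fibreD(1)[OF fg(2)]]
          tower_limit_vadd[OF fibreD[OF fg(1)] fibreD[OF fg(2)]]])
qed (use level_exp_in_fibre V W in blast)+

lemma vscale_fibre:
  assumes V: "V \<in> vcarrier (Lp p M)"
  shows "vscale (co_Lp p N \<pi>) a (fibre p V) = fibre p (vscale (Lp p M) a V)"
  unfolding co_Lp_def normed_structure.simps
proof (intro UN_constant_value)
  fix f assume f: "f \<in> fibre p V"
  show "co_class p N \<pi> (\<lambda>n. vscale (Lp p (N n)) a (f n)) = fibre p (vscale (Lp p M) a V)"
    by (rule co_class_eq_fibre[OF vscale_Lp_carrier[OF p fibreD(1)[OF f]] tower_limit_vscale[OF fibreD[OF f]]])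
qed (use level_exp_in_fibre V in blast)

lemma vnorm_fibre:
  assumes V: "V \<in> vcarrier (Lp p M)"
  shows "vnorm (co_Lp p N \<pi>) (fibre p V) = vnorm (Lp p M) V"
  unfolding co_Lp_def normed_structure.simps
proof (rule the_elem_image)
  show "fibre p V \<noteq> {}" using level_exp_in_fibre[OF V] by blast
  fix f assume f: "f \<in> fibre p V"
  show "lim (\<lambda>n. vnorm (Lp p (N n)) (f n)) = vnorm (Lp p M) V"
    by (rule limI[OF tower_limit_vnorm[OF fibreD[OF f]]])
qed

text \<open>
  The map \<open>V \<mapsto> fibre p V\<close> is inverse to the limit map and carries the structure of \<open>Lp p M\<close> to that
  of \<open>co_Lp p N \<pi>\<close>.
\<close>
theorem limit_map_isometric_isomorphism:
  "isometric_isomorphism (co_Lp p N \<pi>) (Lp p M) (limit_map p)"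
  unfolding isometric_isomorphism_def
proof (intro conjI ballI allI)
  show "bij_betw (limit_map p) (vcarrier (co_Lp p N \<pi>)) (vcarrier (Lp p M))"
    unfolding co_Lp_carrier
    by (rule bij_betw_byWitness[where f' = "fibre p"]) (auto simp: limit_map_fibre)
next
  fix u v assume "u \<in> vcarrier (co_Lp p N \<pi>)" "v \<in> vcarrier (co_Lp p N \<pi>)"
  then show "limit_map p (vadd (co_Lp p N \<pi>) u v) = vadd (Lp p M) (limit_map p u) (limit_map p v)"
    unfolding co_Lp_carrier by (auto simp: limit_map_fibre vadd_fibre vadd_Lp_carrier[OF p])
next
  fix a u assume "u \<in> vcarrier (co_Lp p N \<pi>)"
  then show "limit_map p (vscale (co_Lp p N \<pi>) a u) = vscale (Lp p M) a (limit_map p u)"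
    unfolding co_Lp_carrier by (auto simp: limit_map_fibre vscale_fibre vscale_Lp_carrier[OF p])
next
  fix u assume "u \<in> vcarrier (co_Lp p N \<pi>)"
  then show "vnorm (Lp p M) (limit_map p u) = vnorm (co_Lp p N \<pi>) u"
    unfolding co_Lp_carrier by (auto simp: limit_map_fibre vnorm_fibre)
qed

theorem limit_map_tower_limit:
  assumes "f \<in> co_Cauchy p N \<pi>"
  shows "tower_limit p f (limit_map p (co_class p N \<pi> f))"
proof -
  obtain V where V: "\<And>n. f n \<in> vcarrier (Lp p (N n))" "tower_limit p f V"
    using assms co_Cauchy_iff by blast
  then show ?thesis
    by (simp add: co_class_eq_fibre[OF V] limit_map_fibre[OF tower_limit_carrier[OF V(2)]])
qed

theorem inv_limit_map:
  assumes V: "V \<in> vcarrier (Lp p M)"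
  shows "inv_into (vcarrier (co_Lp p N \<pi>)) (limit_map p) V = co_class p N \<pi> (level_exp p V)"
proof (rule inv_into_f_eq)
  show "inj_on (limit_map p) (vcarrier (co_Lp p N \<pi>))"
    using limit_map_isometric_isomorphism by (simp add: isometric_isomorphism_def bij_betw_def)
  show "co_class p N \<pi> (level_exp p V) \<in> vcarrier (co_Lp p N \<pi>)"
    by (simp add: co_class_level_exp[OF V] co_Lp_carrier V)
  show "limit_map p (co_class p N \<pi> (level_exp p V)) = V"
    by (simp add: co_class_level_exp[OF V] limit_map_fibre[OF V])
qed

text \<open>
  Conditional expectations keep the integral, and so do measure preserving maps. The integrals in the
  limit formula are therefore all equal to their limit.
\<close>
theorem integral_level_exp:
  assumes V: "V \<in> vcarrier (Lp p M)" and v: "v \<in> V" and u: "u \<in> level_exp p V n"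
  shows "integral\<^sup>L (N n) u = integral\<^sup>L M v"
proof -
  interpret F: finite_measure_subalgebra M "level n" by (rule finite_measure_subalgebra_level)
  note u' = Lp_carrier_memD[OF level_exp_carrier(1)[OF V] u]
  note v' = Lp_carrier_memD[OF V v]
  have iv: "integrable M v" by (rule Lp_fun_integrable_real[OF finite_measure_axioms p v'(1)])
  have "Lp_class p M (\<lambda>x. u (\<phi> n x)) = Lp_class p M (real_cond_exp M (level n) v)"
    using level_exp_carrier(2)[OF V, of n] v'(2) u'
    by (metis F.Lp_cond_exp_class Lp_pullback_class phi_measurable distr_phi v'(1))
  then have ae: "AE x in M. u (\<phi> n x) = real_cond_exp M (level n) v x"
    by (rule Lp_class_eqD[OF Lp_fun_comp[OF phi_measurable distr_phi u'(1)]])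
  have um: "u \<in> borel_measurable (N n)" by (rule Lp_fun_measurable[OF u'(1)])
  have "integral\<^sup>L (N n) u = (\<integral>x. u (\<phi> n x) \<partial>M)"
    using integral_distr[OF phi_measurable um] by (simp only: distr_phi)
  also have "\<dots> = (\<integral>x. real_cond_exp M (level n) v x \<partial>M)"
    by (rule integral_cong_AE) (use ae um in auto)
  also have "\<dots> = integral\<^sup>L M v" by (rule F.real_cond_exp_int(2)[OF iv])
  finally show ?thesis .
qed

end

end

section \<open>Measures on functionals are determined by their characteristic function\<close>

text \<open>
  The sigma-algebra generated by the evaluations at points of \<open>V\<close>. Both the cylinder algebra on \<open>E'\<close> and
  the Borel algebra on the dual of a finite-dimensional space are of this form.
\<close>
definition eval_algebra :: "('e \<Rightarrow> real) set \<Rightarrow> 'e set \<Rightarrow> ('e \<Rightarrow> real) measure" where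
  "eval_algebra \<Omega> V = sigma \<Omega> {{l \<in> \<Omega>. l x \<in> B} | x B. x \<in> V \<and> B \<in> sets (borel :: real measure)}"

lemma space_eval_algebra [simp]: "space (eval_algebra \<Omega> V) = \<Omega>"
  by (auto simp: eval_algebra_def space_measure_of_conv)

lemma sets_eval_algebra:
  "sets (eval_algebra \<Omega> V) =
    sigma_sets \<Omega> {{l \<in> \<Omega>. l x \<in> B} | x B. x \<in> V \<and> B \<in> sets (borel :: real measure)}"
  unfolding eval_algebra_def by (rule sets_measure_of) auto

lemma eval_measurable:
  "x \<in> V \<Longrightarrow> (\<lambda>l. l x) \<in> borel_measurable (eval_algebra \<Omega> V)"
proof (rule measurableI)
  fix B :: "real set" assume "x \<in> V" "B \<in> sets borel"
  then show "(\<lambda>l. l x) -` B \<inter> space (eval_algebra \<Omega> V) \<in> sets (eval_algebra \<Omega> V)"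
    unfolding sets_eval_algebra by (intro sigma_sets.Basic) auto
qed simp

lemma measurable_into_eval_algebra:
  assumes "\<And>\<omega>. \<omega> \<in> space M \<Longrightarrow> f \<omega> \<in> \<Omega>"
    and ev: "\<And>x. x \<in> V \<Longrightarrow> (\<lambda>\<omega>. f \<omega> x) \<in> borel_measurable M"
  shows "f \<in> measurable M (eval_algebra \<Omega> V)"
  unfolding eval_algebra_def
proof (rule measurable_measure_of)
  fix S assume "S \<in> {{l \<in> \<Omega>. l x \<in> B} | x B. x \<in> V \<and> B \<in> sets (borel :: real measure)}"
  then obtain x B where S: "S = {l \<in> \<Omega>. l x \<in> B}" "x \<in> V" "B \<in> sets borel" by auto
  have "f -` S \<inter> space M = (\<lambda>\<omega>. f \<omega> x) -` B \<inter> space M" using assms(1) S by auto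
  also have "\<dots> \<in> sets M" by (rule measurable_sets[OF ev[OF S(2)] S(3)])
  finally show "f -` S \<inter> space M \<in> sets M" .
qed (use assms(1) in auto)

text \<open>
  Levy's uniqueness theorem on the line, applied to the distributions of \<open>X\<close> and \<open>Y\<close> under the measures
  with densities \<open>w / c\<close> and \<open>v / c\<close>. The common total mass \<open>c\<close> is the transform at \<open>0\<close>; if it vanishes,
  both sides are \<open>0\<close>.
\<close>
lemma weighted_Levy_uniqueness:
  fixes X :: "'a \<Rightarrow> real" and Y :: "'b \<Rightarrow> real"
  assumes X [measurable]: "X \<in> borel_measurable M" and Y [measurable]: "Y \<in> borel_measurable N"
    and w: "integrable M w" "\<And>x. 0 \<le> w x" and v: "integrable N v" "\<And>x. 0 \<le> v x"
    and eq: "\<And>t. (CLINT x|M. w x *\<^sub>R iexp (t * X x)) = (CLINT y|N. v y *\<^sub>R iexp (t * Y y))"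
    and A [measurable]: "A \<in> sets borel"
  shows "(LINT x|M. w x * indicator A (X x)) = (LINT y|N. v y * indicator A (Y y))"
proof -
  note [measurable] = borel_measurable_integrable[OF w(1)] borel_measurable_integrable[OF v(1)]
  define c where "c = integral\<^sup>L M w"
  have cv: "c = integral\<^sup>L N v"
  proof -
    have "complex_of_real c = complex_of_real (integral\<^sup>L N v)"
      using eq[of 0] by (simp add: c_def scaleR_conv_of_real)
    then show ?thesis by simp
  qed
  have c0: "0 \<le> c" unfolding c_def using w(2) by (intro integral_nonneg_AE) auto
  have iw: "integrable M (\<lambda>x. w x * indicator A (X x))"
  proof (rule Bochner_Integration.integrable_bound[OF w(1)])
    show "(\<lambda>x. w x * indicator A (X x)) \<in> borel_measurable M" by measurable
    show "AE x in M. norm (w x * indicator A (X x)) \<le> norm (w x)" by (rule AE_I2) (simp add: indicator_def)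
  qed
  have iv: "integrable N (\<lambda>x. v x * indicator A (Y x))"
  proof (rule Bochner_Integration.integrable_bound[OF v(1)])
    show "(\<lambda>x. v x * indicator A (Y x)) \<in> borel_measurable N" by measurable
    show "AE x in N. norm (v x * indicator A (Y x)) \<le> norm (v x)" by (rule AE_I2) (simp add: indicator_def)
  qed
  show ?thesis
  proof (cases "c = 0")
    case True
    have "(LINT x|M. w x * indicator A (X x)) \<le> c" unfolding c_def
      by (rule integral_mono[OF iw w(1)]) (use w(2) in \<open>auto simp: indicator_def\<close>)
    moreover have "(LINT x|N. v x * indicator A (Y x)) \<le> c" unfolding cv
      by (rule integral_mono[OF iv v(1)]) (use v(2) in \<open>auto simp: indicator_def\<close>)
    moreover have "0 \<le> (LINT x|M. w x * indicator A (X x))" "0 \<le> (LINT x|N. v x * indicator A (Y x))"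
      using w(2) v(2) by (auto intro!: integral_nonneg_AE)
    ultimately show ?thesis using True by linarith
  next
    case False
    then have c: "0 < c" using c0 by simp
    have distribution: "real_distribution (distr (density K (\<lambda>x. ennreal (u x / c))) borel Z)"
      and char: "char (distr (density K (\<lambda>x. ennreal (u x / c))) borel Z)
        = (\<lambda>t. (CLINT x|K. u x *\<^sub>R iexp (t * Z x)) /\<^sub>R c)"
      and measure: "measure (distr (density K (\<lambda>x. ennreal (u x / c))) borel Z) A
        = (LINT x|K. u x * indicator A (Z x)) / c"
      if Z [measurable]: "Z \<in> borel_measurable K" and u: "integrable K u" "\<And>x. 0 \<le> u x" "integral\<^sup>L K u = c"
      for K :: "'c measure" and u :: "'c \<Rightarrow> real" and Z :: "'c \<Rightarrow> real"
    proof -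
      note [measurable] = borel_measurable_integrable[OF u(1)]
      let ?D = "density K (\<lambda>x. ennreal (u x / c))"
      have "emeasure ?D (space ?D) = (\<integral>\<^sup>+x. ennreal (u x / c) \<partial>K)"
        by (simp add: emeasure_density cong: nn_integral_cong)
      also have "\<dots> = ennreal (LINT x|K. u x / c)"
        by (rule nn_integral_eq_integral) (use u c in auto)
      also have "\<dots> = 1" using u(3) c by simp
      finally interpret D: prob_space ?D by (rule prob_spaceI)
      show "real_distribution (distr ?D borel Z)" by (rule D.real_distribution_distr) simp
      show "char (distr ?D borel Z) = (\<lambda>t. (CLINT x|K. u x *\<^sub>R iexp (t * Z x)) /\<^sub>R c)"
      proof
        fix t
        have "char (distr ?D borel Z) t = (CLINT x|?D. iexp (t * Z x))"
          unfolding char_def by (rule integral_distr) auto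
        also have "\<dots> = (CLINT x|K. (u x / c) *\<^sub>R iexp (t * Z x))"
          by (rule integral_density) (use u(2) c in auto)
        also have "\<dots> = (CLINT x|K. (u x *\<^sub>R iexp (t * Z x)) /\<^sub>R c)"
          by (rule Bochner_Integration.integral_cong) (auto simp: divide_inverse mult.commute)
        also have "\<dots> = (CLINT x|K. u x *\<^sub>R iexp (t * Z x)) /\<^sub>R c"
          by (rule integral_scaleR_right)
        finally show "char (distr ?D borel Z) t = (CLINT x|K. u x *\<^sub>R iexp (t * Z x)) /\<^sub>R c" .
      qed
      have "measure (distr ?D borel Z) A = measure ?D (Z -` A \<inter> space ?D)"
        by (rule measure_distr) auto
      also have "\<dots> = (LINT x|?D. indicator A (Z x))"
      proof -
        have "(LINT x|?D. indicator A (Z x)) = (LINT x|?D. indicator (Z -` A \<inter> space ?D) x :: real)"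
          by (rule Bochner_Integration.integral_cong) (auto simp: indicator_def)
        then show ?thesis by simp
      qed
      also have "\<dots> = (LINT x|K. (u x / c) *\<^sub>R indicator A (Z x))"
        by (rule integral_density) (use u(2) c in auto)
      also have "\<dots> = (LINT x|K. u x * indicator A (Z x)) / c" by simp
      finally show "measure (distr ?D borel Z) A = (LINT x|K. u x * indicator A (Z x)) / c" .
    qed
    have "distr (density M (\<lambda>x. ennreal (w x / c))) borel X = distr (density N (\<lambda>x. ennreal (v x / c))) borel Y"
      by (rule Levy_uniqueness[OF distribution[OF X w c_def[symmetric]] distribution[OF Y v cv[symmetric]]])
        (simp only: char[OF X w c_def[symmetric]] char[OF Y v cv[symmetric]] eq)
    from arg_cong[OF this, of "\<lambda>D. measure D A"]
    have "(LINT x|M. w x * indicator A (X x)) / c = (LINT y|N. v y * indicator A (Y y)) / c"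
      unfolding measure[OF X w c_def[symmetric]] measure[OF Y v cv[symmetric]] .
    then show ?thesis using c by simp
  qed
qed

text \<open>
  The invariant of an induction that removes the coordinates of a cylinder set one at a time: \<open>\<psi>\<close> is
  the indicator of the part of the cylinder treated so far, the exponential stands for the rest.
\<close>
definition same_transform ::
    "('e::real_vector \<Rightarrow> real) measure \<Rightarrow> ('e \<Rightarrow> real) measure \<Rightarrow> 'e set \<Rightarrow> (('e \<Rightarrow> real) \<Rightarrow> real) \<Rightarrow> bool" where
  "same_transform M N V \<psi> \<longleftrightarrow>
    \<psi> \<in> borel_measurable M \<and> (\<forall>l. 0 \<le> \<psi> l \<and> \<psi> l \<le> 1) \<and>
    (\<forall>x\<in>V. (CLINT l|M. \<psi> l *\<^sub>R iexp (l x)) = (CLINT l|N. \<psi> l *\<^sub>R iexp (l x)))"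

context
  fixes \<Omega> :: "('e::real_vector \<Rightarrow> real) set" and V :: "'e set" and M N :: "('e \<Rightarrow> real) measure"
  assumes sub: "subspace V"
    and add: "\<And>l x y. l \<in> \<Omega> \<Longrightarrow> x \<in> V \<Longrightarrow> y \<in> V \<Longrightarrow> l (x + y) = l x + l y"
    and scale: "\<And>l a x. l \<in> \<Omega> \<Longrightarrow> x \<in> V \<Longrightarrow> l (a *\<^sub>R x) = a * l x"
    and finM: "finite_measure M" and finN: "finite_measure N"
    and setsM [measurable_cong]: "sets M = sets (eval_algebra \<Omega> V)"
    and setsN [measurable_cong]: "sets N = sets (eval_algebra \<Omega> V)"
begin

text \<open>
  The step of the induction. For fixed \<open>x\<close> the measures with the densities \<open>\<psi> l * (1 + cos (l x))\<close>,
  \<open>\<psi> l * (1 + sin (l x))\<close> and \<open>\<psi> l\<close> are nonnegative, and the transforms of \<open>l y\<close> under them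
  are combinations of the transforms of \<open>\<psi>\<close> at \<open>t y\<close>, \<open>t y + x\<close> and \<open>t y - x\<close>. So by uniqueness on the line
  they agree for \<open>M\<close> and \<open>N\<close> on the event \<open>l y \<in> A\<close>; subtraction leaves the real and imaginary parts
  of the transform restricted to that event.
\<close>
lemma same_transform_restrict:
  assumes psi: "same_transform M N V \<psi>" and y: "y \<in> V" and A [measurable]: "A \<in> sets borel"
  shows "same_transform M N V (\<lambda>l. \<psi> l * indicator A (l y))"
  unfolding same_transform_def
proof (intro conjI allI ballI)
  have m [measurable]: "\<psi> \<in> borel_measurable M" and bd: "\<And>l. 0 \<le> \<psi> l" "\<And>l. \<psi> l \<le> 1"
    and eq: "\<And>x. x \<in> V \<Longrightarrow> (CLINT l|M. \<psi> l *\<^sub>R iexp (l x)) = (CLINT l|N. \<psi> l *\<^sub>R iexp (l x))"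
    using psi by (auto simp: same_transform_def)
  have mN [measurable]: "\<psi> \<in> borel_measurable N"
    using m by (simp only: measurable_cong_sets[OF setsM refl] measurable_cong_sets[OF setsN refl])
  note [measurable] = eval_measurable[OF y, of \<Omega>]
  show "(\<lambda>l. \<psi> l * indicator A (l y)) \<in> borel_measurable M" by measurable
  show "0 \<le> \<psi> l * indicator A (l y)" "\<psi> l * indicator A (l y) \<le> 1" for l
    using bd[of l] by (auto simp: indicator_def)
  fix x assume x: "x \<in> V"
  note [measurable] = eval_measurable[OF x, of \<Omega>]
  have V': "a *\<^sub>R y + b *\<^sub>R x \<in> V" for a b
    using sub x y by (simp add: subspace_add subspace_scale)
  have lin: "l (a *\<^sub>R y + b *\<^sub>R x) = a * l y + b * l x" if "l \<in> \<Omega>" for l a b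
    using that sub x y by (simp add: add scale subspace_scale)
  have transform: "(CLINT l|K. (\<psi> l * (1 + c * cos (l x) + s * sin (l x))) *\<^sub>R iexp (t * l y))
      = (CLINT l|K. \<psi> l *\<^sub>R iexp (l (t *\<^sub>R y + 0 *\<^sub>R x)))
        + (of_real c / 2 + of_real s / (2 * \<i>)) * (CLINT l|K. \<psi> l *\<^sub>R iexp (l (t *\<^sub>R y + 1 *\<^sub>R x)))
        + (of_real c / 2 - of_real s / (2 * \<i>)) * (CLINT l|K. \<psi> l *\<^sub>R iexp (l (t *\<^sub>R y + (-1) *\<^sub>R x)))"
    (is "?L = _")
    and weight: "integrable K (\<lambda>l. \<psi> l * (1 + c * cos (l x) + s * sin (l x)))"
    if K: "finite_measure K" "sets K = sets (eval_algebra \<Omega> V)" and psiK: "\<psi> \<in> borel_measurable K"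
    for K c s t
  proof -
    interpret finite_measure K by fact
    note [measurable_cong] = K(2) and [measurable] = psiK
    have sp: "space K = \<Omega>" using sets_eq_imp_space_eq[OF K(2)] by simp
    have int: "integrable K (\<lambda>l. \<psi> l *\<^sub>R iexp (l (a *\<^sub>R y + b *\<^sub>R x)))" for a b
    proof (rule integrable_const_bound[where B = 1])
      note [measurable] = eval_measurable[OF V'[of a b], of \<Omega>]
      show "(\<lambda>l. \<psi> l *\<^sub>R iexp (l (a *\<^sub>R y + b *\<^sub>R x))) \<in> borel_measurable K" by measurable
    qed (use bd in auto)
    \<comment> \<open>Euler's formula turns the trigonometric weight into shifts of the frequency by \<open>x\<close> and \<open>- x\<close>.\<close>
    have cs: "complex_of_real (1 + c * cos b + s * sin b) * iexp a
      = iexp a + (of_real c / 2 + of_real s / (2 * \<i>)) * iexp (a + b)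
        + (of_real c / 2 - of_real s / (2 * \<i>)) * iexp (a - b)" for a b :: real
    proof -
      have e: "iexp (a + b) = iexp a * iexp b" "iexp (a - b) = iexp a * iexp (- b)"
        by (simp_all add: exp_add[symmetric] algebra_simps)
      have i: "iexp b = cos b + \<i> * sin b" "iexp (- b) = cos b - \<i> * sin b"
        using exp_Euler[of "complex_of_real b"] exp_Euler[of "- complex_of_real b"]
        by (simp_all add: cos_of_real sin_of_real)
      show ?thesis unfolding e i by (simp add: field_simps)
    qed
    have "?L = (CLINT l|K. \<psi> l *\<^sub>R iexp (l (t *\<^sub>R y + 0 *\<^sub>R x))
        + (of_real c / 2 + of_real s / (2 * \<i>)) * (\<psi> l *\<^sub>R iexp (l (t *\<^sub>R y + 1 *\<^sub>R x)))
        + (of_real c / 2 - of_real s / (2 * \<i>)) * (\<psi> l *\<^sub>R iexp (l (t *\<^sub>R y + (-1) *\<^sub>R x))))"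
    proof (rule Bochner_Integration.integral_cong[OF refl])
      fix l assume "l \<in> space K"
      then have l: "l \<in> \<Omega>" using sp by simp
      show "(\<psi> l * (1 + c * cos (l x) + s * sin (l x))) *\<^sub>R iexp (t * l y) =
        \<psi> l *\<^sub>R iexp (l (t *\<^sub>R y + 0 *\<^sub>R x))
        + (of_real c / 2 + of_real s / (2 * \<i>)) * (\<psi> l *\<^sub>R iexp (l (t *\<^sub>R y + 1 *\<^sub>R x)))
        + (of_real c / 2 - of_real s / (2 * \<i>)) * (\<psi> l *\<^sub>R iexp (l (t *\<^sub>R y + (-1) *\<^sub>R x)))"
        using arg_cong[OF cs[of "l x" "t * l y"], of "\<lambda>z. \<psi> l *\<^sub>R z"]
        unfolding lin[OF l] by (simp add: scaleR_conv_of_real algebra_simps)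
    qed
    also have "\<dots> = (CLINT l|K. \<psi> l *\<^sub>R iexp (l (t *\<^sub>R y + 0 *\<^sub>R x)))
        + (of_real c / 2 + of_real s / (2 * \<i>)) * (CLINT l|K. \<psi> l *\<^sub>R iexp (l (t *\<^sub>R y + 1 *\<^sub>R x)))
        + (of_real c / 2 - of_real s / (2 * \<i>)) * (CLINT l|K. \<psi> l *\<^sub>R iexp (l (t *\<^sub>R y + (-1) *\<^sub>R x)))"
      by (simp only: Bochner_Integration.integral_add Bochner_Integration.integrable_add
          integrable_mult_right int integral_mult_right_zero)
    finally show "?L = \<dots>" .
    show "integrable K (\<lambda>l. \<psi> l * (1 + c * cos (l x) + s * sin (l x)))"
    proof (rule integrable_const_bound[where B = "1 + \<bar>c\<bar> + \<bar>s\<bar>"])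
      have "\<bar>1 + c * cos b + s * sin b\<bar> \<le> 1 + \<bar>c\<bar> + \<bar>s\<bar>" for b :: real
      proof -
        have "\<bar>c * cos b\<bar> \<le> \<bar>c\<bar> * 1" "\<bar>s * sin b\<bar> \<le> \<bar>s\<bar> * 1"
          unfolding abs_mult by (intro mult_left_mono; simp)+
        then show ?thesis by linarith
      qed
      then have "\<bar>\<psi> l * (1 + c * cos (l x) + s * sin (l x))\<bar> \<le> 1 * (1 + \<bar>c\<bar> + \<bar>s\<bar>)" for l
        unfolding abs_mult using bd[of l] by (intro mult_mono) auto
      then show "AE l in K. norm (\<psi> l * (1 + c * cos (l x) + s * sin (l x))) \<le> 1 + \<bar>c\<bar> + \<bar>s\<bar>" by simp
    qed measurable
  qed
  have key: "(LINT l|M. \<psi> l * (1 + c * cos (l x) + s * sin (l x)) * indicator A (l y))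
      = (LINT l|N. \<psi> l * (1 + c * cos (l x) + s * sin (l x)) * indicator A (l y))"
    if "\<And>b::real. 0 \<le> 1 + c * cos b + s * sin b" for c s
  proof (rule weighted_Levy_uniqueness)
    show "(CLINT l|M. (\<psi> l * (1 + c * cos (l x) + s * sin (l x))) *\<^sub>R iexp (t * l y))
        = (CLINT l|N. (\<psi> l * (1 + c * cos (l x) + s * sin (l x))) *\<^sub>R iexp (t * l y))" for t
      unfolding transform[OF finM setsM m] transform[OF finN setsN mN] by (simp only: eq[OF V'])
  qed (use weight[OF finM setsM m] weight[OF finN setsN mN] that bd in \<open>auto intro!: mult_nonneg_nonneg\<close>)
  let ?w = "\<lambda>l. \<psi> l * indicator A (l y)"
  have wint: "integrable K ?w" "integrable K (\<lambda>l. ?w l * cos (l x))" "integrable K (\<lambda>l. ?w l * sin (l x))"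
    if K: "finite_measure K" "sets K = sets (eval_algebra \<Omega> V)" and psiK: "\<psi> \<in> borel_measurable K" for K
  proof -
    interpret finite_measure K by fact
    note [measurable_cong] = K(2) and [measurable] = psiK
    have "\<bar>?w l * b\<bar> \<le> 1" if "\<bar>b\<bar> \<le> 1" for l b
      using bd[of l] that mult_mono[of "\<bar>?w l\<bar>" 1 "\<bar>b\<bar>" 1] by (auto simp: abs_mult indicator_def)
    from this[of 1] this[of "cos _"] this[of "sin _"]
    show "integrable K ?w" "integrable K (\<lambda>l. ?w l * cos (l x))" "integrable K (\<lambda>l. ?w l * sin (l x))"
      by (auto intro!: integrable_const_bound[where B = 1])
  qed
  note wM = wint[OF finM setsM m] and wN = wint[OF finN setsN mN]
  have split: "(LINT l|K. \<psi> l * (1 + c * cos (l x) + s * sin (l x)) * indicator A (l y))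
      = integral\<^sup>L K ?w + c * (LINT l|K. ?w l * cos (l x)) + s * (LINT l|K. ?w l * sin (l x))"
    if i: "integrable K ?w" "integrable K (\<lambda>l. ?w l * cos (l x))" "integrable K (\<lambda>l. ?w l * sin (l x))" for K c s
  proof -
    have "(LINT l|K. \<psi> l * (1 + c * cos (l x) + s * sin (l x)) * indicator A (l y))
        = (LINT l|K. ?w l + c * (?w l * cos (l x)) + s * (?w l * sin (l x)))"
      by (rule Bochner_Integration.integral_cong) (auto simp: algebra_simps)
    then show ?thesis using i by simp
  qed
  \<comment> \<open>The three weights whose differences isolate the cosine and the sine.\<close>
  have cs1: "0 \<le> 1 + 1 * cos b + 0 * sin b" "0 \<le> 1 + 0 * cos b + 1 * sin b" "0 \<le> 1 + 0 * cos b + 0 * sin b"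
    for b :: real
    using cos_ge_minus_one[of b] sin_ge_minus_one[of b] by (simp_all, linarith+)
  have re: "(LINT l|M. ?w l * cos (l x)) = (LINT l|N. ?w l * cos (l x))"
    and im: "(LINT l|M. ?w l * sin (l x)) = (LINT l|N. ?w l * sin (l x))"
    using key[OF cs1(1)] key[OF cs1(2)] key[OF cs1(3)]
    unfolding split[OF wM] split[OF wN] by simp_all
  have "(CLINT l|K. ?w l *\<^sub>R iexp (l x))
      = complex_of_real (LINT l|K. ?w l * cos (l x)) + \<i> * complex_of_real (LINT l|K. ?w l * sin (l x))"
    if i: "integrable K (\<lambda>l. ?w l * cos (l x))" "integrable K (\<lambda>l. ?w l * sin (l x))" for K
  proof -
    have "(CLINT l|K. ?w l *\<^sub>R iexp (l x))
        = (CLINT l|K. complex_of_real (?w l * cos (l x)) + \<i> * complex_of_real (?w l * sin (l x)))"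
      by (rule Bochner_Integration.integral_cong)
        (auto simp: exp_Euler cos_of_real sin_of_real scaleR_conv_of_real algebra_simps)
    also have "\<dots> = (CLINT l|K. complex_of_real (?w l * cos (l x))) + \<i> * (CLINT l|K. complex_of_real (?w l * sin (l x)))"
    proof -
      have "integrable K (\<lambda>l. complex_of_real (?w l * cos (l x)))" "integrable K (\<lambda>l. complex_of_real (?w l * sin (l x)))"
        using integrable_of_real i by blast+
      then show ?thesis
        by (simp only: Bochner_Integration.integral_add integrable_mult_right integral_mult_right_zero)
    qed
    finally show ?thesis by (simp only: integral_complex_of_real)
  qed
  from this[OF wM(2,3)] this[OF wN(2,3)]
  show "(CLINT l|M. ?w l *\<^sub>R iexp (l x)) = (CLINT l|N. ?w l *\<^sub>R iexp (l x))"
    by (simp only: re im)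
qed

text \<open>
  Uniqueness for characteristic functions on a space of functionals: by induction the two measures
  agree on all cylinder sets, which are stable under intersection and generate the algebra.
\<close>
theorem measure_eq_of_same_char:
  assumes eq: "\<And>x. x \<in> V \<Longrightarrow> (CLINT l|M. iexp (l x)) = (CLINT l|N. iexp (l x))"
  shows "M = N"
proof -
  interpret M: finite_measure M by (rule finM)
  interpret N: finite_measure N by (rule finN)
  define cyl where "cyl xs = {l \<in> \<Omega>. \<forall>(x, A)\<in>set xs. l x \<in> A}" for xs :: "('e \<times> real set) list"
  define E where "E = cyl ` {xs. set xs \<subseteq> V \<times> sets borel}"
  define weight where "weight xs l = prod_list (map (\<lambda>(x, A). indicator A (l x) :: real) xs)"
    for xs :: "('e \<times> real set) list" and l
  have weight: "same_transform M N V (weight xs)" if "set xs \<subseteq> V \<times> sets borel" for xs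
    using that
  proof (induction xs)
    case Nil
    then show ?case using eq by (simp add: same_transform_def weight_def)
  next
    case (Cons a xs)
    obtain x A where a: "a = (x, A)" by (cases a)
    have "weight (a # xs) = (\<lambda>l. weight xs l * indicator A (l x))"
      by (auto simp: weight_def a)
    moreover have "same_transform M N V (\<lambda>l. weight xs l * indicator A (l x))"
      by (rule same_transform_restrict) (use Cons a in auto)
    ultimately show ?case by simp
  qed
  have spaces: "space M = \<Omega>" "space N = \<Omega>"
    using sets_eq_imp_space_eq[OF setsM] sets_eq_imp_space_eq[OF setsN] by auto
  have weight_cyl: "weight xs l = indicator (cyl xs) l" if "l \<in> \<Omega>" for xs l
    using that by (induction xs) (auto simp: weight_def cyl_def indicator_def split: if_splits)
  have cyl_sets: "cyl xs \<in> sets (eval_algebra \<Omega> V)" if "set xs \<subseteq> V \<times> sets borel" for xs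
    using that
  proof (induction xs)
    case Nil
    then show ?case using sets.top[of "eval_algebra \<Omega> V"] by (simp add: cyl_def)
  next
    case (Cons a xs)
    obtain x A where a: "a = (x, A)" by (cases a)
    have "cyl (a # xs) = ((\<lambda>l. l x) -` A \<inter> space (eval_algebra \<Omega> V)) \<inter> cyl xs"
      by (auto simp: cyl_def a)
    moreover have "(\<lambda>l. l x) -` A \<inter> space (eval_algebra \<Omega> V) \<in> sets (eval_algebra \<Omega> V)"
      by (rule measurable_sets[OF eval_measurable]) (use Cons a in auto)
    ultimately show ?case using Cons by auto
  qed
  have gen: "sets (eval_algebra \<Omega> V) = sigma_sets \<Omega> E"
  proof
    show "sets (eval_algebra \<Omega> V) \<subseteq> sigma_sets \<Omega> E"
      unfolding sets_eval_algebra
    proof (rule sigma_sets_mono')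
      show "{{l \<in> \<Omega>. l x \<in> B} | x B. x \<in> V \<and> B \<in> sets borel} \<subseteq> E"
      proof safe
        fix x and B :: "real set" assume "x \<in> V" "B \<in> sets borel"
        then show "{l \<in> \<Omega>. l x \<in> B} \<in> E"
          unfolding E_def by (intro image_eqI[of _ _ "[(x, B)]"]) (auto simp: cyl_def)
      qed
    qed
    show "sigma_sets \<Omega> E \<subseteq> sets (eval_algebra \<Omega> V)"
      using sets.sigma_sets_subset[of E "eval_algebra \<Omega> V"] cyl_sets by (auto simp: E_def)
  qed
  show ?thesis
  proof (rule measure_eqI_generator_eq[where E = E and \<Omega> = \<Omega> and A = "\<lambda>_. cyl []"])
    show "Int_stable E"
    proof (rule Int_stableI)
      fix a b assume "a \<in> E" "b \<in> E"
      then obtain xs ys where "a = cyl xs" "b = cyl ys" "set xs \<subseteq> V \<times> sets borel" "set ys \<subseteq> V \<times> sets borel"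
        by (auto simp: E_def)
      then show "a \<inter> b \<in> E"
        unfolding E_def by (intro image_eqI[of _ _ "xs @ ys"]) (auto simp: cyl_def)
    qed
    show "E \<subseteq> Pow \<Omega>" by (auto simp: E_def cyl_def)
    show "sets M = sigma_sets \<Omega> E" "sets N = sigma_sets \<Omega> E" using setsM setsN gen by auto
    show "range (\<lambda>_. cyl []) \<subseteq> E" unfolding E_def by (auto intro: image_eqI[of _ _ "[]"])
    show "(\<Union>i::nat. cyl []) = \<Omega>" by (auto simp: cyl_def)
    show "emeasure M (cyl []) \<noteq> \<infinity>" by simp
    fix X assume "X \<in> E"
    then obtain xs where xs: "X = cyl xs" "set xs \<subseteq> V \<times> sets borel" by (auto simp: E_def)
    have X: "X \<in> sets M" "X \<in> sets N" using cyl_sets[OF xs(2)] setsM setsN xs(1) by auto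
    have zero: "l 0 = 0" if "l \<in> \<Omega>" for l
      using scale[OF that, of 0 0] subspace_0[OF sub] by simp
    \<comment> \<open>At the vector \<open>0\<close> the exponential is \<open>1\<close> and the transform becomes the measure of the cylinder.\<close>
    have "complex_of_real (measure K X) = (CLINT l|K. weight xs l *\<^sub>R iexp (l 0))"
      if "X \<in> sets K" "space K = \<Omega>" "finite_measure K" for K
    proof -
      have "(CLINT l|K. weight xs l *\<^sub>R iexp (l 0)) = (CLINT l|K. complex_of_real (indicator X l))"
        by (rule Bochner_Integration.integral_cong)
          (auto simp: that(2) zero weight_cyl xs(1) scaleR_conv_of_real)
      moreover have "X \<inter> space K = X" using sets.sets_into_space[OF that(1)] by (rule Int_absorb2)
      ultimately show ?thesis by (simp add: integral_complex_of_real)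
    qed
    from this[OF X(1) spaces(1) finM] this[OF X(2) spaces(2) finN]
    have "complex_of_real (measure M X) = complex_of_real (measure N X)"
      using weight[OF xs(2)] subspace_0[OF sub] by (simp add: same_transform_def)
    then show "emeasure M X = emeasure N X"
      by (simp add: M.emeasure_eq_measure N.emeasure_eq_measure)
  qed
qed

end

section \<open>Borel sets of a finite-dimensional dual\<close>

lemma alg_dual_sum:
  assumes l: "l \<in> alg_dual V" and V: "subspace V" and S: "finite S" "\<And>s. s \<in> S \<Longrightarrow> f s \<in> V"
  shows "l (\<Sum>s\<in>S. c s *\<^sub>R f s) = (\<Sum>s\<in>S. c s * l (f s))"
  using S
proof (induction S rule: finite_induct)
  case empty
  have "l (0 *\<^sub>R 0) = 0 * l 0" using l subspace_0[OF V] by (simp only: alg_dual_def mem_Collect_eq)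
  then show ?case by simp
next
  case (insert s S)
  then have "(\<Sum>s\<in>S. c s *\<^sub>R f s) \<in> V" "c s *\<^sub>R f s \<in> V"
    using V by (auto intro!: subspace_sum subspace_scale)
  then show ?case using insert l by (simp add: alg_dual_def)
qed

lemma topspace_alg_dual_topology: "topspace (alg_dual_topology V) = alg_dual V"
  by (auto simp: alg_dual_topology_def alg_dual_def PiE_def)

lemma space_alg_dual_borel [simp]: "space (alg_dual_borel V) = alg_dual V"
  unfolding alg_dual_borel_def
  using openin_subset[of "alg_dual_topology V"] by (auto simp: space_measure_of_conv topspace_alg_dual_topology)

lemma sets_alg_dual_borel:
  "sets (alg_dual_borel V) = sigma_sets (alg_dual V) {U. openin (alg_dual_topology V) U}"
  unfolding alg_dual_borel_def
  by (rule sets_measure_of) (use openin_subset topspace_alg_dual_topology in blast)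

text \<open>
  A basic open set constrains finitely many values \<open>l x\<close>, and each \<open>x\<close> is a combination of the finitely
  many vectors of \<open>S\<close>. So closeness on \<open>S\<close> suffices.
\<close>
lemma alg_dual_open_box:
  fixes S :: "'e::real_vector set"
  assumes S: "finite S" and U: "openin (alg_dual_topology (span S)) U" and l: "l \<in> U"
  obtains \<delta> where "0 < \<delta>" "{l' \<in> alg_dual (span S). \<forall>s\<in>S. \<bar>l' s - l s\<bar> < \<delta>} \<subseteq> U"
proof -
  let ?V = "span S"
  obtain W where W: "openin (product_topology (\<lambda>_. euclideanreal) ?V) W" "U = W \<inter> alg_dual ?V"
    using U by (auto simp: alg_dual_topology_def openin_subtopology)
  have lV: "l \<in> alg_dual ?V" using l W by simp
  obtain O' where fin: "finite {x \<in> ?V. O' x \<noteq> topspace euclideanreal}"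
    and op: "\<And>x. x \<in> ?V \<Longrightarrow> openin euclideanreal (O' x)"
    and lO: "l \<in> Pi\<^sub>E ?V O'" and sub: "Pi\<^sub>E ?V O' \<subseteq> W"
  proof -
    have "l \<in> W" using l W by simp
    from W(1)[unfolded openin_product_topology_alt, THEN bspec, OF this] show thesis
      by (elim exE conjE) (rule that, auto)
  qed
  define F where "F = {x \<in> ?V. O' x \<noteq> UNIV}"
  have F: "finite F" "F \<subseteq> ?V" using fin by (auto simp: F_def)
  have "\<forall>x\<in>F. \<exists>e>0. \<forall>y. \<bar>y - l x\<bar> < e \<longrightarrow> y \<in> O' x"
  proof
    fix x assume "x \<in> F"
    then have "open (O' x)" "l x \<in> O' x" using op[of x] lO by (auto simp: F_def PiE_def)
    then show "\<exists>e>0. \<forall>y. \<bar>y - l x\<bar> < e \<longrightarrow> y \<in> O' x"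
      unfolding open_dist dist_real_def by blast
  qed
  then obtain e where e: "\<And>x. x \<in> F \<Longrightarrow> 0 < e x" "\<And>x y. x \<in> F \<Longrightarrow> \<bar>y - l x\<bar> < e x \<Longrightarrow> y \<in> O' x"
    by metis
  have "\<forall>x\<in>F. \<exists>c. x = (\<Sum>s\<in>S. c s *\<^sub>R s)"
    using F(2) span_finite[OF S] by blast
  then obtain c where c: "\<And>x. x \<in> F \<Longrightarrow> x = (\<Sum>s\<in>S. c x s *\<^sub>R s)" by metis
  \<comment> \<open>Changing \<open>l\<close> by less than \<open>\<delta>\<close> on \<open>S\<close> changes \<open>l x\<close> by less than \<open>\<delta> * K x\<close>; the \<open>1\<close> keeps \<open>K x\<close> positive.\<close>
  define K where "K x = 1 + (\<Sum>s\<in>S. \<bar>c x s\<bar>)" for x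
  have K: "0 < K x" for x unfolding K_def by (intro add_pos_nonneg sum_nonneg) auto
  define \<delta> where "\<delta> = Min (insert 1 ((\<lambda>x. e x / K x) ` F))"
  have d: "0 < \<delta>" unfolding \<delta>_def using F(1) e(1) K by (subst Min_gr_iff) auto
  have dF: "\<delta> * K x \<le> e x" if "x \<in> F" for x
  proof -
    have "\<delta> \<le> e x / K x" unfolding \<delta>_def using F(1) that by (intro Min_le) auto
    then show ?thesis using K[of x] by (simp add: pos_le_divide_eq)
  qed
  have "l' \<in> U" if l': "l' \<in> alg_dual ?V" and close: "\<forall>s\<in>S. \<bar>l' s - l s\<bar> < \<delta>" for l'
  proof -
    have "l' x \<in> O' x" if x: "x \<in> F" for x
    proof (rule e(2)[OF x])
      have val: "m x = (\<Sum>s\<in>S. c x s * m s)" if "m \<in> alg_dual ?V" for m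
        by (subst c[OF x]) (rule alg_dual_sum[OF that subspace_span S], rule span_base)
      have "\<bar>l' x - l x\<bar> = \<bar>\<Sum>s\<in>S. c x s * (l' s - l s)\<bar>"
        by (simp add: val[OF l'] val[OF lV] sum_subtractf right_diff_distrib)
      also have "\<dots> \<le> (\<Sum>s\<in>S. \<bar>c x s\<bar> * \<bar>l' s - l s\<bar>)"
        unfolding abs_mult[symmetric] by (rule sum_abs)
      also have "\<dots> \<le> (\<Sum>s\<in>S. \<bar>c x s\<bar> * \<delta>)"
        using close by (intro sum_mono mult_left_mono) (auto intro: less_imp_le)
      also have "\<dots> < \<delta> * K x"
        unfolding sum_distrib_right[symmetric] using d by (simp add: K_def distrib_left mult.commute)
      finally show "\<bar>l' x - l x\<bar> < e x" using dF[OF x] by simp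
    qed
    then have "l' x \<in> O' x" if "x \<in> ?V" for x
      using that by (cases "x \<in> F") (auto simp: F_def)
    then have "l' \<in> Pi\<^sub>E ?V O'" using l' by (auto simp: alg_dual_def PiE_def)
    then show ?thesis using sub W(2) l' by auto
  qed
  then show ?thesis using d by (intro that[of \<delta>]) auto
qed

text \<open>
  The index set \<open>span S\<close> of the product topology may be uncountable, but every open set is the union of the
  countably many boxes with rational centres over \<open>S\<close> that it contains.
\<close>
theorem sets_alg_dual_borel_eval:
  fixes S :: "'e::real_vector set"
  assumes S: "finite S"
  shows "sets (alg_dual_borel (span S)) = sets (eval_algebra (alg_dual (span S)) (span S))"
proof
  let ?V = "span S"
  let ?A = "eval_algebra (alg_dual ?V) ?V"
  show "sets (alg_dual_borel ?V) \<subseteq> sets ?A"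
  proof -
    have "U \<in> sets ?A" if U: "openin (alg_dual_topology ?V) U" for U
    proof -
      define box where "box q r = {l \<in> space ?A. \<forall>s\<in>S. \<bar>l s - q s\<bar> < r}" for q and r :: real
      have box_sets: "box q r \<in> sets ?A" for q r
        unfolding box_def
      proof (rule sets.sets_Collect_finite_All[OF _ S])
        show "{l \<in> space ?A. \<bar>l s - q s\<bar> < r} \<in> sets ?A" if "s \<in> S" for s
        proof -
          note [measurable] = eval_measurable[OF span_base[OF that], of "alg_dual ?V"]
          show ?thesis by measurable
        qed
      qed
      define I where "I = {(q, k). q \<in> Pi\<^sub>E S (\<lambda>_. \<rat>) \<and> box q (1 / real (Suc k)) \<subseteq> U}"
      have "countable (Pi\<^sub>E S (\<lambda>_. \<rat> :: real set))"
        by (rule countable_PiE[OF S]) (rule countable_rat)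
      then have "countable I"
        by (intro countable_subset[of I "Pi\<^sub>E S (\<lambda>_. \<rat>) \<times> (UNIV :: nat set)"]) (auto simp: I_def)
      have "U = (\<Union>(q, k)\<in>I. box q (1 / real (Suc k)))"
      proof
        show "(\<Union>(q, k)\<in>I. box q (1 / real (Suc k))) \<subseteq> U" by (auto simp: I_def)
        show "U \<subseteq> (\<Union>(q, k)\<in>I. box q (1 / real (Suc k)))"
        proof
          fix l assume l: "l \<in> U"
          obtain \<delta> where \<delta>: "0 < \<delta>" "{l' \<in> alg_dual ?V. \<forall>s\<in>S. \<bar>l' s - l s\<bar> < \<delta>} \<subseteq> U"
            using alg_dual_open_box[OF S U l] .
          \<comment> \<open>Half of \<open>\<delta>\<close>: a point of the box may be as far from its centre as \<open>l\<close> is.\<close>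
          obtain k where k: "1 / real (Suc k) < \<delta> / 2"
            using reals_Archimedean[of "\<delta> / 2"] \<delta>(1) by (auto simp: inverse_eq_divide)
          have "\<forall>s. \<exists>r\<in>\<rat>. \<bar>l s - r\<bar> < 1 / real (Suc k)"
          proof
            fix s
            obtain r where "r \<in> \<rat>" "l s < r" "r < l s + 1 / real (Suc k)"
              using Rats_dense_in_real[of "l s" "l s + 1 / real (Suc k)"] by auto
            then show "\<exists>r\<in>\<rat>. \<bar>l s - r\<bar> < 1 / real (Suc k)" by (intro bexI[of _ r]) auto
          qed
          then obtain q where q: "\<And>s. q s \<in> \<rat>" "\<And>s. \<bar>l s - q s\<bar> < 1 / real (Suc k)" by metis
          let ?q = "restrict q S"
          have "box ?q (1 / real (Suc k)) \<subseteq> U"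
          proof
            fix l' assume "l' \<in> box ?q (1 / real (Suc k))"
            then have l': "l' \<in> alg_dual ?V" "\<And>s. s \<in> S \<Longrightarrow> \<bar>l' s - q s\<bar> < 1 / real (Suc k)"
              by (auto simp: box_def)
            have "\<bar>l' s - l s\<bar> < \<delta>" if "s \<in> S" for s
              using l'(2)[OF that] q(2)[of s] k by linarith
            then show "l' \<in> U" using \<delta>(2) l'(1) by blast
          qed
          then have "(?q, k) \<in> I" using q(1) by (auto simp: I_def)
          moreover have "l \<in> box ?q (1 / real (Suc k))"
            using q(2) openin_subset[OF U] l by (auto simp: box_def topspace_alg_dual_topology)
          ultimately show "l \<in> (\<Union>(q, k)\<in>I. box q (1 / real (Suc k)))" by blast
        qed
      qed
      also have "\<dots> \<in> sets ?A"
        using \<open>countable I\<close> box_sets by (intro sets.countable_UN') auto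
      finally show ?thesis .
    qed
    then have "{U. openin (alg_dual_topology ?V) U} \<subseteq> sets ?A" by blast
    from sets.sigma_sets_subset[OF this] show ?thesis by (simp add: sets_alg_dual_borel)
  qed
  show "sets ?A \<subseteq> sets (alg_dual_borel ?V)"
  proof -
    have ev: "(\<lambda>l. l x) \<in> borel_measurable (alg_dual_borel ?V)" if x: "x \<in> ?V" for x
    proof (rule borel_measurableI)
      fix B :: "real set" assume "open B"
      have "continuous_map (alg_dual_topology ?V) euclideanreal (\<lambda>l. l x)"
        unfolding alg_dual_topology_def
        by (rule continuous_map_from_subtopology[OF continuous_map_product_projection[OF x]])
      from openin_continuous_map_preimage[OF this, of B] \<open>open B\<close>
      have "openin (alg_dual_topology ?V) {l \<in> alg_dual ?V. l x \<in> B}"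
        by (simp add: topspace_alg_dual_topology)
      then have "{l \<in> alg_dual ?V. l x \<in> B} \<in> sets (alg_dual_borel ?V)"
        unfolding sets_alg_dual_borel by (intro sigma_sets.Basic) simp
      then show "(\<lambda>l. l x) -` B \<inter> space (alg_dual_borel ?V) \<in> sets (alg_dual_borel ?V)"
        by (simp add: vimage_def Int_def conj_commute)
    qed
    have "(\<lambda>l. l) \<in> measurable (alg_dual_borel ?V) ?A"
      by (rule measurable_into_eval_algebra) (use ev in auto)
    from measurable_sets[OF this] show ?thesis
      using sets.sets_into_space by (fastforce simp: vimage_def Int_absorb2)
  qed
qed

section \<open>Gaussian densities in triangular form\<close>

lemma nn_integral_normal_density:
  assumes "0 < \<sigma>"
  shows "(\<integral>\<^sup>+y. ennreal (normal_density m \<sigma> y) \<partial>lborel) = 1"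
  using prob_space.emeasure_space_1[OF prob_space_normal_density[OF assms, of m]]
  by (simp add: emeasure_density)

text \<open>
  The substitution \<open>y = m + \<sigma> * x\<close> reduces this to the standard normal distribution.
\<close>
lemma normal_density_transform:
  assumes \<sigma>: "0 < \<sigma>"
  shows "(CLINT y|lborel. normal_density m \<sigma> y *\<^sub>R iexp (s * y))
    = iexp (s * m) * complex_of_real (exp (- (\<sigma> * s)\<^sup>2 / 2))"
proof -
  have "(CLINT y|lborel. normal_density m \<sigma> y *\<^sub>R iexp (s * y))
      = \<bar>\<sigma>\<bar> *\<^sub>R (CLINT x|lborel. normal_density m \<sigma> (m + \<sigma> * x) *\<^sub>R iexp (s * (m + \<sigma> * x)))"
    using \<sigma> by (intro lborel_integral_real_affine) simp
  also have "(CLINT x|lborel. normal_density m \<sigma> (m + \<sigma> * x) *\<^sub>R iexp (s * (m + \<sigma> * x)))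
      = (CLINT x|lborel. (iexp (s * m) /\<^sub>R \<sigma>) * (std_normal_density x *\<^sub>R iexp ((\<sigma> * s) * x)))"
  proof (rule Bochner_Integration.integral_cong[OF refl])
    fix x
    have "normal_density m \<sigma> (m + \<sigma> * x) = std_normal_density x / \<sigma>"
      using \<sigma> by (simp add: normal_density_def power_mult_distrib real_sqrt_mult)
    moreover have "iexp (s * (m + \<sigma> * x)) = iexp (s * m) * iexp ((\<sigma> * s) * x)"
      by (simp add: exp_add[symmetric] algebra_simps)
    ultimately show "normal_density m \<sigma> (m + \<sigma> * x) *\<^sub>R iexp (s * (m + \<sigma> * x))
        = (iexp (s * m) /\<^sub>R \<sigma>) * (std_normal_density x *\<^sub>R iexp ((\<sigma> * s) * x))"
      by (simp add: scaleR_conv_of_real field_simps)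
  qed
  also have "\<dots> = (iexp (s * m) /\<^sub>R \<sigma>) * (CLINT x|lborel. std_normal_density x *\<^sub>R iexp ((\<sigma> * s) * x))"
    by (rule integral_mult_right_zero)
  also have "(CLINT x|lborel. std_normal_density x *\<^sub>R iexp ((\<sigma> * s) * x)) = char std_normal_distribution (\<sigma> * s)"
    unfolding char_def by (subst integral_density) auto
  also have "\<dots> = complex_of_real (exp (- (\<sigma> * s)\<^sup>2 / 2))"
    by (simp add: char_std_normal_distribution)
  finally show ?thesis using \<sigma> by (simp add: scaleR_conv_of_real)
qed

text \<open>
  The law of a vector whose \<open>k\<close>-th coordinate, given the earlier ones, is normal with variance \<open>d k\<close> and a
  mean that is linear in them. Gram-Schmidt puts every Gaussian density into this form, in which the
  last variable can be integrated out.
\<close>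
definition triangular_density ::
    "(nat \<Rightarrow> nat \<Rightarrow> real) \<Rightarrow> (nat \<Rightarrow> real) \<Rightarrow> nat \<Rightarrow> (nat \<Rightarrow> real) \<Rightarrow> real" where
  "triangular_density w d N x = (\<Prod>k<N. normal_density (\<Sum>i<k. w k i * x i) (sqrt (d k)) (x k))"

lemma triangular_density_nonneg: "0 \<le> triangular_density w d N x"
  unfolding triangular_density_def by (intro prod_nonneg) auto

lemma triangular_density_measurable:
  "triangular_density w d N \<in> borel_measurable (\<Pi>\<^sub>M i\<in>{..<N}. lborel)"
proof -
  have c [measurable]: "(\<lambda>x. x i) \<in> borel_measurable (\<Pi>\<^sub>M i\<in>{..<N}. lborel :: real measure)" if "i < N" for i
    using measurable_component_singleton[of i "{..<N}" "\<lambda>_. lborel :: real measure"] that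
    by (simp add: measurable_lborel1)
  have "(\<lambda>x. normal_density (\<Sum>i<k. w k i * x i) (sqrt (d k)) (x k))
      \<in> borel_measurable (\<Pi>\<^sub>M i\<in>{..<N}. lborel)" if "k < N" for k
  proof -
    have "(\<lambda>x. \<Sum>i<k. w k i * x i) \<in> borel_measurable (\<Pi>\<^sub>M i\<in>{..<N}. lborel)"
      using that by (intro borel_measurable_sum borel_measurable_times c) auto
    then show ?thesis unfolding normal_density_def using c[OF that] by measurable
  qed
  then show ?thesis unfolding triangular_density_def[abs_def] by (intro borel_measurable_prod) auto
qed

lemma triangular_density_Suc:
  "triangular_density w d (Suc N) (x(N := y))
    = triangular_density w d N x * normal_density (\<Sum>i<N. w N i * x i) (sqrt (d N)) y"
proof -
  have "(\<Prod>k<N. normal_density (\<Sum>i<k. w k i * (x(N := y)) i) (sqrt (d k)) ((x(N := y)) k))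
      = triangular_density w d N x"
    unfolding triangular_density_def by (rule prod.cong) (auto intro!: arg_cong2[of _ _ _ _ "\<lambda>a b. normal_density a _ b"] sum.cong)
  moreover have "(\<Sum>i<N. w N i * (x(N := y)) i) = (\<Sum>i<N. w N i * x i)"
    by (rule sum.cong) auto
  ultimately show ?thesis by (simp add: triangular_density_def)
qed

lemma triangular_density_nn_integral:
  assumes d: "\<And>k. k < N \<Longrightarrow> 0 < d k"
  shows "(\<integral>\<^sup>+x. ennreal (triangular_density w d N x) \<partial>(\<Pi>\<^sub>M i\<in>{..<N}. lborel)) = 1"
  using d
proof (induction N)
  case 0
  interpret product_sigma_finite "\<lambda>_::nat. lborel :: real measure" by standard
  show ?case by (simp add: triangular_density_def PiM_empty nn_integral_count_space_finite)
next
  case (Suc N)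
  interpret product_sigma_finite "\<lambda>_::nat. lborel :: real measure" by standard
  have "(\<integral>\<^sup>+x. ennreal (triangular_density w d (Suc N) x) \<partial>(\<Pi>\<^sub>M i\<in>insert N {..<N}. lborel))
      = (\<integral>\<^sup>+x. \<integral>\<^sup>+y. ennreal (triangular_density w d (Suc N) (x(N := y))) \<partial>lborel \<partial>(\<Pi>\<^sub>M i\<in>{..<N}. lborel))"
  proof (rule product_nn_integral_insert)
    show "(\<lambda>x. ennreal (triangular_density w d (Suc N) x)) \<in> borel_measurable (\<Pi>\<^sub>M i\<in>insert N {..<N}. lborel)"
      using triangular_density_measurable[of w d "Suc N"] by (simp add: lessThan_Suc)
  qed auto
  also have "\<dots> = (\<integral>\<^sup>+x. ennreal (triangular_density w d N x) \<partial>(\<Pi>\<^sub>M i\<in>{..<N}. lborel))"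
  proof (rule nn_integral_cong)
    fix x
    have "(\<integral>\<^sup>+y. ennreal (triangular_density w d (Suc N) (x(N := y))) \<partial>lborel)
        = (\<integral>\<^sup>+y. ennreal (triangular_density w d N x) *
            ennreal (normal_density (\<Sum>i<N. w N i * x i) (sqrt (d N)) y) \<partial>lborel)"
      by (simp only: triangular_density_Suc ennreal_mult[OF triangular_density_nonneg normal_density_nonneg])
    also have "\<dots> = ennreal (triangular_density w d N x)"
      using Suc.prems by (subst nn_integral_cmult) (auto simp: nn_integral_normal_density)
    finally show "(\<integral>\<^sup>+y. ennreal (triangular_density w d (Suc N) (x(N := y))) \<partial>lborel)
        = ennreal (triangular_density w d N x)" .
  qed
  also have "\<dots> = 1" by (rule Suc.IH) (use Suc.prems in auto)
  finally show ?case by (simp add: lessThan_Suc)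
qed

lemma triangular_density_integrable:
  assumes "\<And>k. k < N \<Longrightarrow> 0 < d k"
  shows "integrable (\<Pi>\<^sub>M i\<in>{..<N}. lborel) (triangular_density w d N)"
  using triangular_density_nn_integral[OF assms] triangular_density_measurable
  by (intro integrableI_nonneg) (auto intro: triangular_density_nonneg)

lemma inner_productD:
  assumes "inner_product C"
  shows "C (x + y) z = C x z + C y z" "C z (x + y) = C z x + C z y"
    "C (a *\<^sub>R x) z = a * C x z" "C z (a *\<^sub>R x) = a * C z x" "C x y = C y x" "x \<noteq> 0 \<Longrightarrow> 0 < C x x"
    "C (x - y) z = C x z - C y z"
    "C (\<Sum>i\<in>I. f i) z = (\<Sum>i\<in>I. C (f i) z)"
    "C z (\<Sum>i\<in>I. f i) = (\<Sum>i\<in>I. C z (f i))"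
    "C z (x - y) = C z x - C z y"
proof -
  have b: "bilinear C" using assms by (simp add: inner_product_def)
  then have l1: "linear (\<lambda>x. C x z)" and l2: "linear (C z)" for z by (auto simp: bilinear_def)
  show "C (x + y) z = C x z + C y z" "C z (x + y) = C z x + C z y"
    "C (a *\<^sub>R x) z = a * C x z" "C z (a *\<^sub>R x) = a * C z x" "C (x - y) z = C x z - C y z"
    "C z (x - y) = C z x - C z y"
    using linear_add[OF l1] linear_add[OF l2] linear_cmul[OF l1] linear_cmul[OF l2] linear_diff[OF l1] linear_diff[OF l2] by auto
  show "C (\<Sum>i\<in>I. f i) z = (\<Sum>i\<in>I. C (f i) z)" "C z (\<Sum>i\<in>I. f i) = (\<Sum>i\<in>I. C z (f i))"
    using linear_sum[OF l1] linear_sum[OF l2] by auto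
  show "C x y = C y x" "x \<noteq> 0 \<Longrightarrow> 0 < C x x" using assms by (auto simp: inner_product_def)
qed

text \<open>
  Gram-Schmidt, as the induction that projects onto the span of the first \<open>k\<close> vectors: \<open>\<eta>\<close> is the
  part of \<open>\<xi> k\<close> orthogonal to the earlier vectors, and the projection is corrected along \<open>\<eta>\<close>.
\<close>
lemma orthogonal_projection_exists:
  fixes \<xi> :: "nat \<Rightarrow> 'e::real_vector"
  assumes C: "inner_product C" and indep: "\<And>k. \<xi> k \<notin> span (\<xi> ` {..<k})"
  shows "\<exists>w. \<forall>j<k. C (v - (\<Sum>i<k. w i *\<^sub>R \<xi> i)) (\<xi> j) = 0"
proof (induction k arbitrary: v)
  case 0
  then show ?case by simp
next
  case (Suc k)
  note ip = inner_productD[OF C]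
  obtain w' where w': "\<forall>j<k. C (\<xi> k - (\<Sum>i<k. w' i *\<^sub>R \<xi> i)) (\<xi> j) = 0" using Suc by blast
  obtain w where w: "\<forall>j<k. C (v - (\<Sum>i<k. w i *\<^sub>R \<xi> i)) (\<xi> j) = 0" using Suc by blast
  define \<eta> where "\<eta> = \<xi> k - (\<Sum>i<k. w' i *\<^sub>R \<xi> i)"
  define u where "u = v - (\<Sum>i<k. w i *\<^sub>R \<xi> i)"
  have "(\<Sum>i<k. w' i *\<^sub>R \<xi> i) \<in> span (\<xi> ` {..<k})"
    by (intro span_sum span_scale span_base) auto
  then have "\<eta> \<noteq> 0" using indep[of k] by (auto simp: \<eta>_def)
  then have pos: "0 < C \<eta> \<eta>" by (rule ip(6))
  \<comment> \<open>Chosen to make \<open>u - t *\<^sub>R \<eta>\<close> orthogonal to \<open>\<eta>\<close>, hence to \<open>\<xi> k\<close>.\<close>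
  define t where "t = C u \<eta> / C \<eta> \<eta>"
  define w'' where "w'' i = (if i = k then t else w i - t * w' i)" for i
  have "(\<Sum>i<Suc k. w'' i *\<^sub>R \<xi> i) = (\<Sum>i<k. (w i - t * w' i) *\<^sub>R \<xi> i) + t *\<^sub>R \<xi> k"
    by (simp add: w''_def)
  also have "\<dots> = (\<Sum>i<k. w i *\<^sub>R \<xi> i) - t *\<^sub>R (\<Sum>i<k. w' i *\<^sub>R \<xi> i) + t *\<^sub>R \<xi> k"
    by (simp add: scaleR_diff_left sum_subtractf scaleR_sum_right)
  also have "\<dots> = (\<Sum>i<k. w i *\<^sub>R \<xi> i) + t *\<^sub>R \<eta>" by (simp add: \<eta>_def algebra_simps)
  finally have eq: "v - (\<Sum>i<Suc k. w'' i *\<^sub>R \<xi> i) = u - t *\<^sub>R \<eta>" by (simp add: u_def)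
  have orth: "C (u - t *\<^sub>R \<eta>) (\<xi> j) = 0" if "j < k" for j
    using w w' that by (simp add: ip(3,7) u_def[symmetric] \<eta>_def[symmetric])
  have "C (u - t *\<^sub>R \<eta>) \<eta> = 0" using pos by (simp add: ip(3,7) t_def)
  moreover have "\<xi> k = \<eta> + (\<Sum>i<k. w' i *\<^sub>R \<xi> i)" by (simp add: \<eta>_def)
  ultimately have "C (u - t *\<^sub>R \<eta>) (\<xi> k) = (\<Sum>i<k. w' i * C (u - t *\<^sub>R \<eta>) (\<xi> i))"
    by (simp only: ip(2,4,9))
  also have "\<dots> = 0" using orth by simp
  finally have "\<forall>j<Suc k. C (u - t *\<^sub>R \<eta>) (\<xi> j) = 0" using orth less_Suc_eq by auto
  then show ?case unfolding eq[symmetric] by blast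
qed

context
  fixes C :: "'e::real_vector \<Rightarrow> 'e \<Rightarrow> real" and \<xi> \<eta> :: "nat \<Rightarrow> 'e" and w :: "nat \<Rightarrow> nat \<Rightarrow> real"
    and d :: "nat \<Rightarrow> real"
  assumes C: "inner_product C"
    and eta: "\<And>k. \<eta> k = \<xi> k - (\<Sum>i<k. w k i *\<^sub>R \<xi> i)"
    and orth: "\<And>j k. j < k \<Longrightarrow> C (\<eta> k) (\<xi> j) = 0"
    and d: "\<And>k. d k = C (\<eta> k) (\<eta> k)" and pos: "\<And>k. 0 < d k"
begin

text \<open>
  Integrating out the last variable shifts the frequencies \<open>t i\<close> by \<open>t N * w N i\<close> and contributes
  \<open>exp (- d N * (t N)\<^sup>2 / 2)\<close>. On the side of \<open>C\<close> this is the orthogonal decomposition of \<open>\<Sum>i\<le>N. t i *\<^sub>R \<xi> i\<close>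
  into a vector of the span of the first \<open>N\<close> vectors and \<open>t N *\<^sub>R \<eta> N\<close>.
\<close>
lemma triangular_density_transform:
  "(CLINT x|\<Pi>\<^sub>M i\<in>{..<N}. lborel. triangular_density w d N x *\<^sub>R iexp (\<Sum>i<N. t i * x i))
    = complex_of_real (exp (- C (\<Sum>i<N. t i *\<^sub>R \<xi> i) (\<Sum>i<N. t i *\<^sub>R \<xi> i) / 2))"
proof (induction N arbitrary: t)
  case 0
  have "C 0 0 = 0" using inner_productD(3)[OF C, of 0 0 0] by simp
  then show ?case
    by (simp add: triangular_density_def PiM_empty lebesgue_integral_count_space_finite)
next
  case (Suc N)
  interpret product_sigma_finite "\<lambda>_::nat. lborel :: real measure" by standard
  note ip = inner_productD[OF C]
  let ?P = "\<lambda>N. \<Pi>\<^sub>M i\<in>{..<N}. lborel :: real measure"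
  let ?F = "\<lambda>x. triangular_density w d (Suc N) x *\<^sub>R iexp (\<Sum>i<Suc N. t i * x i)"
  let ?t = "\<lambda>i. t i + t N * w N i"
  let ?v = "\<Sum>i<N. ?t i *\<^sub>R \<xi> i"
  have comp: "(\<lambda>x. x i) \<in> borel_measurable (?P (Suc N))" if "i < Suc N" for i
    using measurable_component_singleton[of i "{..<Suc N}" "\<lambda>_. lborel :: real measure"] that
    by (simp add: measurable_lborel1)
  have "integrable (?P (Suc N)) ?F"
  proof (rule Bochner_Integration.integrable_bound[OF triangular_density_integrable[where w = w and d = d and N = "Suc N", OF pos]])
    have "(\<lambda>x. \<Sum>i<Suc N. t i * x i) \<in> borel_measurable (?P (Suc N))"
      by (intro borel_measurable_sum borel_measurable_times comp) auto
    then show "?F \<in> borel_measurable (?P (Suc N))"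
      using triangular_density_measurable[of w d "Suc N"] by measurable
  qed (simp add: triangular_density_nonneg)
  then have "integral\<^sup>L (?P (Suc N)) ?F = (CLINT x|?P N. CLINT y|lborel. ?F (x(N := y)))"
    unfolding lessThan_Suc by (intro product_integral_insert) auto
  also have "\<dots> = (CLINT x|?P N. (triangular_density w d N x *\<^sub>R iexp (\<Sum>i<N. ?t i * x i))
      * complex_of_real (exp (- d N * (t N)\<^sup>2 / 2)))"
  proof (rule Bochner_Integration.integral_cong[OF refl])
    fix x
    let ?m = "\<Sum>i<N. w N i * x i"
    have "(CLINT y|lborel. ?F (x(N := y)))
        = (CLINT y|lborel. (triangular_density w d N x *\<^sub>R iexp (\<Sum>i<N. t i * x i))
            * (normal_density ?m (sqrt (d N)) y *\<^sub>R iexp (t N * y)))"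
    proof (rule Bochner_Integration.integral_cong[OF refl])
      fix y
      have "(\<Sum>i<Suc N. t i * (x(N := y)) i) = (\<Sum>i<N. t i * x i) + t N * y"
      proof -
        have "(\<Sum>i<N. t i * (x(N := y)) i) = (\<Sum>i<N. t i * x i)" by (rule sum.cong) auto
        then show ?thesis by simp
      qed
      then have "iexp (\<Sum>i<Suc N. t i * (x(N := y)) i) = iexp (\<Sum>i<N. t i * x i) * iexp (t N * y)"
        by (simp only: exp_add[symmetric] of_real_add distrib_left)
      then show "?F (x(N := y)) = (triangular_density w d N x *\<^sub>R iexp (\<Sum>i<N. t i * x i))
            * (normal_density ?m (sqrt (d N)) y *\<^sub>R iexp (t N * y))"
        by (simp only: triangular_density_Suc) (simp add: scaleR_conv_of_real)
    qed
    also have "\<dots> = (triangular_density w d N x *\<^sub>R iexp (\<Sum>i<N. t i * x i))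
        * (iexp (t N * ?m) * complex_of_real (exp (- (sqrt (d N) * t N)\<^sup>2 / 2)))"
      using pos[of N] by (simp only: integral_mult_right_zero normal_density_transform real_sqrt_gt_zero)
    also have "\<dots> = (triangular_density w d N x *\<^sub>R iexp (\<Sum>i<N. ?t i * x i))
      * complex_of_real (exp (- d N * (t N)\<^sup>2 / 2))"
    proof -
      have "(\<Sum>i<N. ?t i * x i) = (\<Sum>i<N. t i * x i) + t N * ?m"
        by (simp add: distrib_right sum.distrib sum_distrib_left mult.assoc)
      then have "iexp (\<Sum>i<N. ?t i * x i) = iexp (\<Sum>i<N. t i * x i) * iexp (t N * ?m)"
        by (simp only: exp_add[symmetric] of_real_add distrib_left)
      moreover have "(sqrt (d N) * t N)\<^sup>2 = d N * (t N)\<^sup>2"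
        using pos[of N] by (simp add: power_mult_distrib)
      ultimately show ?thesis by simp
    qed
    finally show "(CLINT y|lborel. ?F (x(N := y))) = (triangular_density w d N x *\<^sub>R iexp (\<Sum>i<N. ?t i * x i))
      * complex_of_real (exp (- d N * (t N)\<^sup>2 / 2))" .
  qed
  also have "\<dots> = complex_of_real (exp (- C ?v ?v / 2)) * complex_of_real (exp (- d N * (t N)\<^sup>2 / 2))"
    by (simp only: integral_mult_left_zero Suc.IH)
  also have "\<dots> = complex_of_real (exp (- (C ?v ?v + d N * (t N)\<^sup>2) / 2))"
    by (simp add: exp_add[symmetric] of_real_mult[symmetric] del: of_real_mult)
  also have "C ?v ?v + d N * (t N)\<^sup>2 = C (\<Sum>i<Suc N. t i *\<^sub>R \<xi> i) (\<Sum>i<Suc N. t i *\<^sub>R \<xi> i)"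
  proof -
    have "(\<Sum>i<Suc N. t i *\<^sub>R \<xi> i) = ?v + t N *\<^sub>R \<eta> N"
      by (simp add: eta scaleR_add_left sum.distrib scaleR_sum_right scaleR_diff_right)
    moreover have z: "C (\<eta> N) ?v = 0" by (simp only: ip(4,9)) (simp add: orth)
    moreover have "C ?v (\<eta> N) = 0" using z ip(5) by metis
    ultimately show ?thesis by (simp only: ip(1-4)) (simp add: d power2_eq_square)
  qed
  finally show ?case .
qed

lemma eta_orthogonal: "C (\<eta> j) (\<eta> k) = (if j = k then d k else 0)"
proof -
  note ip = inner_productD[OF C]
  have less: "C (\<eta> k) (\<eta> j) = 0" if "j < k" for j k
  proof -
    have "C (\<eta> k) (\<xi> j - (\<Sum>i<j. w j i *\<^sub>R \<xi> i)) = C (\<eta> k) (\<xi> j) - (\<Sum>i<j. w j i * C (\<eta> k) (\<xi> i))"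
      by (simp only: ip(4,9,10))
    also have "\<dots> = 0" using orth that by simp
    finally show ?thesis by (simp add: eta[of j])
  qed
  show ?thesis using less[of j k] less[of k j] ip(5)[of "\<eta> j" "\<eta> k"] d by (cases j k rule: linorder_cases) auto
qed

text \<open>
  In matrix form, orthogonality of the \<open>\<eta> k\<close> says that the unitriangular matrix \<open>A\<close> of their coordinates
  diagonalises the covariance matrix.
\<close>
lemma cov_mat_factorization:
  fixes n :: nat
  defines "N \<equiv> Suc n"
  defines "A \<equiv> Matrix.mat N N (\<lambda>(k, i). if i = k then 1 else if i < k then - w k i else 0)"
  shows "A * cov_mat C \<xi> n * transpose_mat A = Matrix.mat N N (\<lambda>(i, j). if i = j then d i else 0)"
    and "\<And>k. k < N \<Longrightarrow> \<eta> k = (\<Sum>i<N. A $$ (k, i) *\<^sub>R \<xi> i)"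
    and "\<And>k x. k < N \<Longrightarrow> (\<Sum>i<N. A $$ (k, i) * x i) = x k - (\<Sum>i<k. w k i * x i)"
proof -
  note ip = inner_productD[OF C]
  have split: "{..<N} = {..<k} \<union> {k} \<union> {Suc k..<N}" if "k < N" for k using that by auto
  show eta_A: "\<eta> k = (\<Sum>i<N. A $$ (k, i) *\<^sub>R \<xi> i)" if k: "k < N" for k
  proof -
    have "(\<Sum>i<N. A $$ (k, i) *\<^sub>R \<xi> i) = (\<Sum>i<k. A $$ (k, i) *\<^sub>R \<xi> i) + A $$ (k, k) *\<^sub>R \<xi> k
        + (\<Sum>i=Suc k..<N. A $$ (k, i) *\<^sub>R \<xi> i)"
      unfolding split[OF k] by (subst sum.union_disjoint; auto)+
    also have "\<dots> = - (\<Sum>i<k. w k i *\<^sub>R \<xi> i) + \<xi> k"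
      using k by (simp add: A_def sum_negf)
    finally show ?thesis by (simp add: eta)
  qed
  show "(\<Sum>i<N. A $$ (k, i) * x i) = x k - (\<Sum>i<k. w k i * x i)" if k: "k < N" for k and x :: "nat \<Rightarrow> real"
  proof -
    have "(\<Sum>i<N. A $$ (k, i) * x i) = (\<Sum>i<k. A $$ (k, i) * x i) + A $$ (k, k) * x k
        + (\<Sum>i=Suc k..<N. A $$ (k, i) * x i)"
      unfolding split[OF k] by (subst sum.union_disjoint; auto)+
    also have "\<dots> = - (\<Sum>i<k. w k i * x i) + x k"
      using k by (simp add: A_def sum_negf)
    finally show ?thesis by simp
  qed
  show "A * cov_mat C \<xi> n * transpose_mat A = Matrix.mat N N (\<lambda>(i, j). if i = j then d i else 0)"
  proof (rule eq_matI)
    fix k l assume "k < dim_row (Matrix.mat N N (\<lambda>(i, j). if i = j then d i else 0))"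
      "l < dim_col (Matrix.mat N N (\<lambda>(i, j). if i = j then d i else 0))"
    then have kl: "k < N" "l < N" by auto
    have "(A * cov_mat C \<xi> n * transpose_mat A) $$ (k, l)
        = (\<Sum>j<N. (\<Sum>i<N. A $$ (k, i) * C (\<xi> i) (\<xi> j)) * A $$ (l, j))"
      using kl by (simp add: A_def cov_mat_def N_def scalar_prod_def atLeast0LessThan)
    also have "\<dots> = C (\<eta> k) (\<eta> l)"
      unfolding eta_A[OF kl(1)] eta_A[OF kl(2)] by (simp only: ip(3,4,8,9)) (simp add: mult.commute)
    finally show "(A * cov_mat C \<xi> n * transpose_mat A) $$ (k, l)
        = Matrix.mat N N (\<lambda>(i, j). if i = j then d i else 0) $$ (k, l)"
      using kl by (simp add: eta_orthogonal)
  qed (auto simp: A_def)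
qed

text \<open>
  From \<open>A * C * transpose A = D\<close> follow \<open>det C = det D\<close> and \<open>inverse C = transpose A * inverse D * A\<close>, so that the quadratic form of
  the inverse at \<open>x\<close> is that of \<open>inverse D\<close> at \<open>A x\<close>.
\<close>
lemma det_cov_mat: "Determinant.det (cov_mat C \<xi> n) = (\<Prod>k<Suc n. d k)"
  and quadratic_form_cov_mat:
    "(\<Sum>i\<le>n. \<Sum>j\<le>n. the (mat_inverse (cov_mat C \<xi> n)) $$ (i, j) * x i * x j)
      = (\<Sum>k<Suc n. (x k - (\<Sum>i<k. w k i * x i))\<^sup>2 / d k)"
proof -
  define N where "N = Suc n"
  define A where "A = Matrix.mat N N (\<lambda>(k, i). if i = k then 1 else if i < k then - w k i else 0 :: real)"
  define D where "D = Matrix.mat N N (\<lambda>(i, j). if i = j then d i else 0)"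
  define D' where "D' = Matrix.mat N N (\<lambda>(i, j). if i = j then 1 / d i else 0)"
  let ?C = "cov_mat C \<xi> n"
  note fac = cov_mat_factorization[where n = n, folded N_def, folded A_def, folded D_def]
  have carr [simp]: "A \<in> carrier_mat N N" "D \<in> carrier_mat N N" "D' \<in> carrier_mat N N"
    "?C \<in> carrier_mat N N" "transpose_mat A \<in> carrier_mat N N"
    by (auto simp: A_def D_def D'_def cov_mat_def N_def)
  have dims: "dim_row A = N" "dim_col A = N" "dim_row D' = N" "dim_col D' = N"
    by (simp_all add: A_def D'_def)
  have detA: "Determinant.det A = 1"
  proof -
    have "Determinant.det A = prod_list (diag_mat A)"
      by (rule det_lower_triangular[of N]) (auto simp: A_def)
    also have "diag_mat A = map (\<lambda>_. 1) [0..<N]" by (auto simp: diag_mat_def A_def)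
    also have "prod_list \<dots> = 1" by (induction N) auto
    finally show ?thesis .
  qed
  have detD: "Determinant.det D = (\<Prod>k<N. d k)"
  proof -
    have "Determinant.det D = prod_list (diag_mat D)"
      by (rule det_lower_triangular[of N]) (auto simp: D_def)
    also have "diag_mat D = map d [0..<N]" by (auto simp: diag_mat_def D_def)
    also have "prod_list \<dots> = (\<Prod>k<N. d k)"
      by (simp add: prod.distinct_set_conv_list[symmetric] atLeast0LessThan)
    finally show ?thesis .
  qed
  have AC: "A * ?C \<in> carrier_mat N N" by (rule mult_carrier_mat[OF carr(1,4)])
  have "Determinant.det D = Determinant.det A * Determinant.det ?C * Determinant.det (transpose_mat A)"
    unfolding fac(1)[symmetric]
    using det_mult[OF AC carr(5)] det_mult[OF carr(1,4)] by simp
  then show "Determinant.det ?C = (\<Prod>k<Suc n. d k)"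
    using detA detD det_transpose[OF carr(1)] by (simp add: N_def)
  define P where "P = transpose_mat A * D' * A"
  have P [simp]: "P \<in> carrier_mat N N" unfolding P_def by (intro mult_carrier_mat[of _ N N]) auto
  have DD': "D * D' = 1\<^sub>m N"
  proof (rule eq_matI)
    fix i j assume "i < dim_row (1\<^sub>m N)" "j < dim_col (1\<^sub>m N)"
    then have ij: "i < N" "j < N" by auto
    have "(D * D') $$ (i, j) = (\<Sum>k<N. (if i = k then d i else 0) * (if k = j then 1 / d k else 0))"
      using ij by (simp add: D_def D'_def scalar_prod_def atLeast0LessThan)
    also have "\<dots> = (\<Sum>k<N. if i = k then (if i = j then 1 else 0) else 0)"
      by (rule sum.cong) (use pos in \<open>auto simp: less_imp_neq[symmetric]\<close>)
    finally show "(D * D') $$ (i, j) = 1\<^sub>m N $$ (i, j)" using ij by simp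
  qed (auto simp: D_def D'_def)
  let ?B = "?C * (transpose_mat A * D')"
  have TD: "transpose_mat A * D' \<in> carrier_mat N N" by (intro mult_carrier_mat[of _ N N]) auto
  have CT: "?C * transpose_mat A \<in> carrier_mat N N" by (rule mult_carrier_mat[OF carr(4,5)])
  have B: "?B \<in> carrier_mat N N" by (intro mult_carrier_mat[of _ N N] TD) auto
  have "A * ?B = (A * ?C * transpose_mat A) * D'"
    by (simp only: assoc_mult_mat[OF carr(4,5,3), symmetric] assoc_mult_mat[OF carr(1) CT carr(3), symmetric]
        assoc_mult_mat[OF carr(1,4,5), symmetric])
  also have "\<dots> = 1\<^sub>m N" by (simp only: fac(1) DD')
  finally have "?B * A = 1\<^sub>m N" by (intro mat_mult_left_right_inverse[OF carr(1) B])
  then have CP: "?C * P = 1\<^sub>m N"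
    unfolding P_def by (simp add: assoc_mult_mat[of _ N N _ N _ N] TD)
  then have PC: "P * ?C = 1\<^sub>m N" by (rule mat_mult_left_right_inverse[OF carr(4) P])
  have unit: "?C \<in> Units (ring_mat TYPE(real) N ())"
    using CP PC by (auto simp: Units_def ring_mat_def intro!: bexI[of _ P])
  then obtain Q where Q: "mat_inverse ?C = Some Q"
    using mat_inverse(1)[OF carr(4), of "()"] by (cases "mat_inverse ?C") auto
  from mat_inverse(2)[OF _ Q, of N] have Q': "Q * ?C = 1\<^sub>m N" "Q \<in> carrier_mat N N" by auto
  have "Q = Q * (?C * P)" using CP Q'(2) by simp
  also have "\<dots> = (Q * ?C) * P" using Q'(2) by (simp add: assoc_mult_mat[of _ N N _ N _ N])
  also have "\<dots> = P" by (simp only: Q'(1) left_mult_one_mat[OF P])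
  finally have the_inv: "the (mat_inverse ?C) = P" using Q by simp
  have P_entry: "P $$ (i, j) = (\<Sum>k<N. A $$ (k, i) * A $$ (k, j) / d k)" if "i < N" "j < N" for i j
  proof -
    have "P $$ (i, j) = (\<Sum>k<N. (\<Sum>l<N. A $$ (l, i) * D' $$ (l, k)) * A $$ (k, j))"
      using that dims unfolding P_def by (simp add: scalar_prod_def atLeast0LessThan)
    also have "\<dots> = (\<Sum>k<N. A $$ (k, i) * A $$ (k, j) / d k)"
    proof (rule sum.cong[OF refl])
      fix k assume "k \<in> {..<N}"
      then have "(\<Sum>l<N. A $$ (l, i) * D' $$ (l, k)) = (\<Sum>l<N. if l = k then A $$ (k, i) / d k else 0)"
        by (intro sum.cong) (auto simp: D'_def)
      then show "(\<Sum>l<N. A $$ (l, i) * D' $$ (l, k)) * A $$ (k, j) = A $$ (k, i) * A $$ (k, j) / d k"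
        using \<open>k \<in> {..<N}\<close> by simp
    qed
    finally show ?thesis .
  qed
  have "(\<Sum>i\<le>n. \<Sum>j\<le>n. the (mat_inverse ?C) $$ (i, j) * x i * x j)
      = (\<Sum>i<N. \<Sum>j<N. \<Sum>k<N. (A $$ (k, i) * x i) * (A $$ (k, j) * x j) / d k)"
    unfolding the_inv N_def lessThan_Suc_atMost
    by (intro sum.cong refl) (simp add: P_entry[unfolded N_def lessThan_Suc_atMost] sum_distrib_right sum_distrib_left ac_simps)
  also have "\<dots> = (\<Sum>i<N. \<Sum>k<N. \<Sum>j<N. (A $$ (k, i) * x i) * (A $$ (k, j) * x j) / d k)"
    by (intro sum.cong refl sum.swap)
  also have "\<dots> = (\<Sum>k<N. \<Sum>i<N. \<Sum>j<N. (A $$ (k, i) * x i) * (A $$ (k, j) * x j) / d k)"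
    by (rule sum.swap)
  also have "\<dots> = (\<Sum>k<N. (\<Sum>i<N. A $$ (k, i) * x i)\<^sup>2 / d k)"
    by (simp add: power2_eq_square sum_product sum_divide_distrib)
  also have "\<dots> = (\<Sum>k<N. (x k - (\<Sum>i<k. w k i * x i))\<^sup>2 / d k)"
  proof (rule sum.cong[OF refl])
    fix k assume "k \<in> {..<N}"
    then have "(\<Sum>i<N. A $$ (k, i) * x i) = x k - (\<Sum>i<k. w k i * x i)" using fac(3)[where k = k and x = x] by simp
    then show "(\<Sum>i<N. A $$ (k, i) * x i)\<^sup>2 / d k = (x k - (\<Sum>i<k. w k i * x i))\<^sup>2 / d k"
      by (simp only:)
  qed
  finally show "(\<Sum>i\<le>n. \<Sum>j\<le>n. the (mat_inverse ?C) $$ (i, j) * x i * x j)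
      = (\<Sum>k<Suc n. (x k - (\<Sum>i<k. w k i * x i))\<^sup>2 / d k)" by (simp add: N_def)
qed

lemma gaussian_density_eq_triangular:
  "exp (- (1 / 2) * (\<Sum>i\<le>n. \<Sum>j\<le>n. the (mat_inverse (cov_mat C \<xi> n)) $$ (i, j) * x i * x j)) /
      sqrt ((2 * pi) ^ Suc n * Determinant.det (cov_mat C \<xi> n))
    = triangular_density w d (Suc n) x"
proof -
  have "triangular_density w d (Suc n) x
      = (\<Prod>k<Suc n. exp (- ((x k - (\<Sum>i<k. w k i * x i))\<^sup>2 / d k) / 2)) / (\<Prod>k<Suc n. sqrt (2 * pi * d k))"
    unfolding triangular_density_def prod_dividef[symmetric]
    by (intro prod.cong refl) (use pos in \<open>simp add: normal_density_def less_imp_le\<close>)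
  also have "(\<Prod>k<Suc n. sqrt (2 * pi * d k)) = sqrt (\<Prod>k<Suc n. 2 * pi * d k)"
  proof -
    have "sqrt (\<Prod>k<m. 2 * pi * d k) = (\<Prod>k<m. sqrt (2 * pi * d k))" for m
      by (induction m) (simp_all add: real_sqrt_mult)
    from this[of "Suc n"] show ?thesis by (rule sym)
  qed
  also have "(\<Prod>k<Suc n. 2 * pi * d k) = (2 * pi) ^ Suc n * (\<Prod>k<Suc n. d k)"
    by (simp only: prod.distrib prod_constant card_lessThan power_mult_distrib)
  also have "(\<Prod>k<Suc n. exp (- ((x k - (\<Sum>i<k. w k i * x i))\<^sup>2 / d k) / 2))
      = exp (- (1 / 2) * (\<Sum>k<Suc n. (x k - (\<Sum>i<k. w k i * x i))\<^sup>2 / d k))"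
    unfolding exp_sum[OF finite_lessThan, symmetric] sum_distrib_left
    by (intro arg_cong[of _ _ exp] sum.cong refl) simp
  finally show ?thesis by (simp only: det_cov_mat quadratic_form_cov_mat)
qed

end

section \<open>Gaussian measures on duals\<close>

lemma alg_dualD:
  assumes "l \<in> alg_dual V"
  shows "\<And>x y. x \<in> V \<Longrightarrow> y \<in> V \<Longrightarrow> l (x + y) = l x + l y" "\<And>a x. x \<in> V \<Longrightarrow> l (a *\<^sub>R x) = a * l x"
  using assms by (auto simp: alg_dual_def)

lemma restrict_in_alg_dual:
  assumes "subspace V" "W = UNIV \<and> linear l \<or> V \<subseteq> W \<and> l \<in> alg_dual W"
  shows "restrict l V \<in> alg_dual V"
  using assms by (auto simp: alg_dual_def subspace_add subspace_scale linear_add linear_cmul subset_iff)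

text \<open>
  The characteristic function at \<open>0\<close> is the total mass. A Bochner integral of \<open>1\<close> over an infinite
  measure would be \<open>0\<close>, so the value \<open>1\<close> also gives finiteness.
\<close>
lemma prob_space_of_gaussian_char:
  assumes C: "inner_product C" and char: "gaussian_char C V M"
    and V: "0 \<in> V" "\<And>l. l \<in> space M \<Longrightarrow> l 0 = 0"
  shows "prob_space M"
proof -
  have "(CLINT l|M. 1) = (CLINT l|M. iexp (l 0))"
    by (rule Bochner_Integration.integral_cong) (simp_all add: V(2))
  also have "\<dots> = 1"
    using char V(1) inner_productD(3)[OF C, of 0 0 0] by (simp add: gaussian_char_def)
  finally have "(CLINT l|M. 1) = 1" .
  then have one: "measure M (space M) = 1" by (simp add: scaleR_conv_of_real)
  then have "emeasure M (space M) \<noteq> \<top>" by (auto simp: measure_def)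
  from emeasure_eq_ennreal_measure[OF this] show ?thesis by (intro prob_spaceI) (simp add: one)
qed

lemma span_image_finite_sum:
  assumes "finite I" "x \<in> span (f ` I)"
  obtains t where "x = (\<Sum>i\<in>I. t i *\<^sub>R f i)"
proof -
  have "\<exists>t. x = (\<Sum>i\<in>I. t i *\<^sub>R f i)"
    using assms(2)
  proof (induction rule: span_induct_alt)
    case base
    show ?case by (intro exI[of _ "\<lambda>_. 0"]) simp
  next
    case (step c y z)
    then obtain t j where t: "z = (\<Sum>i\<in>I. t i *\<^sub>R f i)" "j \<in> I" "y = f j" by auto
    have "(\<Sum>i\<in>I. (t i + (if i = j then c else 0)) *\<^sub>R f i) = z + (\<Sum>i\<in>I. (if i = j then c else 0) *\<^sub>R f i)"
      by (simp add: scaleR_add_left sum.distrib t(1))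
    also have "(\<Sum>i\<in>I. (if i = j then c else 0) *\<^sub>R f i) = (\<Sum>i\<in>I. if i = j then c *\<^sub>R f j else 0)"
      by (rule sum.cong) auto
    also have "\<dots> = c *\<^sub>R y" using assms(1) t(2,3) by simp
    finally show ?case by (metis add.commute)
  qed
  then show ?thesis using that by blast
qed

text \<open>
  The Gaussian density, moved to the dual by the inverse of the coordinate map, has the characteristic
  function that defines \<open>K\<close>, so it is \<open>K\<close> by uniqueness.
\<close>
lemma gaussian_integral_eq:
  fixes \<xi> :: "nat \<Rightarrow> 'e::real_vector"
  assumes C: "inner_product C" and K: "fin_dim_gaussian C (fin_span \<xi> n) K"
    and inj: "inj \<xi>" and indep: "independent (range \<xi>)"
    and u: "u \<in> borel_measurable K"
  shows "gaussian_integral C \<xi> n u = integral\<^sup>L K u"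
proof -
  let ?V = "fin_span \<xi> n" and ?P = "\<Pi>\<^sub>M i\<in>{..<Suc n}. lborel :: real measure"
  have not_span: "\<xi> k \<notin> span (\<xi> ` {..<k})" for k
  proof
    assume "\<xi> k \<in> span (\<xi> ` {..<k})"
    moreover have "\<xi> ` {..<k} \<subseteq> range \<xi> - {\<xi> k}" using inj by (auto dest: injD)
    ultimately have "\<xi> k \<in> span (range \<xi> - {\<xi> k})" using span_mono by blast
    then show False using indep unfolding dependent_def by blast
  qed
  have "\<forall>k. \<exists>w. \<forall>j<k. C (\<xi> k - (\<Sum>i<k. w i *\<^sub>R \<xi> i)) (\<xi> j) = 0"
    using orthogonal_projection_exists[OF C not_span] by blast
  then obtain w where w: "\<And>k j. j < k \<Longrightarrow> C (\<xi> k - (\<Sum>i<k. w k i *\<^sub>R \<xi> i)) (\<xi> j) = 0" by metis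
  define \<eta> where "\<eta> k = \<xi> k - (\<Sum>i<k. w k i *\<^sub>R \<xi> i)" for k
  define d where "d k = C (\<eta> k) (\<eta> k)" for k
  have d: "0 < d k" for k
  proof -
    have "(\<Sum>i<k. w k i *\<^sub>R \<xi> i) \<in> span (\<xi> ` {..<k})"
      by (intro span_sum span_scale span_base) auto
    then have "\<eta> k \<noteq> 0" using not_span[of k] by (auto simp: \<eta>_def)
    then show ?thesis unfolding d_def by (rule inner_productD(6)[OF C])
  qed
  have orth: "j < k \<Longrightarrow> C (\<eta> k) (\<xi> j) = 0" for j k using w by (simp add: \<eta>_def)
  let ?g = "triangular_density w d (Suc n)"
  have g [measurable]: "?g \<in> borel_measurable ?P" by (rule triangular_density_measurable)
  define J where "J x = inv_into (alg_dual ?V) (coords \<xi> n) x" for x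
  have coords_onto: "x \<in> coords \<xi> n ` alg_dual ?V" if "x \<in> space ?P" for x
  proof -
    obtain h where h: "linear h" "\<And>v. v \<in> range \<xi> \<Longrightarrow> h v = x (the_inv \<xi> v)"
      using linear_independent_extend[OF indep, of "\<lambda>v. x (the_inv \<xi> v)"] by blast
    have "coords \<xi> n (restrict h ?V) = x"
    proof
      fix i
      show "coords \<xi> n (restrict h ?V) i = x i"
        using h(2)[of "\<xi> i"] the_inv_f_f[OF inj, of i] that
        by (auto simp: coords_def fin_span_def span_base space_PiM PiE_def extensional_def)
    qed
    moreover have "restrict h ?V \<in> alg_dual ?V"
      by (rule restrict_in_alg_dual[where W = UNIV]) (use h(1) in \<open>auto simp: fin_span_def\<close>)
    ultimately show ?thesis by (metis imageI)
  qed
  have J_dual: "J x \<in> alg_dual ?V" and J_coords: "coords \<xi> n (J x) = x" if "x \<in> space ?P" for x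
    using inv_into_into[OF coords_onto[OF that]] f_inv_into_f[OF coords_onto[OF that]] by (auto simp: J_def)
  have J_val: "J x (\<Sum>i<Suc n. t i *\<^sub>R \<xi> i) = (\<Sum>i<Suc n. t i * x i)" if x: "x \<in> space ?P" for x t
  proof -
    have "J x (\<Sum>i<Suc n. t i *\<^sub>R \<xi> i) = (\<Sum>i<Suc n. t i * J x (\<xi> i))"
      by (rule alg_dual_sum[OF J_dual[OF x]]) (auto simp: fin_span_def intro!: span_base)
    also have "\<dots> = (\<Sum>i<Suc n. t i * x i)"
    proof (rule sum.cong[OF refl])
      fix i assume "i \<in> {..<Suc n}"
      then have "J x (\<xi> i) = coords \<xi> n (J x) i" by (simp add: coords_def)
      then show "t i * J x (\<xi> i) = t i * x i" by (simp add: J_coords[OF x])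
    qed
    finally show ?thesis .
  qed
  have V_sum: "\<exists>t. v = (\<Sum>i<Suc n. t i *\<^sub>R \<xi> i)" if v: "v \<in> ?V" for v
  proof -
    have "v \<in> span (\<xi> ` {..<Suc n})" using v by (simp add: fin_span_def lessThan_Suc_atMost)
    then show ?thesis by (rule span_image_finite_sum[OF finite_lessThan]) blast
  qed
  have setsK: "sets K = sets (eval_algebra (alg_dual ?V) ?V)"
    using K sets_alg_dual_borel_eval[of "\<xi> ` {..n}"] by (simp add: fin_dim_gaussian_def fin_span_def)
  have spaceK: "space K = alg_dual ?V" using sets_eq_imp_space_eq[OF setsK] by simp
  have comp: "(\<lambda>x. x i) \<in> borel_measurable ?P" if "i < Suc n" for i
    using measurable_component_singleton[of i "{..<Suc n}" "\<lambda>_. lborel :: real measure"] that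
    by (simp add: measurable_lborel1)
  have "J \<in> measurable ?P (eval_algebra (alg_dual ?V) ?V)"
  proof (rule measurable_into_eval_algebra[OF J_dual])
    fix v assume "v \<in> ?V"
    then obtain t where t: "v = (\<Sum>i<Suc n. t i *\<^sub>R \<xi> i)" using V_sum by blast
    have "(\<lambda>x. \<Sum>i<Suc n. t i * x i) \<in> borel_measurable ?P"
      by (intro borel_measurable_sum borel_measurable_times comp) auto
    then show "(\<lambda>x. J x v) \<in> borel_measurable ?P"
      unfolding t by (rule measurable_cong[THEN iffD2, rotated]) (rule J_val)
  qed
  then have J [measurable]: "J \<in> measurable ?P K"
    by (simp only: measurable_cong_sets[OF refl setsK])
  let ?G = "density ?P (\<lambda>x. ennreal (?g x))"
  have JG: "J \<in> measurable ?G K" using J by simp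
  have "emeasure ?G (space ?G) = 1"
    using triangular_density_nn_integral[of "Suc n" d w, OF d] by (simp add: emeasure_density cong: nn_integral_cong)
  then interpret G: prob_space ?G by (rule prob_spaceI)
  interpret D: prob_space "distr ?G K J" by (rule G.prob_space_distr[OF JG])
  interpret K: prob_space K
  proof (rule prob_space_of_gaussian_char[OF C, of ?V])
    show "gaussian_char C ?V K" using K by (simp add: fin_dim_gaussian_def)
    show "0 \<in> ?V" by (simp add: fin_span_def span_zero)
    show "l 0 = 0" if "l \<in> space K" for l
      using alg_dualD(2)[of l ?V 0 0] that by (simp add: spaceK fin_span_def span_zero)
  qed
  have "distr ?G K J = K"
  proof (rule measure_eq_of_same_char[where \<Omega> = "alg_dual ?V" and V = ?V])
    fix v assume v: "v \<in> ?V"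
    then obtain t where t: "v = (\<Sum>i<Suc n. t i *\<^sub>R \<xi> i)" using V_sum by blast
    have ev: "(\<lambda>l. iexp (l v)) \<in> borel_measurable K"
    proof -
      have "(\<lambda>l. l v) \<in> borel_measurable K"
        using eval_measurable[OF v, of "alg_dual ?V"] by (simp only: measurable_cong_sets[OF setsK refl])
      then show ?thesis by measurable
    qed
    have "(CLINT l|distr ?G K J. iexp (l v)) = (CLINT x|?G. iexp (J x v))"
      by (rule integral_distr[OF JG ev])
    also have "\<dots> = (CLINT x|?P. ?g x *\<^sub>R iexp (J x v))"
      by (rule integral_density) (use measurable_compose[OF J ev] triangular_density_nonneg in auto)
    also have "\<dots> = (CLINT x|?P. ?g x *\<^sub>R iexp (\<Sum>i<Suc n. t i * x i))"
      unfolding t by (rule Bochner_Integration.integral_cong[OF refl]) (simp only: J_val)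
    also have "\<dots> = complex_of_real (exp (- C v v / 2))"
      unfolding t by (rule triangular_density_transform[OF C \<eta>_def orth d_def d])
    also have "\<dots> = (CLINT l|K. iexp (l v))"
      using K v by (simp add: fin_dim_gaussian_def gaussian_char_def)
    finally show "(CLINT l|distr ?G K J. iexp (l v)) = (CLINT l|K. iexp (l v))" .
  qed (use setsK alg_dualD D.finite_measure_axioms K.finite_measure_axioms in \<open>auto simp: fin_span_def\<close>)
  then have "integral\<^sup>L K u = integral\<^sup>L (distr ?G K J) u" by (simp only:)
  also have "\<dots> = (LINT x|?G. u (J x))" by (rule integral_distr[OF JG u])
  also have "\<dots> = (LINT x|?P. ?g x *\<^sub>R u (J x))"
    by (rule integral_density) (use measurable_compose[OF J u] triangular_density_nonneg in auto)
  also have "\<dots> = gaussian_integral C \<xi> n u"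
  proof -
    have "?g x = exp (- (1 / 2) * (\<Sum>i\<le>n. \<Sum>j\<le>n. the (mat_inverse (cov_mat C \<xi> n)) $$ (i, j) * x i * x j)) /
        sqrt ((2 * pi) ^ Suc n * Determinant.det (cov_mat C \<xi> n))" for x
      by (rule gaussian_density_eq_triangular[OF C \<eta>_def orth d_def d, symmetric])
    then show ?thesis
      unfolding gaussian_integral_def J_def lessThan_Suc_atMost by (simp only: real_scaleR_def mult.commute)
  qed
  finally show ?thesis by (rule sym)
qed

text \<open>
  Countably many seminorms give a countable neighbourhood base \<open>B n\<close> at \<open>x\<close>.
\<close>
lemma frechet_closure_sequential:
  fixes S :: "'e::{real_vector,topological_space} set"
  assumes E: "frechet_space TYPE('e)" and x: "x \<in> closure S"
  obtains y where "\<And>n::nat. y n \<in> S" "y \<longlonglongrightarrow> x"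
proof -
  obtain P :: "nat \<Rightarrow> 'e \<Rightarrow> real" where P: "\<And>i. seminorm (P i)"
    and opn: "\<And>U. open U \<longleftrightarrow> (\<forall>x\<in>U. \<exists>F \<epsilon>. finite F \<and> \<epsilon> > 0 \<and> {y. \<forall>i\<in>F. P i (y - x) < \<epsilon>} \<subseteq> U)"
    using E unfolding frechet_space_def by blast
  have P0: "P i 0 = 0" for i using P[of i] by (metis abs_zero mult_zero_left scaleR_zero_left seminorm_def)
  define B where "B n = {y. \<forall>i\<in>{..n}. P i (y - x) < 1 / real (Suc n)}" for n
  have "open (B n)" for n
    unfolding opn
  proof
    fix z assume z: "z \<in> B n"
    define e where "e = Min ((\<lambda>i. 1 / real (Suc n) - P i (z - x)) ` {..n})"
    have "0 < e" unfolding e_def using z by (subst Min_gr_iff) (auto simp: B_def)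
    moreover have "{y. \<forall>i\<in>{..n}. P i (y - z) < e} \<subseteq> B n"
    proof
      fix y assume y: "y \<in> {y. \<forall>i\<in>{..n}. P i (y - z) < e}"
      have "P i (y - x) < 1 / real (Suc n)" if "i \<le> n" for i
      proof -
        have "P i ((y - z) + (z - x)) \<le> P i (y - z) + P i (z - x)"
          using P[of i] unfolding seminorm_def by blast
        moreover have "e \<le> 1 / real (Suc n) - P i (z - x)"
          unfolding e_def using that by (intro Min_le) auto
        moreover have "P i (y - z) < e" using y that by auto
        ultimately show ?thesis by simp
      qed
      then show "y \<in> B n" by (simp add: B_def)
    qed
    ultimately show "\<exists>F \<epsilon>. finite F \<and> \<epsilon> > 0 \<and> {y. \<forall>i\<in>F. P i (y - z) < \<epsilon>} \<subseteq> B n"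
      by (intro exI[of _ "{..n}"] exI[of _ e]) auto
  qed
  moreover have "x \<in> B n" for n by (simp add: B_def P0)
  ultimately have "\<exists>y\<in>S. y \<in> B n" for n
    using x by (meson closure_iff_nhds_not_empty subset_refl disjoint_iff)
  then obtain y where y: "\<And>n. y n \<in> S" "\<And>n. y n \<in> B n" by metis
  have "y \<longlonglongrightarrow> x"
  proof (rule topological_tendstoI)
    fix U assume U: "open U" "x \<in> U"
    from iffD1[OF opn U(1), THEN bspec, OF U(2)]
    obtain F e where F: "finite F" "0 < e" "{y. \<forall>i\<in>F. P i (y - x) < e} \<subseteq> U" by (elim exE conjE)
    obtain N where N: "1 / real (Suc N) < e"
      using reals_Archimedean[OF F(2)] by (auto simp: inverse_eq_divide)
    obtain M where M: "\<And>i. i \<in> F \<Longrightarrow> i \<le> M"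
      using F(1)[unfolded finite_nat_set_iff_bounded_le] by (elim exE) (rule that, erule bspec)
    have "y n \<in> U" if n: "max N M \<le> n" for n
    proof -
      have "P i (y n - x) < e" if "i \<in> F" for i
      proof -
        have "P i (y n - x) < 1 / real (Suc n)" using y(2)[of n] M[OF that] n by (auto simp: B_def)
        also have "\<dots> \<le> 1 / real (Suc N)" using n by (intro divide_left_mono) auto
        finally show ?thesis using N by simp
      qed
      then show ?thesis using F(3) by blast
    qed
    then show "\<forall>\<^sub>F n in sequentially. y n \<in> U" unfolding eventually_sequentially by blast
  qed
  then show ?thesis using y(1) that by blast
qed

lemma fin_span_mono: "n \<le> m \<Longrightarrow> fin_span \<xi> n \<subseteq> fin_span \<xi> m"
  unfolding fin_span_def by (intro span_mono image_mono) auto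

lemma span_range_eq_UN_fin_span: "span (range \<xi>) = (\<Union>n. fin_span \<xi> n)"
proof
  have "subspace (\<Union>n. fin_span \<xi> n)"
  proof (rule subspaceI)
    show "0 \<in> (\<Union>n. fin_span \<xi> n)" by (auto simp: fin_span_def span_zero)
    fix x y assume "x \<in> (\<Union>n. fin_span \<xi> n)" "y \<in> (\<Union>n. fin_span \<xi> n)"
    then obtain n m where "x \<in> fin_span \<xi> n" "y \<in> fin_span \<xi> m" by auto
    then have "x \<in> fin_span \<xi> (max n m)" "y \<in> fin_span \<xi> (max n m)"
      using fin_span_mono[of n "max n m" \<xi>] fin_span_mono[of m "max n m" \<xi>] by auto
    then have "x + y \<in> fin_span \<xi> (max n m)" unfolding fin_span_def by (rule span_add)
    then show "x + y \<in> (\<Union>n. fin_span \<xi> n)" by blast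
  next
    fix c x assume "x \<in> (\<Union>n. fin_span \<xi> n)"
    then show "c *\<^sub>R x \<in> (\<Union>n. fin_span \<xi> n)" unfolding fin_span_def by (auto intro: span_scale)
  qed
  moreover have "range \<xi> \<subseteq> (\<Union>n. fin_span \<xi> n)"
    unfolding fin_span_def by (auto intro!: span_base)
  ultimately show "span (range \<xi>) \<subseteq> (\<Union>n. fin_span \<xi> n)" by (intro span_minimal)
  show "(\<Union>n. fin_span \<xi> n) \<subseteq> span (range \<xi>)"
    unfolding fin_span_def by (intro UN_least span_mono) auto
qed

lemma cylinder_algebra_eval: "cylinder_algebra = eval_algebra top_dual UNIV"
  by (simp add: cylinder_algebra_def eval_algebra_def)

text \<open>
  Measure preservation holds because the image of \<open>\<mu>\<close> has the characteristic function of \<open>\<mu>n n\<close>. The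
  levels generate because evaluation at any \<open>x\<close> is, on continuous functionals, the pointwise limit of
  evaluations at vectors \<open>y n\<close> of the dense span, each of which belongs to some level.
\<close>
theorem gaussian_measure_tower:
  fixes \<mu> :: "('e::{real_vector,topological_space} \<Rightarrow> real) measure"
  assumes E: "frechet_space TYPE('e)" and \<mu>: "gaussian_measure C \<mu>" and \<xi>: "complete_system \<xi>"
    and \<mu>n: "\<And>n. fin_dim_gaussian C (fin_span \<xi> n) (\<mu>n n)"
  shows "measure_tower \<mu> \<mu>n (phi \<xi>) (proj \<xi>)"
proof -
  have C: "inner_product C" and setsM: "sets \<mu> = sets (eval_algebra top_dual UNIV)"
    and charM: "gaussian_char C UNIV \<mu>"
    using \<mu> by (auto simp: gaussian_measure_def cylinder_algebra_eval)
  have spaceM: "space \<mu> = top_dual" using sets_eq_imp_space_eq[OF setsM] by simp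
  have lin: "linear l" if "l \<in> top_dual" for l :: "'e \<Rightarrow> real" using that by (simp add: top_dual_def)
  have setsN: "sets (\<mu>n n) = sets (eval_algebra (alg_dual (fin_span \<xi> n)) (fin_span \<xi> n))" for n
    using \<mu>n[of n] sets_alg_dual_borel_eval[of "\<xi> ` {..n}"] by (simp add: fin_dim_gaussian_def fin_span_def)
  have spaceN: "space (\<mu>n n) = alg_dual (fin_span \<xi> n)" for n
    using sets_eq_imp_space_eq[OF setsN] by simp
  have sub: "subspace (fin_span \<xi> n)" for n by (simp add: fin_span_def)
  have charN: "gaussian_char C (fin_span \<xi> n) (\<mu>n n)" for n using \<mu>n by (simp add: fin_dim_gaussian_def)
  interpret M: prob_space \<mu>
    by (rule prob_space_of_gaussian_char[OF C charM]) (auto simp: spaceM lin linear_0)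
  have zeroN: "l 0 = 0" if "l \<in> space (\<mu>n n)" for l n
    using alg_dualD(2)[of l "fin_span \<xi> n" 0 0] that by (simp add: spaceN subspace_0[OF sub])
  have finN: "finite_measure (\<mu>n n)" for n
  proof -
    interpret prob_space "\<mu>n n"
      by (rule prob_space_of_gaussian_char[OF C charN[of n] subspace_0[OF sub]]) (rule zeroN)
    show ?thesis by (rule finite_measure_axioms)
  qed
  have evM: "(\<lambda>l. l x) \<in> borel_measurable \<mu>" for x
    using eval_measurable[of x UNIV top_dual] by (simp add: measurable_cong_sets[OF setsM refl])
  have evN: "(\<lambda>l. l x) \<in> borel_measurable (\<mu>n n)" if "x \<in> fin_span \<xi> n" for x n
    using eval_measurable[OF that] by (simp add: measurable_cong_sets[OF setsN refl])
  have phi_dual: "phi \<xi> n l \<in> alg_dual (fin_span \<xi> n)" if "l \<in> top_dual" for l n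
    unfolding phi_def by (rule restrict_in_alg_dual[OF sub, where W = UNIV]) (use lin[OF that] in simp)
  have phi_meas: "phi \<xi> n \<in> measurable \<mu> (\<mu>n n)" for n
    unfolding measurable_cong_sets[OF refl setsN]
    by (rule measurable_into_eval_algebra) (auto simp: spaceM phi_dual, simp add: phi_def evM)
  have proj_meas: "proj \<xi> n m \<in> measurable (\<mu>n m) (\<mu>n n)" if "n \<le> m" for n m
    unfolding measurable_cong_sets[OF refl setsN]
  proof (rule measurable_into_eval_algebra)
    show "proj \<xi> n m l \<in> alg_dual (fin_span \<xi> n)" if "l \<in> space (\<mu>n m)" for l
      unfolding proj_def using fin_span_mono[OF \<open>n \<le> m\<close>, of \<xi>] that
      by (intro restrict_in_alg_dual[OF sub, where W = "fin_span \<xi> m"]) (simp add: spaceN)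
    show "(\<lambda>l. proj \<xi> n m l x) \<in> borel_measurable (\<mu>n m)" if "x \<in> fin_span \<xi> n" for x
      using that fin_span_mono[OF \<open>n \<le> m\<close>, of \<xi>] by (auto simp: proj_def intro!: evN)
  qed
  have distr: "distr \<mu> (\<mu>n n) (phi \<xi> n) = \<mu>n n" for n
  proof (rule measure_eq_of_same_char[where \<Omega> = "alg_dual (fin_span \<xi> n)" and V = "fin_span \<xi> n"])
    fix x assume x: "x \<in> fin_span \<xi> n"
    have "(CLINT l|distr \<mu> (\<mu>n n) (phi \<xi> n). iexp (l x)) = (CLINT l|\<mu>. iexp (phi \<xi> n l x))"
    proof (rule integral_distr[OF phi_meas])
      note [measurable] = evN[OF x]
      show "(\<lambda>l. iexp (l x)) \<in> borel_measurable (\<mu>n n)" by measurable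
    qed
    also have "\<dots> = (CLINT l|\<mu>. iexp (l x))" using x by (simp add: phi_def)
    also have "\<dots> = (CLINT l|\<mu>n n. iexp (l x))"
      using charM charN[of n] x by (simp add: gaussian_char_def)
    finally show "(CLINT l|distr \<mu> (\<mu>n n) (phi \<xi> n). iexp (l x)) = (CLINT l|\<mu>n n. iexp (l x))" .
  next
    show "finite_measure (distr \<mu> (\<mu>n n) (phi \<xi> n))" by (rule M.finite_measure_distr[OF phi_meas])
  qed (use sub alg_dualD finN setsN in auto)
  let ?L = "\<lambda>n. vimage_algebra (space \<mu>) (phi \<xi> n) (\<mu>n n)"
  have "sets \<mu> = sigma_sets (space \<mu>) (\<Union>n. sets (?L n))"
  proof
    show "sigma_sets (space \<mu>) (\<Union>n. sets (?L n)) \<subseteq> sets \<mu>"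
      by (rule sets.sigma_sets_subset) (use sets_image_in_sets[OF refl phi_meas] in blast)
    define S where "S = sigma (space \<mu>) (\<Union>n. sets (?L n))"
    have pow: "(\<Union>n. sets (?L n)) \<subseteq> Pow (space \<mu>)"
      using sets.sets_into_space[of _ "?L _"] by auto
    have setsS: "sets S = sigma_sets (space \<mu>) (\<Union>n. sets (?L n))"
      unfolding S_def by (rule sets_measure_of[OF pow])
    have spaceS: "space S = top_dual"
      unfolding S_def by (rule trans[OF space_measure_of[OF pow] spaceM])
    have ev_fin: "(\<lambda>l. l x) \<in> borel_measurable S" if x: "x \<in> fin_span \<xi> n" for x n
    proof -
      have "sets (?L n) \<subseteq> sets S" unfolding setsS by (auto intro: sigma_sets.Basic)
      moreover have "phi \<xi> n \<in> measurable (?L n) (\<mu>n n)"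
        by (rule measurable_vimage_algebra1) (auto simp: spaceM spaceN phi_dual)
      ultimately have "phi \<xi> n \<in> measurable S (\<mu>n n)"
        using measurable_mono[OF order_refl refl, of "?L n" S "\<mu>n n"] spaceS spaceM by auto
      from measurable_compose[OF this evN[OF x]] show ?thesis using x by (simp add: phi_def)
    qed
    have ev: "(\<lambda>l. l x) \<in> borel_measurable S" for x
    proof -
      have "x \<in> closure (span (range \<xi>))" using \<xi> by (simp add: complete_system_def)
      then obtain y where y: "\<And>n::nat. y n \<in> span (range \<xi>)" "y \<longlonglongrightarrow> x"
        using frechet_closure_sequential[OF E] by blast
      show ?thesis
      proof (rule borel_measurable_LIMSEQ_real)
        show "(\<lambda>l. l (y n)) \<in> borel_measurable S" for n
          using y(1)[of n] ev_fin unfolding span_range_eq_UN_fin_span by blast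
        show "(\<lambda>n. l (y n)) \<longlonglongrightarrow> l x" if "l \<in> space S" for l
        proof -
          have "l \<in> top_dual" using that spaceS by blast
          then have "continuous_on UNIV l" by (simp add: top_dual_def)
          from continuous_on_tendsto_compose[OF this y(2)] show ?thesis by simp
        qed
      qed
    qed
    have ident: "(\<lambda>l. l) \<in> measurable S (eval_algebra top_dual UNIV)"
      by (rule measurable_into_eval_algebra) (use spaceS ev in blast)+
    have "A \<in> sets S" if A: "A \<in> sets \<mu>" for A
    proof -
      have "A \<inter> top_dual \<in> sets S"
        using measurable_sets[OF ident, of A] A setsM by (simp add: spaceS)
      moreover have "A \<inter> top_dual = A" using sets.sets_into_space[OF A] spaceM by blast
      ultimately show ?thesis by (simp only:)
    qed
    then show "sets \<mu> \<subseteq> sigma_sets (space \<mu>) (\<Union>n. sets (?L n))"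
      unfolding setsS[symmetric] by (rule subsetI)
  qed
  moreover have "proj \<xi> n m (phi \<xi> m l) = phi \<xi> n l" if "n \<le> m" for n m l
    unfolding proj_def phi_def using fin_span_mono[OF that, of \<xi>] by (auto simp: restrict_def fun_eq_iff)
  ultimately show ?thesis
    by unfold_locales (use phi_meas proj_meas distr in auto)
qed

theorem theorem4p6:
  fixes \<mu> :: "('e::{real_vector,topological_space} \<Rightarrow> real) measure"
    and C :: "'e \<Rightarrow> 'e \<Rightarrow> real"
    and \<xi> :: "nat \<Rightarrow> 'e"
    and \<mu>n :: "nat \<Rightarrow> ('e \<Rightarrow> real) measure"
    and p :: real
  assumes "frechet_space TYPE('e)"
    and "nuclear_space TYPE('e)"
    and "infinite_dimensional TYPE('e)"
    and "gaussian_measure C \<mu>"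
    and "1 \<le> p"
    and "complete_system \<xi>"
    and "\<forall>n. fin_dim_gaussian C (fin_span \<xi> n) (\<mu>n n)"
  shows
    "(\<forall>f\<in>co_Cauchy p \<mu>n (proj \<xi>).
        Lp_limit p \<mu> (\<lambda>n. Lp_pullback p \<mu> (phi \<xi> n) (f n))
          (F_op p \<xi> \<mu> (co_class p \<mu>n (proj \<xi>) f))) \<and>
     isometric_isomorphism (co_Lp p \<mu>n (proj \<xi>)) (Lp p \<mu>) (F_op p \<xi> \<mu>) \<and>
     (\<forall>f\<in>vcarrier (Lp p \<mu>).
        fin_cond_exp p \<xi> \<mu> \<mu>n f \<in> co_Cauchy p \<mu>n (proj \<xi>) \<and>
        inv_into (vcarrier (co_Lp p \<mu>n (proj \<xi>))) (F_op p \<xi> \<mu>) f =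
          co_class p \<mu>n (proj \<xi>) (fin_cond_exp p \<xi> \<mu> \<mu>n f)) \<and>
     (inj \<xi> \<and> independent (range \<xi>) \<longrightarrow>
       (\<forall>f\<in>vcarrier (Lp 1 \<mu>).
          (\<exists>fn. (\<forall>n. fn n \<in> vcarrier (Lp 1 (\<mu>n n))) \<and> integral_formula C \<xi> \<mu> f fn) \<and>
          (\<forall>n. fin_cond_exp 1 \<xi> \<mu> \<mu>n f n \<in> vcarrier (Lp 1 (\<mu>n n))) \<and>
          integral_formula C \<xi> \<mu> f (fin_cond_exp 1 \<xi> \<mu> \<mu>n f)))"
proof -
  note p = \<open>1 \<le> p\<close>
  have \<mu>n: "fin_dim_gaussian C (fin_span \<xi> n) (\<mu>n n)" for n using assms(7) by blast
  interpret T: measure_tower \<mu> \<mu>n "phi \<xi>" "proj \<xi>"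
    by (rule gaussian_measure_tower[OF assms(1,4,6) \<mu>n])
  have C: "inner_product C" and space: "space \<mu> = top_dual"
    using assms(4) sets_eq_imp_space_eq[of \<mu> cylinder_algebra]
    by (auto simp: gaussian_measure_def cylinder_algebra_eval)
  \<comment> \<open>The operators of the statement are those of the tower.\<close>
  have F: "F_op q \<xi> \<mu> = T.limit_map q" for q
    by (simp add: fun_eq_iff F_op_def T.limit_map_def T.tower_limit_def)
  have level: "fin_algebra \<xi> n = T.level n" for n
    using \<mu>n[of n] by (simp add: fin_algebra_def T.level_def vimage_algebra_def space fin_dim_gaussian_def)
  have E: "fin_cond_exp q \<xi> \<mu> \<mu>n f = T.level_exp q f" for q f
    by (simp add: fun_eq_iff fin_cond_exp_def T.level_exp_def level)
  have formula: "integral_formula C \<xi> \<mu> f (T.level_exp 1 f)"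
    if f: "f \<in> vcarrier (Lp 1 \<mu>)" and indep: "inj \<xi> \<and> independent (range \<xi>)" for f
    unfolding integral_formula_def
  proof (intro ballI allI impI)
    fix v u assume v: "v \<in> f" and u: "\<forall>n. u n \<in> T.level_exp 1 f n"
    have "gaussian_integral C \<xi> n (u n) = (LINT l|\<mu>. v l)" for n
    proof -
      have un: "u n \<in> T.level_exp 1 f n" using u by blast
      have "u n \<in> borel_measurable (\<mu>n n)"
        using Lp_carrier_memD(1)[OF T.level_exp_carrier(1)[OF order_refl f] un] by (rule Lp_fun_measurable)
      then have "gaussian_integral C \<xi> n (u n) = integral\<^sup>L (\<mu>n n) (u n)"
        by (rule gaussian_integral_eq[OF C \<mu>n conjunct1[OF indep] conjunct2[OF indep]])
      also have "\<dots> = (LINT l|\<mu>. v l)" by (rule T.integral_level_exp[OF order_refl f v un])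
      finally show ?thesis .
    qed
    then show "(\<lambda>n. gaussian_integral C \<xi> n (u n)) \<longlonglongrightarrow> (LINT l|\<mu>. v l)" by simp
  qed
  show ?thesis
    unfolding F E
    using T.limit_map_tower_limit[OF p] T.limit_map_isometric_isomorphism[OF p]
      T.level_exp_co_Cauchy[OF p] T.inv_limit_map[OF p] T.level_exp_carrier(1)[OF order_refl] formula
    unfolding T.tower_limit_def by blast
qed

end
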